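(* Let $n\ge 2$ be an integer and let $F\in\mathfrak{G}_n$ have linear part of determinant $1$. Let $c=\lceil \log_2 n\rceil$. Then: (1) $F$ is the product of $1+3c$ reversible elements of $\mathfrak{G}_n$. (2) $F$ is the product of $8+6c$ involutions of $\mathfrak{G}_n$.
   Context: For $n\in\mathbb{N}$, let $\mathfrak{G}_n$ denote the group, under formal composition, of formally invertible formal maps of $(\mathbb{C}^n,0)$: its elements are $n$-tuples $F=(F_{,1},\dots,F_{,n})$ of formal power series in $n$ commuting variables with complex coefficients and zero constant terms, whose linear part $L(F)$ (the homogeneous degree-one part of $F$, viewed as an $n\times n$ complex matrix) lies in $\mathrm{GL}(n,\mathbb{C})$. The series need not converge. An element $g$ of a group $G$ is reversible if there is $h\in G$ with $h^{-1}gh=g^{-1}$. An element is an involution if it equals its own inverse (so the identity counts as an involution and as a reversible element). *)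

theory Defs
  imports
    "Jordan_Normal_Form.Determinant"
    "HOL-Algebra.Group"
    "HOL-Library.Poly_Mapping"
    "HOL-Library.Groups_Big_Fun"
begin

section \<open>Formal power series in several variables\<close>

text \<open>
  A monomial in the variables \<open>X\<^sub>0, X\<^sub>1, \<dots>\<close> is its finitely supported exponent vector, and a series
  is an arbitrary family of coefficients. The number of variables is not part of the type: the
  series in \<open>n\<close> variables are those in \<open>mfps_carrier n\<close>, which only involve \<open>X\<^sub>0, \<dots>, X\<^sub>n\<^sub>-\<^sub>1\<close>.
\<close>

type_synonym monomial = "nat \<Rightarrow>\<^sub>0 nat"

typedef 'a mfps = "UNIV :: (monomial \<Rightarrow> 'a) set"
  morphisms mcoeff MFPS
  by simp

lemma mcoeff_MFPS [simp]: "mcoeff (MFPS f) = f"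
  by (simp add: MFPS_inverse)

lemma mfps_eq_iff: "f = g \<longleftrightarrow> (\<forall>m. mcoeff f m = mcoeff g m)"
  by (metis mcoeff_inject ext)

lemma mfps_eqI: "(\<And>m. mcoeff f m = mcoeff g m) \<Longrightarrow> f = g"
  by (simp add: mfps_eq_iff)

definition mdegree :: "monomial \<Rightarrow> nat" where
  "mdegree m = (\<Sum>i\<in>Poly_Mapping.keys m. Poly_Mapping.lookup m i)"

definition decomps :: "monomial \<Rightarrow> (monomial \<times> monomial) set" where
  "decomps m = {(a, b). a + b = m}"

lemma finite_bounded_monomials:
  assumes "finite A"
  shows "finite {m :: monomial. Poly_Mapping.keys m \<subseteq> A \<and> (\<forall>i. Poly_Mapping.lookup m i \<le> d)}"
    (is "finite ?M")
proof -
  have "Poly_Mapping.lookup ` ?M \<subseteq> {f. \<forall>i. (i \<in> A \<longrightarrow> f i \<in> {..d}) \<and> (i \<notin> A \<longrightarrow> f i = 0)}"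
    by (auto simp: in_keys_iff)
  moreover have "finite {f :: nat \<Rightarrow> nat. \<forall>i. (i \<in> A \<longrightarrow> f i \<in> {..d}) \<and> (i \<notin> A \<longrightarrow> f i = 0)}"
    by (rule finite_set_of_finite_funs) (use assms in auto)
  ultimately have "finite (Poly_Mapping.lookup ` ?M)"
    by (rule finite_subset)
  moreover have "inj_on Poly_Mapping.lookup ?M"
    by (meson inj_onI lookup_inject)
  ultimately show ?thesis
    by (rule finite_imageD)
qed

lemma mdegree_superset:
  assumes "finite A" "Poly_Mapping.keys m \<subseteq> A"
  shows "mdegree m = (\<Sum>i\<in>A. Poly_Mapping.lookup m i)"
  unfolding mdegree_def
  by (rule sum.mono_neutral_left) (use assms in \<open>auto simp: in_keys_iff\<close>)

lemma mdegree_add: "mdegree (a + b) = mdegree a + mdegree b"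
proof -
  let ?A = "Poly_Mapping.keys a \<union> Poly_Mapping.keys b"
  have "Poly_Mapping.keys (a + b) \<subseteq> ?A"
    by (auto simp: in_keys_iff lookup_add)
  thus ?thesis
    by (simp add: mdegree_superset[of ?A] lookup_add sum.distrib)
qed

lemma mdegree_0 [simp]: "mdegree 0 = 0"
  by (simp add: mdegree_def)

lemma lookup_le_mdegree: "Poly_Mapping.lookup m i \<le> mdegree m"
proof (cases "i \<in> Poly_Mapping.keys m")
  case True
  thus ?thesis
    unfolding mdegree_def by (intro member_le_sum) auto
qed (simp add: in_keys_iff)

lemma mdegree_eq_0_iff: "mdegree m = 0 \<longleftrightarrow> m = 0"
  by (metis lookup_le_mdegree le_zero_eq mdegree_0 poly_mapping_eqI lookup_zero)

lemma finite_decomps: "finite (decomps m)"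
proof -
  let ?M = "{k :: monomial. Poly_Mapping.keys k \<subseteq> Poly_Mapping.keys m \<and>
               (\<forall>i. Poly_Mapping.lookup k i \<le> mdegree m)}"
  have "decomps m \<subseteq> ?M \<times> ?M"
    by (auto simp: decomps_def in_keys_iff lookup_add mdegree_add
             intro: order_trans[OF lookup_le_mdegree])
  thus ?thesis
    by (rule finite_subset) (auto intro!: finite_cartesian_product finite_bounded_monomials)
qed

instantiation mfps :: (comm_ring_1) comm_ring_1
begin

definition zero_mfps :: "'a mfps" where
  "0 = MFPS (\<lambda>_. 0)"

definition one_mfps :: "'a mfps" where
  "1 = MFPS (\<lambda>m. if m = 0 then 1 else 0)"

definition plus_mfps :: "'a mfps \<Rightarrow> 'a mfps \<Rightarrow> 'a mfps" where
  "f + g = MFPS (\<lambda>m. mcoeff f m + mcoeff g m)"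

definition minus_mfps :: "'a mfps \<Rightarrow> 'a mfps \<Rightarrow> 'a mfps" where
  "f - g = MFPS (\<lambda>m. mcoeff f m - mcoeff g m)"

definition uminus_mfps :: "'a mfps \<Rightarrow> 'a mfps" where
  "- f = MFPS (\<lambda>m. - mcoeff f m)"

definition times_mfps :: "'a mfps \<Rightarrow> 'a mfps \<Rightarrow> 'a mfps" where
  "f * g = MFPS (\<lambda>m. \<Sum>(a, b)\<in>decomps m. mcoeff f a * mcoeff g b)"

instance
proof
  fix f g h :: "'a mfps"
  show "f * g * h = f * (g * h)"
  proof (rule mfps_eqI)
    fix m
    have "mcoeff (f * g * h) m =
        (\<Sum>((s, c), (a, b))\<in>(SIGMA p:decomps m. decomps (fst p)). mcoeff f a * mcoeff g b * mcoeff h c)"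
      by (simp add: times_mfps_def sum_distrib_right case_prod_unfold)
        (simp add: sum.Sigma finite_decomps case_prod_unfold)
    also have "\<dots> =
        (\<Sum>((a, s), (b, c))\<in>(SIGMA p:decomps m. decomps (snd p)). mcoeff f a * (mcoeff g b * mcoeff h c))"
      by (rule sum.reindex_bij_witness[where
            i = "\<lambda>((a, s), (b, c)). ((a + b, c), (a, b))" and
            j = "\<lambda>((s, c), (a, b)). ((a, b + c), (b, c))"])
        (auto simp: decomps_def add.assoc mult.assoc)
    also have "\<dots> = mcoeff (f * (g * h)) m"
      by (simp add: times_mfps_def sum_distrib_left case_prod_unfold)
        (simp add: sum.Sigma finite_decomps case_prod_unfold)
    finally show "mcoeff (f * g * h) m = mcoeff (f * (g * h)) m" .
  qed
  show "f * g = g * f"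
  proof (rule mfps_eqI)
    fix m
    have "(\<Sum>(a, b)\<in>decomps m. mcoeff f a * mcoeff g b) =
          (\<Sum>(a, b)\<in>decomps m. mcoeff g a * mcoeff f b)"
      by (rule sum.reindex_bij_witness[where i = "\<lambda>(a, b). (b, a)" and j = "\<lambda>(a, b). (b, a)"])
        (auto simp: decomps_def ac_simps)
    thus "mcoeff (f * g) m = mcoeff (g * f) m"
      by (simp add: times_mfps_def)
  qed
  show "1 * f = f"
  proof (rule mfps_eqI)
    fix m
    have "mcoeff (1 * f) m =
        (\<Sum>(a, b)\<in>decomps m. (if a = 0 then 1 else 0) * mcoeff f b)"
      by (simp add: times_mfps_def one_mfps_def)
    also have "\<dots> = (\<Sum>(a, b)\<in>{(0 :: monomial, m)}. (if a = 0 then 1 else 0) * mcoeff f b)"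
      by (rule sum.mono_neutral_right[OF finite_decomps])
        (auto simp: decomps_def split: if_splits)
    finally show "mcoeff (1 * f) m = mcoeff f m"
      by simp
  qed
  show "(f + g) * h = f * h + g * h"
    by (rule mfps_eqI)
      (simp add: times_mfps_def plus_mfps_def distrib_right sum.distrib case_prod_unfold)
  show "(0 :: 'a mfps) \<noteq> 1"
    by (auto simp: zero_mfps_def one_mfps_def mfps_eq_iff)
qed (auto intro!: mfps_eqI simp: zero_mfps_def plus_mfps_def minus_mfps_def uminus_mfps_def)

end

lemma mcoeff_0 [simp]: "mcoeff 0 m = 0"
  and mcoeff_1: "mcoeff 1 m = (if m = 0 then 1 else 0)"
  and mcoeff_add [simp]: "mcoeff (f + g) m = mcoeff f m + mcoeff g m"
  and mcoeff_diff [simp]: "mcoeff (f - g) m = mcoeff f m - mcoeff g m"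
  and mcoeff_uminus [simp]: "mcoeff (- f) m = - mcoeff f m"
  and mcoeff_mult: "mcoeff (f * g) m = (\<Sum>(a, b)\<in>decomps m. mcoeff f a * mcoeff g b)"
  by (simp_all add: zero_mfps_def one_mfps_def plus_mfps_def minus_mfps_def uminus_mfps_def
        times_mfps_def)

definition mvar :: "nat \<Rightarrow> 'a :: comm_ring_1 mfps" where
  "mvar i = MFPS (\<lambda>m. if m = Poly_Mapping.single i 1 then 1 else 0)"

definition mfps_carrier :: "nat \<Rightarrow> 'a :: comm_ring_1 mfps set" where
  "mfps_carrier n = {f. \<forall>m. mcoeff f m \<noteq> 0 \<longrightarrow> Poly_Mapping.keys m \<subseteq> {..<n}}"


section \<open>Formal composition\<close>

definition monom_subst :: "monomial \<Rightarrow> 'a :: comm_ring_1 mfps vec \<Rightarrow> 'a mfps" where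
  "monom_subst k G = (\<Prod>i<dim_vec G. (G $ i) ^ Poly_Mapping.lookup k i)"

text \<open>
  Each coefficient of the substitution of \<open>G\<close> into \<open>f = \<Sum>\<^sub>k f\<^sub>k X\<^sup>k\<close> is a sum over all monomials \<open>k\<close>;
  it is finite because the entries of \<open>G\<close> have no constant term (see \<open>finite_mfps_subst\<close> below).
\<close>

definition mfps_subst :: "'a :: comm_ring_1 mfps \<Rightarrow> 'a mfps vec \<Rightarrow> 'a mfps" where
  "mfps_subst f G = MFPS (\<lambda>m. Sum_any (\<lambda>k. mcoeff f k * mcoeff (monom_subst k G) m))"

definition order_ge :: "nat \<Rightarrow> 'a :: comm_ring_1 mfps \<Rightarrow> bool" where
  "order_ge d f \<longleftrightarrow> (\<forall>m. mdegree m < d \<longrightarrow> mcoeff f m = 0)"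

lemma order_ge_0 [simp]: "order_ge 0 f"
  by (simp add: order_ge_def)

lemma order_ge_mult:
  assumes "order_ge d f" "order_ge e g"
  shows "order_ge (d + e) (f * g)"
  unfolding order_ge_def
proof (intro allI impI)
  fix m assume m: "mdegree m < d + e"
  have "mcoeff f a * mcoeff g b = 0" if "(a, b) \<in> decomps m" for a b
  proof -
    have "mdegree a + mdegree b < d + e"
      using that m by (auto simp: decomps_def mdegree_add)
    hence "mdegree a < d \<or> mdegree b < e"
      by linarith
    thus ?thesis
      using assms by (auto simp: order_ge_def)
  qed
  thus "mcoeff (f * g) m = 0"
    by (auto simp: mcoeff_mult intro!: sum.neutral)
qed

lemma order_ge_power:
  assumes "order_ge 1 f"
  shows "order_ge k (f ^ k)"
proof (induction k)
  case (Suc k)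
  thus ?case
    using order_ge_mult[OF assms Suc.IH] by simp
qed simp

lemma order_ge_prod:
  assumes "finite A" "\<And>i. i \<in> A \<Longrightarrow> order_ge (d i) (f i)"
  shows "order_ge (sum d A) (prod f A)"
  using assms by (induction A rule: finite_induct) (simp_all add: order_ge_mult)

lemma finite_mfps_subst:
  assumes "f \<in> mfps_carrier n" and "dim_vec G = n" and "\<And>i. i < n \<Longrightarrow> mcoeff (G $ i) 0 = 0"
  shows "finite {k. mcoeff f k * mcoeff (monom_subst k G) m \<noteq> 0}"
proof (rule finite_subset)
  show "finite {k. Poly_Mapping.keys k \<subseteq> {..<n} \<and> (\<forall>i. Poly_Mapping.lookup k i \<le> mdegree m)}"
    by (rule finite_bounded_monomials) simp
  have "order_ge (\<Sum>i<n. Poly_Mapping.lookup k i) (monom_subst k G)" for k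
    unfolding monom_subst_def assms(2)
    by (intro order_ge_prod order_ge_power) (auto simp: order_ge_def mdegree_eq_0_iff assms(3))
  hence "mdegree k \<le> mdegree m"
    if "Poly_Mapping.keys k \<subseteq> {..<n}" "mcoeff (monom_subst k G) m \<noteq> 0" for k
    using that mdegree_superset[of "{..<n}" k]
    by (metis order_ge_def finite_lessThan not_le)
  moreover have "Poly_Mapping.keys k \<subseteq> {..<n}" if "mcoeff f k \<noteq> 0" for k
    using that assms(1) by (auto simp: mfps_carrier_def)
  ultimately have "Poly_Mapping.keys k \<subseteq> {..<n} \<and> mdegree k \<le> mdegree m"
    if "mcoeff f k * mcoeff (monom_subst k G) m \<noteq> 0" for k
    using that by (metis mult_zero_left mult_zero_right)
  thus "{k. mcoeff f k * mcoeff (monom_subst k G) m \<noteq> 0}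
      \<subseteq> {k. Poly_Mapping.keys k \<subseteq> {..<n} \<and> (\<forall>i. Poly_Mapping.lookup k i \<le> mdegree m)}"
    by (blast intro: order_trans[OF lookup_le_mdegree])
qed


section \<open>The group of invertible formal maps\<close>

definition linear_part :: "nat \<Rightarrow> complex mfps vec \<Rightarrow> complex mat" where
  "linear_part n F = mat n n (\<lambda>(i, j). mcoeff (F $ i) (Poly_Mapping.single j 1))"

definition formal_maps :: "nat \<Rightarrow> complex mfps vec monoid" where
  "formal_maps n = \<lparr>
     carrier = {F \<in> carrier_vec n.
       (\<forall>i<n. F $ i \<in> mfps_carrier n \<and> mcoeff (F $ i) 0 = 0) \<and> invertible_mat (linear_part n F)},
     monoid.mult = (\<lambda>F G. vec n (\<lambda>i. mfps_subst (F $ i) G)),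
     one = vec n mvar\<rparr>"


section \<open>Reversible elements and involutions\<close>

definition reversible :: "('a, 'b) monoid_scheme \<Rightarrow> 'a \<Rightarrow> bool" where
  "reversible G g \<longleftrightarrow>
     g \<in> carrier G \<and> (\<exists>h\<in>carrier G. inv\<^bsub>G\<^esub> h \<otimes>\<^bsub>G\<^esub> g \<otimes>\<^bsub>G\<^esub> h = inv\<^bsub>G\<^esub> g)"

definition involution :: "('a, 'b) monoid_scheme \<Rightarrow> 'a \<Rightarrow> bool" where
  "involution G g \<longleftrightarrow> g \<in> carrier G \<and> inv\<^bsub>G\<^esub> g = g"

definition product_of :: "('a, 'b) monoid_scheme \<Rightarrow> nat \<Rightarrow> ('a \<Rightarrow> bool) \<Rightarrow> 'a \<Rightarrow> bool" where
  "product_of G k P g \<longleftrightarrow>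
     (\<exists>gs. length gs = k \<and> (\<forall>x\<in>set gs. P x) \<and> g = foldr (\<otimes>\<^bsub>G\<^esub>) gs \<one>\<^bsub>G\<^esub>)"

end

theory Submission
  imports Defs
    "Jordan_Normal_Form.Schur_Decomposition"
    "HOL-Computational_Algebra.Formal_Power_Series"
begin

text \<open>
  Call a product of two involutions strongly reversible; such elements are closed under conjugation,
  and it suffices to write \<open>F\<close> as a product of \<open>2 + 2 c\<close> of them. After conjugating the linear part of
  \<open>F\<close> to an upper triangular matrix, a diagonal factor of determinant \<open>1\<close> can be split off so that the
  eigenvalues of what remains satisfy no multiplicative relation except that their product is \<open>1\<close>.
  Its Poincare-Dulac normal form then multiplies each \<open>x\<^sub>i\<close> by a series \<open>w\<^sub>i\<close> in \<open>p = x\<^sub>0 \<cdots> x\<^sub>n\<^sub>-\<^sub>1\<close>.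

  If the product \<open>\<psi>\<close> of the \<open>w\<^sub>i\<close> is \<open>1\<close>, pairing the variables \<open>c\<close> times writes the map as a product of
  \<open>c\<close> maps that are inverted by a permutation of the variables; this also covers the diagonal factor.
  In general a map acting on \<open>x\<^sub>0\<close> only remains, under which \<open>p\<close> becomes \<open>p \<psi>(p)\<close>. If
  \<open>\<psi>(p) = 1 + p + p\<^sup>2 + \<cdots>\<close> up to order two, it is conjugate to the one with \<open>p / (1 - p)\<close>, which is
  strongly reversible. One further factor \<open>H \<sigma> H\<^sup>-\<^sup>1 \<sigma>\<close> with an involution \<open>\<sigma>\<close> mixing \<open>x\<^sub>0\<close> and \<open>x\<^sub>1\<close> serves
  to prescribe these two coefficients of \<open>\<psi>\<close>.
\<close>


section \<open>Coefficients and substitution\<close>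

text \<open>The obstacle is the resonant terms. As the eigenvalues multiply to 1, every
  \<open>x_i p^k\<close> is resonant and survives the linearised conjugacy equation; \<psi> records
  the joint effect of these terms on \<open>p\<close>. The series \<open>z \<psi>(z)\<close> is a
  parabolic germ in one variable, and germs \<open>z + z^2 + b z^3 + ...\<close> are classified up
  to formal conjugacy by \<open>b\<close>. The model with \<open>b = 1\<close> is
  \<open>z / (1 - z)\<close>, the composite of the involutions \<open>- z / (1 + z)\<close> and
  \<open>- z\<close>; hence exactly the coefficients one and two of \<psi> have to be prescribed.

  The factor that prescribes them must itself be a product of two involutions. A permutation of the
  variables in the role of \<sigma> would not help: it only moves resonant coefficients from one
  variable to another, and to first order \<psi> stays the same. The chosen \<sigma> instead turns a
  nonresonant term of \<open>H\<close> into a resonant one.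

  The count \<open>2 + 2 c\<close> consists of \<open>c\<close> for the diagonal factor, 1 for the
  factor with \<sigma>, 1 for the map on \<open>x_0\<close> and \<open>c\<close> for the
  pairing.\<close>

definition mmonom :: "'a :: comm_ring_1 \<Rightarrow> monomial \<Rightarrow> 'a mfps" where
  "mmonom c a = MFPS (\<lambda>m. if m = a then c else 0)"

lemma mcoeff_mmonom: "mcoeff (mmonom c a) m = (if m = a then c else 0)"
  by (simp add: mmonom_def)

lemma mvar_eq_mmonom: "mvar i = mmonom 1 (Poly_Mapping.single i 1)"
  by (simp add: mvar_def mmonom_def)

lemma mcoeff_mvar: "mcoeff (mvar i) m = (if m = Poly_Mapping.single i 1 then 1 else 0)"
  by (simp add: mvar_def)

lemma one_eq_mmonom: "1 = mmonom 1 0"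
  by (rule mfps_eqI) (simp add: mcoeff_1 mcoeff_mmonom)

lemma mcoeff_mmonom_mult_add: "mcoeff (mmonom c a * f) (a + b) = c * mcoeff f b"
proof -
  have "mcoeff (mmonom c a * f) (a + b)
      = (\<Sum>(u, v)\<in>decomps (a + b). (if u = a then c else 0) * mcoeff f v)"
    by (simp add: mcoeff_mult mcoeff_mmonom)
  also have "\<dots> = (\<Sum>(u, v)\<in>{(a, b)}. (if u = a then c else 0) * mcoeff f v)"
    by (rule sum.mono_neutral_right[OF finite_decomps]) (auto simp: decomps_def split: if_splits)
  finally show ?thesis by simp
qed

lemma mcoeff_mmonom_mult_eq_0:
  assumes "\<And>b. m \<noteq> a + b"
  shows "mcoeff (mmonom c a * f) m = 0"
  unfolding mcoeff_mult
  by (rule sum.neutral) (use assms in \<open>auto simp: decomps_def mcoeff_mmonom\<close>)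

text \<open>Scalars act throughout as the constant series \<open>mmonom c 0\<close>, so that they
  take part in products and substitutions like any other series.\<close>

lemma mcoeff_const_mult [simp]: "mcoeff (mmonom c 0 * f) m = c * mcoeff f m"
  using mcoeff_mmonom_mult_add[of c 0 f m] by simp

lemma mmonom_mult: "mmonom c a * mmonom d b = mmonom (c * d) (a + b)"
proof (rule mfps_eqI)
  fix m
  show "mcoeff (mmonom c a * mmonom d b) m = mcoeff (mmonom (c * d) (a + b)) m"
  proof (cases "\<exists>e. m = a + e")
    case True
    then show ?thesis by (auto simp: mcoeff_mmonom_mult_add) (auto simp: mcoeff_mmonom)
  next
    case False
    then show ?thesis by (auto simp: mcoeff_mmonom_mult_eq_0 mcoeff_mmonom)
  qed
qed

lemma mcoeff_sum: "mcoeff (sum f A) m = (\<Sum>i\<in>A. mcoeff (f i) m)"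
  by (induction A rule: infinite_finite_induct) auto

lemma mcoeff_mult_0: "mcoeff (f * g) 0 = mcoeff f 0 * mcoeff g 0"
proof -
  have "decomps 0 = {(0, 0)}"
    by (auto simp: decomps_def plus_poly_mapping.rep_eq poly_mapping_eq_iff fun_eq_iff)
  then show ?thesis by (simp add: mcoeff_mult)
qed

lemma mdegree_single [simp]: "mdegree (Poly_Mapping.single i c) = c"
  by (simp add: mdegree_def)

lemma keys_add_nat:
  "Poly_Mapping.keys (a + b :: monomial) = Poly_Mapping.keys a \<union> Poly_Mapping.keys b"
  by (auto simp: in_keys_iff lookup_add)

lemma single_eq_single_iff [simp]:
  "Poly_Mapping.single i (Suc 0) = Poly_Mapping.single j (Suc 0) \<longleftrightarrow> i = j"
  by (metis lookup_single_eq lookup_single_not_eq nat.distinct(1))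

lemma single_Suc_0_neq_0 [simp]: "Poly_Mapping.single i (Suc 0) \<noteq> 0" "0 \<noteq> Poly_Mapping.single i (Suc 0)"
  by (metis lookup_single_eq lookup_zero nat.distinct(1))+

lemma mdegree_eq_1E:
  assumes "mdegree m = 1"
  obtains i where "m = Poly_Mapping.single i 1" "i \<in> Poly_Mapping.keys m"
proof -
  obtain i where i: "i \<in> Poly_Mapping.keys m"
    using assms by (metis all_not_in_conv keys_eq_empty mdegree_0 zero_neq_one)
  have "m = Poly_Mapping.single i 1"
  proof (rule poly_mapping_eqI)
    fix j
    have sub: "Poly_Mapping.keys m \<subseteq> insert i (insert j (Poly_Mapping.keys m))" by auto
    have "(\<Sum>l\<in>{i, j}. Poly_Mapping.lookup m l) \<le> mdegree m"
      unfolding mdegree_superset[OF _ sub, simplified] by (rule sum_mono2) auto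
    then show "Poly_Mapping.lookup m j = Poly_Mapping.lookup (Poly_Mapping.single i 1) j"
      using i assms lookup_le_mdegree[of m i]
      by (cases "i = j") (auto simp: lookup_single in_keys_iff)
  qed
  with i show ?thesis using that by blast
qed

text \<open>Adding one variable at a time matches the multiplicativity of
  \<open>monom_subst\<close>; the set \<open>A\<close> keeps the variables in range during the
  induction.\<close>

lemma monomial_induct [consumes 1, case_names zero step]:
  assumes "Poly_Mapping.keys k \<subseteq> A"
    and "P 0"
    and "\<And>i k. i \<in> A \<Longrightarrow> Poly_Mapping.keys k \<subseteq> A \<Longrightarrow> P k \<Longrightarrow> P (Poly_Mapping.single i 1 + k :: monomial)"
  shows "P k"
  using assms(1)
proof (induction "mdegree k" arbitrary: k)
  case 0
  then show ?case using assms(2) by (simp add: mdegree_eq_0_iff)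
next
  case (Suc d)
  obtain i where i: "i \<in> Poly_Mapping.keys k"
    using Suc.hyps(2) by (metis all_not_in_conv keys_eq_empty mdegree_0 nat.distinct(1))
  define k' where "k' = k - Poly_Mapping.single i 1"
  have k: "k = Poly_Mapping.single i 1 + k'"
    by (rule poly_mapping_eqI)
      (use i in \<open>auto simp: k'_def lookup_add lookup_minus lookup_single in_keys_iff when_def\<close>)
  have "Poly_Mapping.keys k' \<subseteq> A" "mdegree k' = d"
    using Suc.prems Suc.hyps(2) by (auto simp: k keys_add_nat mdegree_add)
  then show ?case
    unfolding k using Suc.hyps(1) Suc.prems i by (intro assms(3)) auto
qed

section \<open>Order of vanishing and closure of the series in n variables\<close>

lemma order_ge_mono: "order_ge d f \<Longrightarrow> e \<le> d \<Longrightarrow> order_ge e f"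
  by (auto simp: order_ge_def)

lemma order_ge_add: "order_ge d f \<Longrightarrow> order_ge d g \<Longrightarrow> order_ge d (f + g)"
  by (auto simp: order_ge_def)

lemma order_ge_zero [simp]: "order_ge d 0"
  by (simp add: order_ge_def)

lemma order_ge_diff_commute: "order_ge d (f - g) \<longleftrightarrow> order_ge d (g - f)"
  unfolding order_ge_def mcoeff_diff right_minus_eq by metis

lemma order_ge_1_iff: "order_ge 1 f \<longleftrightarrow> mcoeff f 0 = 0"
  by (auto simp: order_ge_def mdegree_eq_0_iff)

lemma order_ge_mmonom: "order_ge (mdegree a) (mmonom c a)"
  by (auto simp: order_ge_def mcoeff_mmonom)

lemma mfps_carrierI: "(\<And>m. mcoeff f m \<noteq> 0 \<Longrightarrow> Poly_Mapping.keys m \<subseteq> {..<n}) \<Longrightarrow> f \<in> mfps_carrier n"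
  by (simp add: mfps_carrier_def)

lemma mfps_carrierD: "f \<in> mfps_carrier n \<Longrightarrow> \<not> Poly_Mapping.keys m \<subseteq> {..<n} \<Longrightarrow> mcoeff f m = 0"
  by (auto simp: mfps_carrier_def)

lemma zero_mfps_carrier [simp]: "0 \<in> mfps_carrier n"
  by (simp add: mfps_carrier_def)

lemma mmonom_carrier: "Poly_Mapping.keys a \<subseteq> {..<n} \<Longrightarrow> mmonom c a \<in> mfps_carrier n"
  by (auto simp: mfps_carrier_def mcoeff_mmonom)

lemma const_mfps_carrier [simp]: "mmonom c 0 \<in> mfps_carrier n"
  by (simp add: mmonom_carrier)

lemma one_mfps_carrier [simp]: "1 \<in> mfps_carrier n"
  by (simp add: one_eq_mmonom)

lemma mvar_carrier [simp]: "i < n \<Longrightarrow> mvar i \<in> mfps_carrier n"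
  by (simp add: mvar_eq_mmonom mmonom_carrier)

lemma add_mfps_carrier [simp]:
  "f \<in> mfps_carrier n \<Longrightarrow> g \<in> mfps_carrier n \<Longrightarrow> f + g \<in> mfps_carrier n"
  by (intro mfps_carrierI) (metis mfps_carrierD mcoeff_add add_0)

lemma uminus_mfps_carrier [simp]: "f \<in> mfps_carrier n \<Longrightarrow> - f \<in> mfps_carrier n"
  by (auto simp: mfps_carrier_def)

lemma diff_mfps_carrier [simp]:
  "f \<in> mfps_carrier n \<Longrightarrow> g \<in> mfps_carrier n \<Longrightarrow> f - g \<in> mfps_carrier n"
  using add_mfps_carrier[of f n "- g"] by simp

lemma mult_mfps_carrier [simp]:
  assumes "f \<in> mfps_carrier n" "g \<in> mfps_carrier n"
  shows "f * g \<in> mfps_carrier n"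
proof (rule mfps_carrierI)
  fix m assume "mcoeff (f * g) m \<noteq> 0"
  then obtain p where "p \<in> decomps m" "mcoeff f (fst p) * mcoeff g (snd p) \<noteq> 0"
    unfolding mcoeff_mult case_prod_unfold by (meson sum.neutral)
  then obtain a b where "m = a + b" "mcoeff f a * mcoeff g b \<noteq> 0"
    by (auto simp: decomps_def)
  moreover from this have "mcoeff f a \<noteq> 0" "mcoeff g b \<noteq> 0" by auto
  ultimately show "Poly_Mapping.keys m \<subseteq> {..<n}"
    using assms by (auto simp: keys_add_nat mfps_carrier_def)
qed

lemma sum_mfps_carrier:
  "(\<And>i. i \<in> A \<Longrightarrow> f i \<in> mfps_carrier n) \<Longrightarrow> sum f A \<in> mfps_carrier n"
  by (induction A rule: infinite_finite_induct) auto

lemma prod_mfps_carrier: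
  "(\<And>i. i \<in> A \<Longrightarrow> f i \<in> mfps_carrier n) \<Longrightarrow> prod f A \<in> mfps_carrier n"
  by (induction A rule: infinite_finite_induct) auto

lemma power_mfps_carrier: "f \<in> mfps_carrier n \<Longrightarrow> f ^ k \<in> mfps_carrier n"
  by (induction k) auto

section \<open>Substitution as a ring homomorphism\<close>

definition monomials_upto :: "nat \<Rightarrow> nat \<Rightarrow> monomial set" where
  "monomials_upto n d = {k. Poly_Mapping.keys k \<subseteq> {..<n} \<and> mdegree k \<le> d}"

lemma finite_monomials_upto [simp]: "finite (monomials_upto n d)"
  by (rule finite_subset[OF _ finite_bounded_monomials[of "{..<n}" d]])
    (auto simp: monomials_upto_def intro: order_trans[OF lookup_le_mdegree])

text \<open>Invertibility is left out on purpose: the algebra of composition is valid for all maps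
  fixing the origin, and the construction of inverses needs it before the group is
  available.\<close>

definition endos :: "nat \<Rightarrow> 'a :: comm_ring_1 mfps vec set" where
  "endos n = {G \<in> carrier_vec n. \<forall>i<n. G $ i \<in> mfps_carrier n \<and> mcoeff (G $ i) 0 = 0}"

lemma endosD:
  assumes "G \<in> endos n"
  shows "dim_vec G = n" "i < n \<Longrightarrow> G $ i \<in> mfps_carrier n" "i < n \<Longrightarrow> mcoeff (G $ i) 0 = 0"
  using assms by (auto simp: endos_def)

lemma vec_in_endos:
  "(\<And>i. i < n \<Longrightarrow> f i \<in> mfps_carrier n) \<Longrightarrow> (\<And>i. i < n \<Longrightarrow> mcoeff (f i) 0 = 0) \<Longrightarrow> vec n f \<in> endos n"
  by (auto simp: endos_def)

lemma monom_subst_0 [simp]: "monom_subst 0 G = 1"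
  by (simp add: monom_subst_def)

lemma monom_subst_add: "monom_subst (a + b) G = monom_subst a G * monom_subst b G"
  by (simp add: monom_subst_def lookup_add power_add prod.distrib)

lemma monom_subst_single:
  assumes "i < dim_vec G"
  shows "monom_subst (Poly_Mapping.single i c) G = (G $ i) ^ c"
proof -
  have "monom_subst (Poly_Mapping.single i c) G = (\<Prod>j<dim_vec G. if i = j then (G $ j) ^ c else 1)"
    unfolding monom_subst_def by (intro prod.cong) (auto simp: lookup_single)
  then show ?thesis using assms by simp
qed

lemma monom_subst_carrier: "G \<in> endos n \<Longrightarrow> monom_subst k G \<in> mfps_carrier n"
  unfolding monom_subst_def by (intro prod_mfps_carrier power_mfps_carrier) (auto simp: endos_def)

lemma order_ge_monom_subst:
  assumes "G \<in> endos n" "Poly_Mapping.keys k \<subseteq> {..<n}"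
  shows "order_ge (mdegree k) (monom_subst k G)"
  using assms(2)
proof (induction k rule: monomial_induct)
  case (step i k)
  then have "order_ge (1 + mdegree k) (G $ i * monom_subst k G)"
    using assms(1) by (intro order_ge_mult) (auto simp: order_ge_1_iff[simplified] endosD)
  then show ?case
    using step assms(1) by (simp add: monom_subst_add monom_subst_single mdegree_add endosD)
qed simp

text \<open>Without constant terms in \<open>G\<close>, \<open>monom_subst k G\<close> has order at
  least \<open>mdegree k\<close>, so larger \<open>k\<close> do not reach \<open>m\<close>. The
  bound \<open>d\<close> is free, so that one finite index set can serve several coefficients at
  once.\<close>

lemma mcoeff_subst:
  assumes "f \<in> mfps_carrier n" "G \<in> endos n" "mdegree m \<le> d"
  shows "mcoeff (mfps_subst f G) m
       = (\<Sum>k\<in>monomials_upto n d. mcoeff f k * mcoeff (monom_subst k G) m)"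
proof -
  have "k \<in> monomials_upto n d" if nz: "mcoeff f k * mcoeff (monom_subst k G) m \<noteq> 0" for k
  proof -
    have k: "Poly_Mapping.keys k \<subseteq> {..<n}"
      using nz assms(1) mfps_carrierD by fastforce
    have "mdegree k \<le> mdegree m"
      using order_ge_monom_subst[OF assms(2) k] nz by (auto simp: order_ge_def not_less[symmetric])
    then show ?thesis using k assms(3) by (simp add: monomials_upto_def)
  qed
  then have "{k. mcoeff f k * mcoeff (monom_subst k G) m \<noteq> 0} \<subseteq> monomials_upto n d" by blast
  then show ?thesis
    unfolding mfps_subst_def mcoeff_MFPS by (intro Sum_any.expand_superset) simp_all
qed

lemma subst_carrier:
  assumes "f \<in> mfps_carrier n" "G \<in> endos n"
  shows "mfps_subst f G \<in> mfps_carrier n"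
proof (rule mfps_carrierI)
  fix m assume "mcoeff (mfps_subst f G) m \<noteq> 0"
  then obtain k where "mcoeff f k * mcoeff (monom_subst k G) m \<noteq> 0"
    unfolding mcoeff_subst[OF assms order_refl] by (meson sum.neutral)
  then have "mcoeff (monom_subst k G) m \<noteq> 0" by auto
  then show "Poly_Mapping.keys m \<subseteq> {..<n}"
    using monom_subst_carrier[OF assms(2), of k] by (auto simp: mfps_carrier_def)
qed

lemma subst_mmonom: "mfps_subst (mmonom c a) G = mmonom c 0 * monom_subst a G"
proof (rule mfps_eqI)
  fix m
  have "Sum_any (\<lambda>k. mcoeff (mmonom c a) k * mcoeff (monom_subst k G) m)
      = (\<Sum>k\<in>{a}. mcoeff (mmonom c a) k * mcoeff (monom_subst k G) m)"
    by (rule Sum_any.expand_superset) (auto simp: mcoeff_mmonom)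
  then show "mcoeff (mfps_subst (mmonom c a) G) m = mcoeff (mmonom c 0 * monom_subst a G) m"
    by (simp add: mfps_subst_def mcoeff_mmonom)
qed

lemma subst_const [simp]: "mfps_subst (mmonom c 0) G = mmonom c 0"
  by (simp add: subst_mmonom)

lemma subst_1 [simp]: "mfps_subst 1 G = 1"
  by (simp add: one_eq_mmonom subst_mmonom mmonom_mult del: mcoeff_const_mult)

lemma subst_mvar [simp]: "i < dim_vec G \<Longrightarrow> mfps_subst (mvar i) G = G $ i"
  by (simp add: mvar_eq_mmonom subst_mmonom monom_subst_single flip: one_eq_mmonom)

lemma subst_0 [simp]: "mfps_subst 0 G = 0"
  by (rule mfps_eqI) (simp add: mfps_subst_def)

lemma subst_add:
  "f \<in> mfps_carrier n \<Longrightarrow> g \<in> mfps_carrier n \<Longrightarrow> G \<in> endos n \<Longrightarrow>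
    mfps_subst (f + g) G = mfps_subst f G + mfps_subst g G"
  by (rule mfps_eqI) (simp add: mcoeff_subst[OF _ _ order_refl, of _ n] distrib_right sum.distrib)

lemma subst_diff:
  "f \<in> mfps_carrier n \<Longrightarrow> g \<in> mfps_carrier n \<Longrightarrow> G \<in> endos n \<Longrightarrow>
    mfps_subst (f - g) G = mfps_subst f G - mfps_subst g G"
  by (rule mfps_eqI) (simp add: mcoeff_subst[OF _ _ order_refl, of _ n] left_diff_distrib sum_subtractf)

lemma subst_sum:
  "(\<And>i. i \<in> A \<Longrightarrow> f i \<in> mfps_carrier n) \<Longrightarrow> G \<in> endos n \<Longrightarrow>
    mfps_subst (sum f A) G = (\<Sum>i\<in>A. mfps_subst (f i) G)"
  by (induction A rule: infinite_finite_induct) (auto simp: subst_add[of _ n] sum_mfps_carrier)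

text \<open>Both sides become the same finite sum over pairs \<open>(a, b)\<close> of monomials of
  degree at most \<open>d\<close>; on the left such a pair is found inside its sum
  \<open>a + b\<close>, on the right in the two separate expansions.\<close>

lemma subst_mult:
  assumes f: "f \<in> mfps_carrier n" and g: "g \<in> mfps_carrier n" and G: "G \<in> endos n"
  shows "mfps_subst (f * g) G = mfps_subst f G * mfps_subst g G"
proof (rule mfps_eqI)
  fix m
  define d where "d = mdegree m"
  let ?S = "monomials_upto n d"
  define T where "T = (\<lambda>(a, b). mcoeff f a * mcoeff g b * mcoeff (monom_subst (a + b) G) m)"
  have "mcoeff (mfps_subst (f * g) G) m
      = (\<Sum>k\<in>?S. \<Sum>p\<in>decomps k. T p)"
    by (simp add: mcoeff_subst[OF mult_mfps_carrier[OF f g] G order_refl] flip: d_def)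
      (auto intro!: sum.cong simp: mcoeff_mult sum_distrib_right T_def decomps_def)
  also have "\<dots> = (\<Sum>(k, p)\<in>(SIGMA k:?S. decomps k). T p)"
    by (subst sum.Sigma) (auto simp: finite_decomps)
  also have "\<dots> = (\<Sum>p\<in>{p \<in> ?S \<times> ?S. fst p + snd p \<in> ?S}. T p)"
    by (rule sum.reindex_bij_witness[where i = "\<lambda>p. (fst p + snd p, p)" and j = snd])
      (auto simp: decomps_def monomials_upto_def keys_add_nat mdegree_add)
  \<comment> \<open>The new pairs have total degree above \<open>d\<close>, and a product of that
    order has no coefficient at \<open>m\<close>.\<close>
  also have "\<dots> = (\<Sum>p\<in>?S \<times> ?S. T p)"
  proof (rule sum.mono_neutral_left)
    show "\<forall>p\<in>?S \<times> ?S - {p \<in> ?S \<times> ?S. fst p + snd p \<in> ?S}. T p = 0"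
    proof
      fix p assume p: "p \<in> ?S \<times> ?S - {p \<in> ?S \<times> ?S. fst p + snd p \<in> ?S}"
      have k: "Poly_Mapping.keys (fst p + snd p) \<subseteq> {..<n}" "mdegree (fst p + snd p) > d"
        using p by (auto simp: monomials_upto_def keys_add_nat)
      then have "mcoeff (monom_subst (fst p + snd p) G) m = 0"
        using order_ge_monom_subst[OF G k(1)] by (simp add: order_ge_def d_def)
      then show "T p = 0" by (simp add: T_def case_prod_unfold)
    qed
  qed auto
  also have "\<dots> = (\<Sum>(u, v)\<in>decomps m. mcoeff (mfps_subst f G) u * mcoeff (mfps_subst g G) v)"
  proof -
    have "mcoeff (mfps_subst f G) u * mcoeff (mfps_subst g G) v
        = (\<Sum>(a, b)\<in>?S \<times> ?S. mcoeff f a * mcoeff g b * (mcoeff (monom_subst a G) u * mcoeff (monom_subst b G) v))"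
      if "(u, v) \<in> decomps m" for u v
    proof -
      have "mdegree u \<le> d" "mdegree v \<le> d" using that by (auto simp: d_def decomps_def mdegree_add)
      then show ?thesis
        by (simp add: mcoeff_subst[OF f G, of _ d] mcoeff_subst[OF g G, of _ d] sum_product
            sum.cartesian_product mult_ac)
    qed
    then have "(\<Sum>(u, v)\<in>decomps m. mcoeff (mfps_subst f G) u * mcoeff (mfps_subst g G) v)
      = (\<Sum>(u, v)\<in>decomps m. \<Sum>(a, b)\<in>?S \<times> ?S. mcoeff f a * mcoeff g b * (mcoeff (monom_subst a G) u * mcoeff (monom_subst b G) v))"
      by (intro sum.cong) auto
    also have "\<dots> = (\<Sum>(a, b)\<in>?S \<times> ?S. \<Sum>(u, v)\<in>decomps m. mcoeff f a * mcoeff g b * (mcoeff (monom_subst a G) u * mcoeff (monom_subst b G) v))"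
      unfolding case_prod_unfold by (rule sum.swap)
    also have "\<dots> = (\<Sum>p\<in>?S \<times> ?S. T p)"
      by (intro sum.cong) (auto simp: T_def monom_subst_add mcoeff_mult sum_distrib_left case_prod_unfold)
    finally show ?thesis by simp
  qed
  finally show "mcoeff (mfps_subst (f * g) G) m = mcoeff (mfps_subst f G * mfps_subst g G) m"
    by (simp add: mcoeff_mult)
qed

lemma subst_power:
  "f \<in> mfps_carrier n \<Longrightarrow> G \<in> endos n \<Longrightarrow> mfps_subst (f ^ k) G = mfps_subst f G ^ k"
  by (induction k) (simp_all add: subst_mult[of _ n] power_mfps_carrier)

lemma subst_prod:
  "(\<And>i. i \<in> A \<Longrightarrow> f i \<in> mfps_carrier n) \<Longrightarrow> G \<in> endos n \<Longrightarrow>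
    mfps_subst (prod f A) G = (\<Prod>i\<in>A. mfps_subst (f i) G)"
  by (induction A rule: infinite_finite_induct) (auto simp: subst_mult[of _ n] prod_mfps_carrier)

lemma monom_subst_mvar:
  assumes "Poly_Mapping.keys k \<subseteq> {..<n}"
  shows "monom_subst k (vec n mvar) = mmonom 1 k"
  using assms
proof (induction k rule: monomial_induct)
  case (step i k)
  then show ?case
    by (simp add: monom_subst_add monom_subst_single) (simp add: mvar_eq_mmonom mmonom_mult)
qed (simp add: one_eq_mmonom)

lemma id_in_endos [simp]: "vec n mvar \<in> endos n"
  by (rule vec_in_endos) (auto simp: mcoeff_mvar)

lemma subst_id:
  assumes "f \<in> mfps_carrier n"
  shows "mfps_subst f (vec n mvar) = f"
proof (rule mfps_eqI)
  fix m
  have "mcoeff (mfps_subst f (vec n mvar)) m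
      = (\<Sum>k\<in>monomials_upto n (mdegree m). if m = k then mcoeff f k else 0)"
    unfolding mcoeff_subst[OF assms id_in_endos order_refl]
    by (intro sum.cong) (auto simp: monomials_upto_def monom_subst_mvar mcoeff_mmonom)
  also have "\<dots> = mcoeff f m"
    using mfps_carrierD[OF assms, of m] by (simp add: sum.delta) (auto simp: monomials_upto_def)
  finally show "mcoeff (mfps_subst f (vec n mvar)) m = mcoeff f m" .
qed

section \<open>Composition of maps\<close>

definition mcomp :: "nat \<Rightarrow> 'a :: comm_ring_1 mfps vec \<Rightarrow> 'a mfps vec \<Rightarrow> 'a mfps vec" where
  "mcomp n F G = vec n (\<lambda>i. mfps_subst (F $ i) G)"

lemma dim_mcomp [simp]: "dim_vec (mcomp n F G) = n"
  by (simp add: mcomp_def)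

lemma mcomp_index [simp]: "i < n \<Longrightarrow> mcomp n F G $ i = mfps_subst (F $ i) G"
  by (simp add: mcomp_def)

lemma mcoeff_subst_0:
  assumes "f \<in> mfps_carrier n" "G \<in> endos n"
  shows "mcoeff (mfps_subst f G) 0 = mcoeff f 0"
proof -
  have "monomials_upto n 0 = {0}" by (auto simp: monomials_upto_def mdegree_eq_0_iff)
  then show ?thesis
    using mcoeff_subst[OF assms, of 0 0] by (simp add: mcoeff_1)
qed

lemma mcomp_endos: "F \<in> endos n \<Longrightarrow> G \<in> endos n \<Longrightarrow> mcomp n F G \<in> endos n"
  unfolding mcomp_def by (rule vec_in_endos) (auto simp: subst_carrier mcoeff_subst_0[of _ n] endosD)

lemma monom_subst_mcomp:
  assumes "G \<in> endos n" "H \<in> endos n"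
  shows "mfps_subst (monom_subst k G) H = monom_subst k (mcomp n G H)"
proof -
  have "mfps_subst (monom_subst k G) H
      = (\<Prod>i<n. mfps_subst ((G $ i) ^ Poly_Mapping.lookup k i) H)"
    unfolding monom_subst_def endosD(1)[OF assms(1)]
    by (rule subst_prod[OF _ assms(2)]) (use endosD[OF assms(1)] in \<open>auto intro: power_mfps_carrier\<close>)
  then show ?thesis
    using assms endosD[OF assms(1)] by (simp add: monom_subst_def subst_power[of _ n])
qed

text \<open>Truncating the inner and the outer substitution at the same degree leaves an exchange of
  two finite sums.\<close>

lemma subst_assoc:
  assumes f: "f \<in> mfps_carrier n" and G: "G \<in> endos n" and H: "H \<in> endos n"
  shows "mfps_subst (mfps_subst f G) H = mfps_subst f (mcomp n G H)"
proof (rule mfps_eqI)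
  fix m
  define d where "d = mdegree m"
  let ?S = "monomials_upto n d"
  have "mcoeff (mfps_subst (mfps_subst f G) H) m
      = (\<Sum>l\<in>?S. (\<Sum>k\<in>?S. mcoeff f k * mcoeff (monom_subst k G) l) * mcoeff (monom_subst l H) m)"
    by (simp add: mcoeff_subst[OF subst_carrier[OF f G] H order_refl] flip: d_def)
      (auto intro!: sum.cong simp: mcoeff_subst[OF f G, of _ d] monomials_upto_def)
  also have "\<dots> = (\<Sum>k\<in>?S. mcoeff f k * (\<Sum>l\<in>?S. mcoeff (monom_subst k G) l * mcoeff (monom_subst l H) m))"
    unfolding sum_distrib_left sum_distrib_right mult.assoc by (rule sum.swap)
  also have "\<dots> = (\<Sum>k\<in>?S. mcoeff f k * mcoeff (monom_subst k (mcomp n G H)) m)"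
    by (simp add: mcoeff_subst[OF monom_subst_carrier[OF G] H, of m d] d_def flip: monom_subst_mcomp[OF G H])
  also have "\<dots> = mcoeff (mfps_subst f (mcomp n G H)) m"
    by (simp add: mcoeff_subst[OF f mcomp_endos[OF G H], of m d] d_def)
  finally show "mcoeff (mfps_subst (mfps_subst f G) H) m = mcoeff (mfps_subst f (mcomp n G H)) m" .
qed

lemma mcomp_assoc:
  assumes "F \<in> endos n" "G \<in> endos n" "H \<in> endos n"
  shows "mcomp n (mcomp n F G) H = mcomp n F (mcomp n G H)"
  by (rule eq_vecI) (use assms in \<open>auto simp: subst_assoc[of _ n] endosD\<close>)

lemma id_mcomp: "F \<in> endos n \<Longrightarrow> mcomp n (vec n mvar) F = F"
  by (rule eq_vecI) (auto simp: endosD)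

section \<open>Dependence of a composition on its factors\<close>

text \<open>Telescoping: each term replaces one factor by a difference of order \<open>d\<close>,
  while the other \<open>mdegree k - 1\<close> factors have order at least 1 each.\<close>

lemma monom_subst_diff:
  assumes "G \<in> endos n" "G' \<in> endos n" "\<And>i. i < n \<Longrightarrow> order_ge d (G $ i - G' $ i)" "d \<ge> 1"
    and "Poly_Mapping.keys k \<subseteq> {..<n}"
  shows "k \<noteq> 0 \<Longrightarrow> order_ge (d + mdegree k - 1) (monom_subst k G - monom_subst k G')"
  using assms(5)
proof (induction k rule: monomial_induct)
  case (step i k)
  have i: "i < n" using step by simp
  have "monom_subst (Poly_Mapping.single i 1 + k) G - monom_subst (Poly_Mapping.single i 1 + k) G'
      = G $ i * (monom_subst k G - monom_subst k G') + (G $ i - G' $ i) * monom_subst k G'"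
    using i endosD[OF assms(1)] endosD[OF assms(2)]
    by (simp add: monom_subst_add monom_subst_single algebra_simps)
  moreover have "order_ge (d + mdegree k) (G $ i * (monom_subst k G - monom_subst k G'))"
  proof (cases "k = 0")
    case False
    then have "order_ge (1 + (d + mdegree k - 1)) (G $ i * (monom_subst k G - monom_subst k G'))"
      using step i endosD[OF assms(1)] by (intro order_ge_mult) (auto simp: order_ge_1_iff[simplified])
    then show ?thesis using assms(4) by simp
  qed simp
  moreover have "order_ge (d + mdegree k) ((G $ i - G' $ i) * monom_subst k G')"
    using step i assms by (intro order_ge_mult order_ge_monom_subst) auto
  ultimately show ?case by (simp add: mdegree_add order_ge_add)
qed simp

text \<open>A first-order Taylor formula: a change of \<open>G\<close> of order \<open>d\<close> is
  seen up to degree \<open>d\<close> only through the linear part of \<open>f\<close>.\<close>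

lemma mcoeff_subst_diff_arg:
  assumes f: "f \<in> mfps_carrier n" and G: "G \<in> endos n" "G' \<in> endos n"
    and ord: "\<And>i. i < n \<Longrightarrow> order_ge d (G $ i - G' $ i)" and d: "d \<ge> 1" and a: "mdegree a \<le> d"
  shows "mcoeff (mfps_subst f G) a - mcoeff (mfps_subst f G') a
      = (\<Sum>i<n. mcoeff f (Poly_Mapping.single i 1) * mcoeff (G $ i - G' $ i) a)"
proof -
  let ?T = "\<lambda>k. mcoeff f k * mcoeff (monom_subst k G - monom_subst k G') a"
  let ?L = "(\<lambda>i. Poly_Mapping.single i 1) ` {..<n} :: monomial set"
  have "mcoeff (mfps_subst f G) a - mcoeff (mfps_subst f G') a = (\<Sum>k\<in>monomials_upto n d. ?T k)"
    by (simp add: mcoeff_subst[OF f _ a] G sum_subtractf right_diff_distrib)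
  also have "\<dots> = (\<Sum>k\<in>?L. ?T k)"
  proof (rule sum.mono_neutral_right)
    show "?L \<subseteq> monomials_upto n d" using d by (auto simp: monomials_upto_def)
    show "\<forall>k\<in>monomials_upto n d - ?L. ?T k = 0"
    proof
      fix k assume k: "k \<in> monomials_upto n d - ?L"
      show "?T k = 0"
      proof (cases "k = 0")
        case False
        have keys: "Poly_Mapping.keys k \<subseteq> {..<n}" using k by (simp add: monomials_upto_def)
        have "mdegree k \<noteq> 1"
        proof
          assume "mdegree k = 1"
          then obtain i where "k = Poly_Mapping.single i 1" "i \<in> Poly_Mapping.keys k"
            by (rule mdegree_eq_1E)
          then show False using k keys by auto
        qed
        \<comment> \<open>From here on the difference has order at least \<open>d + 1\<close>,
          beyond the degree of \<open>a\<close>.\<close>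
        then have "mdegree k \<ge> 2" using False mdegree_eq_0_iff[of k] by linarith
        moreover have "order_ge (d + mdegree k - 1) (monom_subst k G - monom_subst k G')"
          by (rule monom_subst_diff[OF G ord d keys False])
        ultimately show ?thesis using a by (auto simp: order_ge_def)
      qed simp
    qed
  qed simp
  also have "\<dots> = (\<Sum>i<n. ?T (Poly_Mapping.single i 1))"
    by (subst sum.reindex) (auto simp: inj_on_def)
  also have "\<dots> = (\<Sum>i<n. mcoeff f (Poly_Mapping.single i 1) * mcoeff (G $ i - G' $ i) a)"
    using endosD[OF G(1)] endosD[OF G(2)] by (intro sum.cong) (auto simp: monom_subst_single)
  finally show ?thesis .
qed

lemma order_ge_subst:
  assumes "f \<in> mfps_carrier n" "G \<in> endos n" "order_ge d f"
  shows "order_ge d (mfps_subst f G)"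
  unfolding order_ge_def
proof (intro allI impI)
  fix m assume m: "mdegree m < d"
  show "mcoeff (mfps_subst f G) m = 0"
    unfolding mcoeff_subst[OF assms(1,2) order_refl]
    by (intro sum.neutral) (use assms(3) m in \<open>auto simp: order_ge_def monomials_upto_def\<close>)
qed

text \<open>The chain rule at the origin, obtained from the difference formula with
  \<open>d = 1\<close> by comparing \<open>G\<close> with the zero map.\<close>

lemma mcoeff_subst_linear:
  assumes f: "f \<in> mfps_carrier n" and G: "G \<in> endos n"
  shows "mcoeff (mfps_subst f G) (Poly_Mapping.single j 1)
      = (\<Sum>i<n. mcoeff f (Poly_Mapping.single i 1) * mcoeff (G $ i) (Poly_Mapping.single j 1))"
proof -
  let ?Z = "vec n (\<lambda>_. 0)"
  have Z: "?Z \<in> endos n" by (rule vec_in_endos) auto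
  have Zk: "monom_subst k ?Z = (if k = 0 then 1 else 0)" if "Poly_Mapping.keys k \<subseteq> {..<n}" for k
    using that
  proof (induction k rule: monomial_induct)
    case (step i k)
    have "mdegree (Poly_Mapping.single i 1 + k) \<noteq> 0" by (simp add: mdegree_add)
    then have "Poly_Mapping.single i 1 + k \<noteq> 0" by (metis mdegree_0)
    then show ?case using step by (simp add: monom_subst_add monom_subst_single)
  qed simp
  have "mcoeff (mfps_subst f ?Z) (Poly_Mapping.single j 1) = 0"
    unfolding mcoeff_subst[OF f Z order_refl]
    by (intro sum.neutral) (auto simp: monomials_upto_def Zk mcoeff_1)
  then show ?thesis
    using mcoeff_subst_diff_arg[OF f G Z, of 1 "Poly_Mapping.single j 1"] endosD[OF G]
    by (simp add: order_ge_1_iff[simplified])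
qed

section \<open>Maps with diagonal linear part\<close>

definition diag_linear :: "nat \<Rightarrow> (nat \<Rightarrow> 'a :: comm_ring_1) \<Rightarrow> 'a mfps vec \<Rightarrow> bool" where
  "diag_linear n l G \<longleftrightarrow> G \<in> endos n \<and>
     (\<forall>i<n. \<forall>j<n. mcoeff (G $ i) (Poly_Mapping.single j 1) = (if i = j then l i else 0))"

text \<open>The eigenvalue of the monomial with exponent \<open>a\<close> under substitution of the
  diagonal linear map with entries \<open>l\<close>.\<close>

definition mpow :: "nat \<Rightarrow> (nat \<Rightarrow> 'a :: comm_ring_1) \<Rightarrow> monomial \<Rightarrow> 'a" where
  "mpow n l a = (\<Prod>i<n. l i ^ Poly_Mapping.lookup a i)"

lemma mpow_0 [simp]: "mpow n l 0 = 1"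
  by (simp add: mpow_def)

lemma mpow_add: "mpow n l (a + b) = mpow n l a * mpow n l b"
  by (simp add: mpow_def lookup_add power_add prod.distrib)

lemma mpow_single: "i < n \<Longrightarrow> mpow n l (Poly_Mapping.single i 1) = l i"
proof -
  assume i: "i < n"
  have "mpow n l (Poly_Mapping.single i 1) = (\<Prod>j<n. if i = j then l j else 1)"
    unfolding mpow_def by (intro prod.cong) (auto simp: lookup_single)
  then show ?thesis using i by simp
qed

lemma mpow_1 [simp]: "mpow n (\<lambda>_. 1) a = 1"
  by (simp add: mpow_def)

lemma diag_linear_leading:
  assumes "diag_linear n l G" "i < n"
  shows "order_ge 2 (G $ i - mmonom (l i) (Poly_Mapping.single i 1))"
  unfolding order_ge_def
proof (intro allI impI)
  fix m assume "mdegree m < 2"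
  then consider "m = 0" | "mdegree m = 1" using mdegree_eq_0_iff[of m] by linarith
  then show "mcoeff (G $ i - mmonom (l i) (Poly_Mapping.single i 1)) m = 0"
  proof cases
    case 1
    then show ?thesis using assms by (auto simp: diag_linear_def mcoeff_mmonom endosD)
  next
    case 2
    then obtain j where j: "m = Poly_Mapping.single j 1" by (rule mdegree_eq_1E)
    have "mcoeff (G $ i) m = 0" if "j \<ge> n"
      using that assms by (intro mfps_carrierD[of _ n]) (auto simp: diag_linear_def endosD j)
    then show ?thesis
      using assms by (cases "j < n") (auto simp: diag_linear_def mcoeff_mmonom j)
  qed
qed

lemma monom_subst_leading:
  assumes G: "diag_linear n l G" and "Poly_Mapping.keys k \<subseteq> {..<n}"
  shows "order_ge (Suc (mdegree k)) (monom_subst k G - mmonom (mpow n l k) k)"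
  using assms(2)
proof (induction k rule: monomial_induct)
  case zero
  then show ?case by (simp flip: one_eq_mmonom)
next
  case (step i k)
  have i: "i < n" and Ge: "G \<in> endos n" using step G by (auto simp: diag_linear_def)
  let ?e = "Poly_Mapping.single i 1"
  have "monom_subst (?e + k) G - mmonom (mpow n l (?e + k)) (?e + k)
      = G $ i * (monom_subst k G - mmonom (mpow n l k) k)
        + (G $ i - mmonom (l i) ?e) * mmonom (mpow n l k) k"
  proof -
    have "mmonom (mpow n l (?e + k)) (?e + k) = mmonom (l i) ?e * mmonom (mpow n l k) k"
      by (simp only: mpow_add mpow_single[OF i] mmonom_mult)
    then show ?thesis
      using i endosD[OF Ge] by (simp add: monom_subst_add monom_subst_single algebra_simps)
  qed
  moreover have "order_ge (1 + Suc (mdegree k)) (G $ i * (monom_subst k G - mmonom (mpow n l k) k))"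
    using step i endosD[OF Ge] by (intro order_ge_mult) (auto simp: order_ge_1_iff[simplified])
  moreover have "order_ge (2 + mdegree k) ((G $ i - mmonom (l i) ?e) * mmonom (mpow n l k) k)"
    using diag_linear_leading[OF G i] by (intro order_ge_mult order_ge_mmonom)
  ultimately show ?case by (simp add: mdegree_add order_ge_add)
qed

text \<open>In the lowest degree of \<open>f\<close> only the linear part of \<open>G\<close> acts,
  and for a diagonal linear part every monomial is an eigenvector.\<close>

lemma mcoeff_subst_leading:
  assumes f: "f \<in> mfps_carrier n" and G: "diag_linear n l G" and ord: "order_ge d f" and a: "mdegree a = d"
  shows "mcoeff (mfps_subst f G) a = mpow n l a * mcoeff f a"
proof -
  have Ge: "G \<in> endos n" using G by (simp add: diag_linear_def)
  have "mcoeff (mfps_subst f G) a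
      = (\<Sum>k\<in>monomials_upto n d. if a = k then mpow n l k * mcoeff f k else 0)"
    unfolding mcoeff_subst[OF f Ge, of a d, unfolded a, OF order_refl]
  proof (rule sum.cong)
    fix k assume k: "k \<in> monomials_upto n d"
    then have keys: "Poly_Mapping.keys k \<subseteq> {..<n}" by (simp add: monomials_upto_def)
    show "mcoeff f k * mcoeff (monom_subst k G) a = (if a = k then mpow n l k * mcoeff f k else 0)"
    proof (cases "mdegree k < d")
      case True
      then show ?thesis using ord a by (auto simp: order_ge_def)
    next
      case False
      then have "mcoeff (monom_subst k G - mmonom (mpow n l k) k) a = 0"
        using monom_subst_leading[OF G keys] a by (auto simp: order_ge_def)
      then show ?thesis by (simp add: mcoeff_mmonom)
    qed
  qed simp
  also have "\<dots> = mpow n l a * mcoeff f a"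
    using mfps_carrierD[OF f, of a] a by (simp add: sum.delta) (auto simp: monomials_upto_def)
  finally show ?thesis .
qed

text \<open>The split by degree fits the recursive constructions: degrees 0 and 1 are built into the
  ansatz, and the equations solved concern degree 2 and above.\<close>

lemma mfps_carrier_eqI:
  assumes "f \<in> mfps_carrier n" "g \<in> mfps_carrier n" "mcoeff f 0 = mcoeff g 0"
    and "\<And>j. j < n \<Longrightarrow> mcoeff f (Poly_Mapping.single j 1) = mcoeff g (Poly_Mapping.single j 1)"
    and "\<And>a. Poly_Mapping.keys a \<subseteq> {..<n} \<Longrightarrow> mdegree a \<ge> 2 \<Longrightarrow> mcoeff f a = mcoeff g a"
  shows "f = g"
proof (rule mfps_eqI)
  fix m
  show "mcoeff f m = mcoeff g m"
  proof (cases "Poly_Mapping.keys m \<subseteq> {..<n}")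
    case True
    consider "m = 0" | "mdegree m = 1" | "mdegree m \<ge> 2" using mdegree_eq_0_iff[of m] by linarith
    then show ?thesis
    proof cases
      case 2
      then obtain j where "m = Poly_Mapping.single j 1" "j \<in> Poly_Mapping.keys m" by (rule mdegree_eq_1E)
      then show ?thesis using assms(4) True by blast
    qed (use assms True in auto)
  qed (use assms in \<open>simp add: mfps_carrierD\<close>)
qed


section \<open>Triangular systems\<close>

text \<open>The common form of all recursive constructions here: the inverse map, the normal form,
  Abel's equation and the diagonalisation of a triangular matrix. By \<open>tri\<close>, equation
  \<open>j\<close> is affine in the unknown \<open>j\<close> with slope \<open>c j\<close> and
  otherwise involves only unknowns of smaller grade, so the equations can be solved grade by
  grade.\<close>

lemma triangular_solution:
  fixes \<Phi> :: "('j \<Rightarrow> 'a :: field) \<Rightarrow> 'j \<Rightarrow> 'a" and \<delta> :: "'j \<Rightarrow> nat"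
  assumes tri: "\<And>X Y j. (\<And>j'. \<delta> j' < \<delta> j \<Longrightarrow> X j' = Y j') \<Longrightarrow> \<Phi> X j - \<Phi> Y j = c j * (X j - Y j)"
    and c: "\<And>j. c j \<noteq> 0"
  shows "\<exists>X. \<forall>j. \<Phi> X j = 0"
proof -
  \<comment> \<open>\<open>A d\<close> holds the solution on the grades below \<open>d\<close> and 0
    elsewhere. An unknown of grade \<open>d\<close> still has the value 0 there, so the affine
    equation is solved by \<open>- \<Phi> X j / c j\<close>.\<close>
  define A where "A = rec_nat (\<lambda>_. 0) (\<lambda>d X j. if \<delta> j = d then - \<Phi> X j / c j else X j)"
  have A0: "A 0 j = 0" and AS: "A (Suc d) j = (if \<delta> j = d then - \<Phi> (A d) j / c j else A d j)" for d j
    by (simp_all add: A_def)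
  have low: "d \<le> \<delta> j \<Longrightarrow> A d j = 0" for d j
    by (induction d) (auto simp: A0 AS)
  define X where "X j = A (Suc (\<delta> j)) j" for j
  have high: "\<delta> j < d \<Longrightarrow> A d j = X j" for d j
  proof (induction d)
    case (Suc d)
    then show ?case by (cases "\<delta> j = d") (auto simp: AS X_def)
  qed simp
  have "\<Phi> X j = 0" for j
  proof -
    have "\<Phi> X j - \<Phi> (A (\<delta> j)) j = c j * (X j - A (\<delta> j) j)"
      by (rule tri) (simp add: high)
    then show ?thesis using c[of j] by (simp add: low X_def AS)
  qed
  then show ?thesis by blast
qed

text \<open>The unknown part of a map. The cut-off in the definition lets \<open>x\<close> range
  over all families of coefficients, so the unknowns satisfy no side conditions.\<close>

definition higher_terms :: "nat \<Rightarrow> (monomial \<Rightarrow> 'a :: comm_ring_1) \<Rightarrow> 'a mfps" where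
  "higher_terms n x = MFPS (\<lambda>a. if Poly_Mapping.keys a \<subseteq> {..<n} \<and> mdegree a \<ge> 2 then x a else 0)"

lemma mcoeff_higher_terms:
  "mcoeff (higher_terms n x) a = (if Poly_Mapping.keys a \<subseteq> {..<n} \<and> mdegree a \<ge> 2 then x a else 0)"
  by (simp add: higher_terms_def)

lemma higher_terms_carrier [simp]: "higher_terms n x \<in> mfps_carrier n"
  by (auto simp: mfps_carrier_def mcoeff_higher_terms)

lemma diag_linear_higher_terms:
  "diag_linear n l (vec n (\<lambda>i. mmonom (l i) 0 * mvar i + higher_terms n (x i)))"
  unfolding diag_linear_def
  by (auto intro!: vec_in_endos simp: mcoeff_higher_terms mcoeff_mvar)

text \<open>Diagonal entries 1 mean tangency to the identity. The coefficient of the unknown left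
  inverse at \<open>a\<close> then enters the equation for degree \<open>mdegree a\<close> with
  slope \<open>mpow n (\<lambda>_. 1) a = 1\<close>.\<close>

lemma tangent_left_inverse:
  fixes F :: "complex mfps vec"
  assumes F: "diag_linear n (\<lambda>_. 1) F"
  shows "\<exists>X. diag_linear n (\<lambda>_. 1) X \<and> mcomp n X F = vec n mvar"
proof -
  define B :: "(nat \<times> monomial \<Rightarrow> complex) \<Rightarrow> nat \<Rightarrow> complex mfps" where
    "B X i = mmonom 1 0 * mvar i + higher_terms n (\<lambda>a. X (i, a))" for X i
  define good where "good = (\<lambda>(i, a). i < n \<and> Poly_Mapping.keys a \<subseteq> {..<n} \<and> 2 \<le> mdegree a)"
  \<comment> \<open>Meaningless indices receive the equation \<open>X (i, a) = 0\<close>, so that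
    the system is triangular with nonzero slopes over the whole index type.\<close>
  define \<Phi> where "\<Phi> X = (\<lambda>(i, a). if good (i, a) then mcoeff (mfps_subst (B X i) F) a else X (i, a))" for X
  have BC: "i < n \<Longrightarrow> B X i \<in> mfps_carrier n" for X i by (simp add: B_def)
  have Fe: "F \<in> endos n" using F by (simp add: diag_linear_def)
  have "\<exists>X. \<forall>j. \<Phi> X j = 0"
  proof (rule triangular_solution[where \<delta> = "\<lambda>(i :: nat, a). mdegree a" and c = "\<lambda>_. 1"])
    fix X Y :: "nat \<times> monomial \<Rightarrow> complex" and j
    assume eq: "\<And>j'. (case j' of (i :: nat, a) \<Rightarrow> mdegree a) < (case j of (i :: nat, a) \<Rightarrow> mdegree a) \<Longrightarrow> X j' = Y j'"
    obtain i a where j: "j = (i, a)" by (cases j)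
    show "\<Phi> X j - \<Phi> Y j = 1 * (X j - Y j)"
    proof (cases "good j")
      case True
      then have i: "i < n" by (simp add: good_def j)
      have "order_ge (mdegree a) (B X i - B Y i)"
        using eq by (auto simp: order_ge_def B_def mcoeff_higher_terms j)
      from mcoeff_subst_leading[OF _ F this refl] show ?thesis
        using True i by (simp add: \<Phi>_def j subst_diff[OF _ _ Fe] BC) (simp add: B_def mcoeff_higher_terms good_def)
    qed (simp add: \<Phi>_def j)
  qed simp
  then obtain X where X: "\<And>j. \<Phi> X j = 0" by blast
  let ?B = "vec n (B X)"
  have dB: "diag_linear n (\<lambda>_. 1) ?B"
    unfolding B_def by (rule diag_linear_higher_terms[of n "\<lambda>_. 1" "\<lambda>i a. X (i, a)"])
  moreover have "mcomp n ?B F = vec n mvar"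
  proof (rule eq_vecI)
    fix i assume "i < dim_vec (vec n mvar :: complex mfps vec)"
    then have i: "i < n" by simp
    have "mfps_subst (B X i) F = mvar i"
    proof (rule mfps_carrier_eqI[of _ n])
      fix j assume "j < n"
      then have "mcoeff (mfps_subst (B X i) F) (Poly_Mapping.single j 1)
          = (\<Sum>k<n. if k = i then (if i = j then 1 else 0) else 0)"
        unfolding mcoeff_subst_linear[OF BC[OF i] Fe]
        using F i dB by (intro sum.cong) (auto simp: diag_linear_def)
      then show "mcoeff (mfps_subst (B X i) F) (Poly_Mapping.single j 1) = mcoeff (mvar i) (Poly_Mapping.single j 1)"
        using i by (simp add: mcoeff_mvar)
    next
      fix a :: monomial assume a: "Poly_Mapping.keys a \<subseteq> {..<n}" "mdegree a \<ge> 2"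
      have "mcoeff (mfps_subst (B X i) F) a = 0" using X[of "(i, a)"] a i by (simp add: \<Phi>_def good_def)
      moreover have "a \<noteq> Poly_Mapping.single i 1" using a by auto
      ultimately show "mcoeff (mfps_subst (B X i) F) a = mcoeff (mvar i) a" by (simp add: mcoeff_mvar)
    qed (use i Fe in \<open>auto simp: subst_carrier BC mcoeff_subst_0[of _ n] B_def mcoeff_higher_terms mcoeff_mvar\<close>)
    then show "mcomp n ?B F $ i = vec n mvar $ i" using i by simp
  qed simp
  ultimately show ?thesis by blast
qed


section \<open>The group of formal maps\<close>

definition linear_map :: "nat \<Rightarrow> 'a :: comm_ring_1 mat \<Rightarrow> 'a mfps vec" where
  "linear_map n A = vec n (\<lambda>i. \<Sum>j<n. mmonom (A $$ (i, j)) 0 * mvar j)"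

lemma linear_map_endos [simp]: "linear_map n A \<in> endos n"
  unfolding linear_map_def
  by (rule vec_in_endos) (auto intro!: sum_mfps_carrier simp: mcoeff_sum mcoeff_mvar)

lemma linear_map_index:
  "i < n \<Longrightarrow> linear_map n A $ i = (\<Sum>j<n. mmonom (A $$ (i, j)) 0 * mvar j)"
  by (simp add: linear_map_def)

lemma linear_part_carrier [simp]: "linear_part n F \<in> carrier_mat n n"
  by (simp add: linear_part_def)

lemma linear_part_linear_map:
  assumes "A \<in> carrier_mat n n"
  shows "linear_part n (linear_map n A) = A"
proof (rule eq_matI)
  fix i j assume "i < dim_row A" "j < dim_col A"
  then have ij: "i < n" "j < n" using assms by auto
  then have "linear_part n (linear_map n A) $$ (i, j) = (\<Sum>k<n. if j = k then A $$ (i, k) else 0)"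
    by (simp add: linear_part_def linear_map_def mcoeff_sum mcoeff_mvar if_distrib[of "(*) _"] cong: if_cong)
  then show "linear_part n (linear_map n A) $$ (i, j) = A $$ (i, j)" using ij by simp
qed (use assms in \<open>auto simp: linear_part_def\<close>)

lemma linear_part_mcomp:
  assumes "F \<in> endos n" "G \<in> endos n"
  shows "linear_part n (mcomp n F G) = linear_part n F * linear_part n G"
proof (rule eq_matI)
  fix i j assume "i < dim_row (linear_part n F * linear_part n G)" "j < dim_col (linear_part n F * linear_part n G)"
  then have ij: "i < n" "j < n" by (auto simp: linear_part_def)
  then show "linear_part n (mcomp n F G) $$ (i, j) = (linear_part n F * linear_part n G) $$ (i, j)"
    using mcoeff_subst_linear[OF endosD(2)[OF assms(1)] assms(2)]
    by (simp add: linear_part_def scalar_prod_def atLeast0LessThan)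
qed (auto simp: linear_part_def)

lemma linear_map_mcomp:
  assumes "G \<in> endos n" "i < n"
  shows "mcomp n (linear_map n A) G $ i = (\<Sum>j<n. mmonom (A $$ (i, j)) 0 * G $ j)"
proof -
  have "mcomp n (linear_map n A) G $ i = (\<Sum>j<n. mfps_subst (mmonom (A $$ (i, j)) 0 * mvar j) G)"
    using assms by (simp add: linear_map_def) (rule subst_sum[of _ _ n], auto)
  then show ?thesis using assms endosD[OF assms(1)] by (simp add: subst_mult[of _ n])
qed

lemma mcomp_linear_map:
  assumes "A \<in> carrier_mat n n" "B \<in> carrier_mat n n"
  shows "mcomp n (linear_map n A) (linear_map n B) = linear_map n (A * B)"
proof (rule eq_vecI)
  fix i assume "i < dim_vec (linear_map n (A * B))"
  then have i: "i < n" by (simp add: linear_map_def)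
  show "mcomp n (linear_map n A) (linear_map n B) $ i = linear_map n (A * B) $ i"
  proof (rule mfps_eqI)
    fix m
    have "mcoeff (mcomp n (linear_map n A) (linear_map n B) $ i) m
        = (\<Sum>j<n. A $$ (i, j) * (\<Sum>k<n. B $$ (j, k) * mcoeff (mvar k) m))"
      using i by (simp add: linear_map_mcomp mcoeff_sum linear_map_index del: mcomp_index)
    also have "\<dots> = (\<Sum>k<n. (\<Sum>j<n. A $$ (i, j) * B $$ (j, k)) * mcoeff (mvar k) m)"
      unfolding sum_distrib_left sum_distrib_right mult.assoc by (rule sum.swap)
    also have "\<dots> = mcoeff (linear_map n (A * B) $ i) m"
      using i assms by (simp add: linear_map_def mcoeff_sum scalar_prod_def atLeast0LessThan)
    finally show "mcoeff (mcomp n (linear_map n A) (linear_map n B) $ i) m = mcoeff (linear_map n (A * B) $ i) m" .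
  qed
qed (simp add: linear_map_def)

lemma linear_map_1: "linear_map n (1\<^sub>m n) = vec n mvar"
proof (rule eq_vecI)
  fix i assume "i < dim_vec (vec n mvar :: 'a mfps vec)"
  then have i: "i < n" by simp
  have "linear_map n (1\<^sub>m n) $ i = (\<Sum>j<n. if i = j then mvar j else 0)"
  proof -
    have "mmonom (1\<^sub>m n $$ (i, j)) 0 * mvar j = (if i = j then mvar j else 0)" if "j \<in> {..<n}" for j
      by (rule mfps_eqI) (use i that in auto)
    then show ?thesis unfolding linear_map_index[OF i] by (rule sum.cong[OF refl])
  qed
  then show "linear_map n (1\<^sub>m n) $ i = vec n mvar $ i" using i by simp
qed (simp add: linear_map_def)

lemma formal_maps_simps [simp]:
  "monoid.mult (formal_maps n) = mcomp n" "one (formal_maps n) = vec n mvar"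
  by (auto simp: formal_maps_def mcomp_def fun_eq_iff)

lemma carrier_formal_maps:
  "carrier (formal_maps n) = {F \<in> endos n. invertible_mat (linear_part n F)}"
  by (auto simp: formal_maps_def endos_def)

lemma invertible_matI:
  "A \<in> carrier_mat n n \<Longrightarrow> B \<in> carrier_mat n n \<Longrightarrow> A * B = 1\<^sub>m n \<Longrightarrow> B * A = 1\<^sub>m n \<Longrightarrow> invertible_mat A"
  by (auto simp: invertible_mat_def inverts_mat_def)

lemma invertible_matE:
  assumes "invertible_mat A" "A \<in> carrier_mat n n"
  obtains B where "B \<in> carrier_mat n n" "A * B = 1\<^sub>m n" "B * A = 1\<^sub>m n"
proof -
  obtain B where B: "A * B = 1\<^sub>m (dim_row A)" "B * A = 1\<^sub>m (dim_row B)"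
    using assms by (auto simp: invertible_mat_def inverts_mat_def)
  have d: "dim_col B = n" "dim_row B = n" "dim_row A = n"
    using arg_cong[OF B(1), of dim_col] arg_cong[OF B(2), of dim_col] assms by auto
  show ?thesis
    by (rule that[of B]) (use d in \<open>simp_all only: B carrier_mat_def mem_Collect_eq simp_thms\<close>)
qed

lemma diag_linear_iff_linear_part:
  "diag_linear n l F \<longleftrightarrow> F \<in> endos n \<and> linear_part n F = mat n n (\<lambda>(i, j). if i = j then l i else 0)"
  by (auto simp: diag_linear_def linear_part_def mat_eq_iff)

lemma tangent_iff_linear_part:
  "diag_linear n (\<lambda>_. 1) F \<longleftrightarrow> F \<in> endos n \<and> linear_part n F = 1\<^sub>m n"
  by (simp add: diag_linear_iff_linear_part one_mat_def)

text \<open>A left inverse is enough for \<open>groupI\<close>. Composing \<open>F\<close> with the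
  inverse of its linear part on the left makes it tangent to the identity, where the recursion
  applies.\<close>

theorem group_formal_maps: "group (formal_maps n)"
proof (rule groupI)
  fix F G assume F: "F \<in> carrier (formal_maps n)" and G: "G \<in> carrier (formal_maps n)"
  obtain A where A: "A \<in> carrier_mat n n" "linear_part n F * A = 1\<^sub>m n" "A * linear_part n F = 1\<^sub>m n"
    using F by (auto simp: carrier_formal_maps elim!: invertible_matE)
  obtain B where B: "B \<in> carrier_mat n n" "linear_part n G * B = 1\<^sub>m n" "B * linear_part n G = 1\<^sub>m n"
    using G by (auto simp: carrier_formal_maps elim!: invertible_matE)
  have cancel: "P * Q * (Q' * P') = 1\<^sub>m n"
    if c: "P \<in> carrier_mat n n" "Q \<in> carrier_mat n n" "P' \<in> carrier_mat n n" "Q' \<in> carrier_mat n n"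
      and inv: "P * P' = 1\<^sub>m n" "Q * Q' = 1\<^sub>m n" for P Q P' Q' :: "complex mat"
  proof -
    have "P * Q * (Q' * P') = P * (Q * (Q' * P'))"
      using c by (intro assoc_mult_mat) auto
    also have "Q * (Q' * P') = Q * Q' * P'"
      using c by (intro assoc_mult_mat[symmetric]) auto
    finally show ?thesis using c inv by simp
  qed
  have "invertible_mat (linear_part n F * linear_part n G)"
    by (rule invertible_matI[where n = n and B = "B * A"])
      (use A B in \<open>auto intro!: cancel mult_carrier_mat[of _ n n]\<close>)
  then show "F \<otimes>\<^bsub>formal_maps n\<^esub> G \<in> carrier (formal_maps n)"
    using F G by (auto simp: carrier_formal_maps mcomp_endos linear_part_mcomp)
next
  have "linear_part n (vec n mvar) = 1\<^sub>m n"
    by (rule eq_matI) (auto simp: linear_part_def mcoeff_mvar)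
  then show "\<one>\<^bsub>formal_maps n\<^esub> \<in> carrier (formal_maps n)"
    by (auto simp: carrier_formal_maps intro: invertible_matI[where n = n and B = "1\<^sub>m n"])
next
  fix F assume F: "F \<in> carrier (formal_maps n)"
  then have Fe: "F \<in> endos n" by (simp add: carrier_formal_maps)
  obtain A where A: "A \<in> carrier_mat n n" "linear_part n F * A = 1\<^sub>m n" "A * linear_part n F = 1\<^sub>m n"
    using F by (auto simp: carrier_formal_maps elim!: invertible_matE)
  have "diag_linear n (\<lambda>_. 1) (mcomp n (linear_map n A) F)"
    using Fe A by (simp add: tangent_iff_linear_part mcomp_endos linear_part_mcomp linear_part_linear_map)
  then obtain X where X: "diag_linear n (\<lambda>_. 1) X" "mcomp n X (mcomp n (linear_map n A) F) = vec n mvar"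
    using tangent_left_inverse by blast
  have Xe: "X \<in> endos n" using X by (simp add: diag_linear_def)
  have "mcomp n (mcomp n X (linear_map n A)) F = vec n mvar"
    using X Xe Fe by (simp add: mcomp_assoc)
  moreover have "linear_part n (mcomp n X (linear_map n A)) = A"
    using X A Xe by (simp add: tangent_iff_linear_part linear_part_mcomp linear_part_linear_map)
  then have "mcomp n X (linear_map n A) \<in> carrier (formal_maps n)"
    using A Xe by (auto simp: carrier_formal_maps mcomp_endos intro: invertible_matI[of _ n "linear_part n F"])
  ultimately show "\<exists>Y\<in>carrier (formal_maps n). Y \<otimes>\<^bsub>formal_maps n\<^esub> F = \<one>\<^bsub>formal_maps n\<^esub>"
    by auto
qed (auto simp: carrier_formal_maps mcomp_assoc id_mcomp)

section \<open>The Poincare-Dulac normal form\<close>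

text \<open>The exponent of \<open>p^k\<close>, where \<open>p\<close> is the product of the
  \<open>n\<close> variables.\<close>

definition rep :: "nat \<Rightarrow> nat \<Rightarrow> monomial" where
  "rep n k = (\<Sum>i<n. Poly_Mapping.single i k)"

lemma lookup_rep: "Poly_Mapping.lookup (rep n k) i = (if i < n then k else 0)"
  by (simp add: rep_def lookup_sum lookup_single when_def)

lemma keys_rep: "Poly_Mapping.keys (rep n k) \<subseteq> {..<n}"
  by (auto simp: in_keys_iff lookup_rep split: if_splits)

lemma mdegree_rep: "mdegree (rep n k) = n * k"
  using mdegree_superset[OF _ keys_rep] by (simp add: lookup_rep)

definition resonant :: "nat \<Rightarrow> nat \<Rightarrow> monomial \<Rightarrow> bool" where
  "resonant n i a \<longleftrightarrow> (\<exists>k. a = Poly_Mapping.single i 1 + rep n k)"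

text \<open>Only accidental resonances are excluded: the relations that hold are exactly those
  forced by a product of eigenvalues equal to 1.\<close>

definition nonresonant :: "nat \<Rightarrow> (nat \<Rightarrow> 'a :: comm_ring_1) \<Rightarrow> bool" where
  "nonresonant n l \<longleftrightarrow> (\<forall>i<n. \<forall>a. Poly_Mapping.keys a \<subseteq> {..<n} \<longrightarrow> mdegree a \<ge> 1 \<longrightarrow>
     (mpow n l a = l i \<longleftrightarrow> resonant n i a))"

text \<open>Besides the shape of \<open>N\<close>, the conjugating map \<open>B\<close> is
  normalised to have no resonant higher terms. This removes the freedom in \<open>B\<close>, so that
  normal forms of two different maps can be compared.\<close>

definition normal_form ::
  "nat \<Rightarrow> (nat \<Rightarrow> complex) \<Rightarrow> complex mfps vec \<Rightarrow> complex mfps vec \<Rightarrow> complex mfps vec \<Rightarrow> bool" where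
  "normal_form n l F B N \<longleftrightarrow> diag_linear n (\<lambda>_. 1) B \<and> diag_linear n l N \<and> mcomp n B F = mcomp n N B \<and>
     (\<forall>i<n. \<forall>a. mdegree a \<ge> 2 \<longrightarrow> resonant n i a \<longrightarrow> mcoeff (B $ i) a = 0) \<and>
     (\<forall>i<n. \<forall>a. mdegree a \<ge> 2 \<longrightarrow> \<not> resonant n i a \<longrightarrow> mcoeff (N $ i) a = 0)"

text \<open>The homological equation: the linearisation of \<open>B o F = N o B\<close> in the
  lowest degree in which the data differ. Since \<open>F\<close> is allowed to vary too, it serves
  both the existence of the normal form (with \<open>F' = F\<close>) and its dependence on
  \<open>F\<close>.\<close>

lemma conjugacy_defect_diff:
  assumes F: "diag_linear n l F" "diag_linear n l F'"
    and B: "diag_linear n (\<lambda>_. 1) B" "diag_linear n (\<lambda>_. 1) B'"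
    and N: "diag_linear n l N" "diag_linear n l N'"
    and d: "d \<ge> 2"
    and oB: "\<And>i. i < n \<Longrightarrow> order_ge d (B $ i - B' $ i)"
    and oN: "\<And>i. i < n \<Longrightarrow> order_ge d (N $ i - N' $ i)"
    and oF: "\<And>i. i < n \<Longrightarrow> order_ge d (F $ i - F' $ i)"
    and i: "i < n" and a: "mdegree a = d"
  shows "mcoeff (mfps_subst (B $ i) F - mfps_subst (N $ i) B) a
         - mcoeff (mfps_subst (B' $ i) F' - mfps_subst (N' $ i) B') a
       = (mpow n l a - l i) * (mcoeff (B $ i) a - mcoeff (B' $ i) a)
         + (mcoeff (F $ i) a - mcoeff (F' $ i) a) - (mcoeff (N $ i) a - mcoeff (N' $ i) a)"
proof -
  have e: "F \<in> endos n" "F' \<in> endos n" "B \<in> endos n" "B' \<in> endos n" "N \<in> endos n" "N' \<in> endos n"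
    using F B N by (auto simp: diag_linear_def)
  note c = endosD(2)[OF e(1) i] endosD(2)[OF e(2) i] endosD(2)[OF e(3) i] endosD(2)[OF e(4) i]
    endosD(2)[OF e(5) i] endosD(2)[OF e(6) i]
  have 1: "mcoeff (mfps_subst (B $ i) F) a - mcoeff (mfps_subst (B $ i) F') a = mcoeff (F $ i) a - mcoeff (F' $ i) a"
  proof -
    have "mcoeff (mfps_subst (B $ i) F) a - mcoeff (mfps_subst (B $ i) F') a
        = (\<Sum>j<n. if i = j then mcoeff (F $ j - F' $ j) a else 0)"
      using d a by (subst mcoeff_subst_diff_arg[OF c(3) e(1,2) oF]; (intro sum.cong)?)
        (use B i in \<open>auto simp: diag_linear_def\<close>)
    then show ?thesis using i by simp
  qed
  have 2: "mcoeff (mfps_subst (N' $ i) B) a - mcoeff (mfps_subst (N' $ i) B') a = l i * (mcoeff (B $ i) a - mcoeff (B' $ i) a)"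
  proof -
    have "mcoeff (mfps_subst (N' $ i) B) a - mcoeff (mfps_subst (N' $ i) B') a
        = (\<Sum>j<n. if i = j then l i * mcoeff (B $ j - B' $ j) a else 0)"
      using d a by (subst mcoeff_subst_diff_arg[OF c(6) e(3,4) oB]; (intro sum.cong)?)
        (use N i in \<open>auto simp: diag_linear_def\<close>)
    then show ?thesis using i by simp
  qed
  have 3: "mcoeff (mfps_subst (B $ i) F') a - mcoeff (mfps_subst (B' $ i) F') a
      = mpow n l a * (mcoeff (B $ i) a - mcoeff (B' $ i) a)"
    using mcoeff_subst_leading[OF _ F(2) oB[OF i] a] by (simp add: c subst_diff[OF c(3,4) e(2)])
  have 4: "mcoeff (mfps_subst (N $ i) B) a - mcoeff (mfps_subst (N' $ i) B) a
      = mcoeff (N $ i) a - mcoeff (N' $ i) a"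
    using mcoeff_subst_leading[OF _ B(1) oN[OF i] a] by (simp add: c subst_diff[OF c(5,6) e(3)])
  have "mcoeff (mfps_subst (B $ i) F - mfps_subst (N $ i) B) a
         - mcoeff (mfps_subst (B' $ i) F' - mfps_subst (N' $ i) B') a
      = (mcoeff (mfps_subst (B $ i) F) a - mcoeff (mfps_subst (B $ i) F') a)
        + (mcoeff (mfps_subst (B $ i) F') a - mcoeff (mfps_subst (B' $ i) F') a)
        - (mcoeff (mfps_subst (N $ i) B) a - mcoeff (mfps_subst (N' $ i) B) a)
        - (mcoeff (mfps_subst (N' $ i) B) a - mcoeff (mfps_subst (N' $ i) B') a)"
    by simp
  then show ?thesis unfolding 1 2 3 4 by (simp add: algebra_simps)
qed

text \<open>There is one unknown per component and monomial: it is a coefficient of \<open>N\<close>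
  at resonant monomials and of \<open>B\<close> at all others.\<close>

lemma normal_form_exists:
  assumes nr: "nonresonant n l" and F: "diag_linear n l F"
  shows "\<exists>B N. normal_form n l F B N"
proof -
  define B :: "(nat \<times> monomial \<Rightarrow> complex) \<Rightarrow> complex mfps vec" where
    "B X = vec n (\<lambda>i. mmonom 1 0 * mvar i + higher_terms n (\<lambda>a. if resonant n i a then 0 else X (i, a)))" for X
  define N :: "(nat \<times> monomial \<Rightarrow> complex) \<Rightarrow> complex mfps vec" where
    "N X = vec n (\<lambda>i. mmonom (l i) 0 * mvar i + higher_terms n (\<lambda>a. if resonant n i a then X (i, a) else 0))" for X
  define good where "good = (\<lambda>(i, a). i < n \<and> Poly_Mapping.keys a \<subseteq> {..<n} \<and> 2 \<le> mdegree a)"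
  define \<Phi> where "\<Phi> X = (\<lambda>(i, a). if good (i, a)
      then mcoeff (mfps_subst (B X $ i) F - mfps_subst (N X $ i) (B X)) a else X (i, a))" for X
  \<comment> \<open>The slopes come from the homological equation: \<open>- 1\<close> where the
    unknown belongs to \<open>N\<close>, and a difference of eigenvalues, nonzero by nonresonance,
    where it belongs to \<open>B\<close>.\<close>
  define c where "c = (\<lambda>(i, a). if good (i, a) then if resonant n i a then - 1 else mpow n l a - l i else 1)"
  have dB: "diag_linear n (\<lambda>_. 1) (B X)" and dN: "diag_linear n l (N X)" for X
    unfolding B_def N_def
    using diag_linear_higher_terms[of n "\<lambda>_. 1" "\<lambda>i a. if resonant n i a then 0 else X (i, a)"]
      diag_linear_higher_terms[of n l "\<lambda>i a. if resonant n i a then X (i, a) else 0"] by auto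
  have Be: "B X \<in> endos n" and Ne: "N X \<in> endos n" for X
    using dB[of X] dN[of X] by (auto simp: diag_linear_def)
  have Fe: "F \<in> endos n" using F by (simp add: diag_linear_def)
  have "\<exists>X. \<forall>j. \<Phi> X j = 0"
  proof (rule triangular_solution[where \<delta> = "\<lambda>(i :: nat, a). mdegree a" and c = c])
    fix X Y :: "nat \<times> monomial \<Rightarrow> complex" and j
    assume eq: "\<And>j'. (case j' of (i :: nat, a) \<Rightarrow> mdegree a) < (case j of (i :: nat, a) \<Rightarrow> mdegree a) \<Longrightarrow> X j' = Y j'"
    obtain i a where j: "j = (i, a)" by (cases j)
    have eq': "X (i', b) = Y (i', b)" if "mdegree b < mdegree a" for i' b
      using eq[of "(i', b)"] that by (simp add: j)
    show "\<Phi> X j - \<Phi> Y j = c j * (X j - Y j)"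
    proof (cases "good j")
      case True
      then have i: "i < n" and a: "Poly_Mapping.keys a \<subseteq> {..<n}" "2 \<le> mdegree a" by (auto simp: good_def j)
      have oB: "order_ge (mdegree a) (B X $ k - B Y $ k)" and oN: "order_ge (mdegree a) (N X $ k - N Y $ k)"
        if "k < n" for k
        using eq' that by (auto simp: order_ge_def B_def N_def mcoeff_higher_terms)
      show ?thesis
        using True conjugacy_defect_diff[OF F F dB[of X] dB[of Y] dN[of X] dN[of Y] a(2) oB oN _ i refl] i a
        by (simp add: \<Phi>_def j c_def) (simp add: B_def N_def mcoeff_higher_terms)
    qed (simp add: \<Phi>_def j c_def)
  next
    fix j :: "nat \<times> monomial"
    show "c j \<noteq> 0"
      using nr by (cases j) (auto simp: c_def good_def nonresonant_def)
  qed
  then obtain X where X: "\<And>j. \<Phi> X j = 0" by blast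
  have "mcomp n (B X) F = mcomp n (N X) (B X)"
  proof (rule eq_vecI)
    fix i assume "i < dim_vec (mcomp n (N X) (B X))"
    then have i: "i < n" by simp
    have "mfps_subst (B X $ i) F = mfps_subst (N X $ i) (B X)"
    proof (rule mfps_carrier_eqI[of _ n])
      fix j assume j: "j < n"
      have "mcoeff (mfps_subst (B X $ i) F) (Poly_Mapping.single j 1)
          = (\<Sum>k<n. if k = i then (if i = j then l i else 0) else 0)"
        unfolding mcoeff_subst_linear[OF endosD(2)[OF Be i] Fe]
        using F i j dB by (intro sum.cong) (auto simp: diag_linear_def)
      moreover have "mcoeff (mfps_subst (N X $ i) (B X)) (Poly_Mapping.single j 1)
          = (\<Sum>k<n. if k = i then (if i = j then l i else 0) else 0)"
        unfolding mcoeff_subst_linear[OF endosD(2)[OF Ne i] Be]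
        using dN i j dB by (intro sum.cong) (auto simp: diag_linear_def)
      ultimately show "mcoeff (mfps_subst (B X $ i) F) (Poly_Mapping.single j 1)
        = mcoeff (mfps_subst (N X $ i) (B X)) (Poly_Mapping.single j 1)" by simp
    next
      fix a :: monomial assume a: "Poly_Mapping.keys a \<subseteq> {..<n}" "mdegree a \<ge> 2"
      show "mcoeff (mfps_subst (B X $ i) F) a = mcoeff (mfps_subst (N X $ i) (B X)) a"
        using X[of "(i, a)"] a i by (simp add: \<Phi>_def good_def)
    qed (use i Fe Be Ne in \<open>auto simp: subst_carrier mcoeff_subst_0[of _ n] endosD[of _ n]\<close>)
    then show "mcomp n (B X) F $ i = mcomp n (N X) (B X) $ i" using i by simp
  qed simp
  then have "normal_form n l F (B X) (N X)"
    unfolding normal_form_def using dB[of X] dN[of X]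
    by (auto simp: B_def N_def mcoeff_higher_terms mcoeff_mvar)
  then show ?thesis by blast
qed

text \<open>Passing to the normal form is triangular in the degree: changing \<open>F\<close> from
  degree \<open>d\<close> on leaves \<open>N\<close> alone below \<open>d\<close>, and at a resonant
  monomial of degree \<open>d\<close> the change is passed on to \<open>N\<close> unaltered, as
  \<open>B\<close> has no coefficient there. This makes single coefficients of \<open>N\<close>
  adjustable.\<close>

lemma normal_form_diff:
  assumes nr: "nonresonant n l" and F: "diag_linear n l F" "diag_linear n l F'"
    and nf: "normal_form n l F B N" "normal_form n l F' B' N'"
    and d: "d \<ge> 2" and oF: "\<And>i. i < n \<Longrightarrow> order_ge d (F $ i - F' $ i)"
    and i: "i < n"
  shows "order_ge d (N $ i - N' $ i)"
    and "resonant n i a \<Longrightarrow> mdegree a = d \<Longrightarrow>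
      mcoeff (N $ i) a - mcoeff (N' $ i) a = mcoeff (F $ i) a - mcoeff (F' $ i) a"
proof -
  have B: "diag_linear n (\<lambda>_. 1) B" "diag_linear n (\<lambda>_. 1) B'" and N: "diag_linear n l N" "diag_linear n l N'"
    using nf by (auto simp: normal_form_def)
  have e: "B \<in> endos n" "B' \<in> endos n" "N \<in> endos n" "N' \<in> endos n"
    using B N by (auto simp: diag_linear_def)
  have defect: "(mpow n l a - l i) * (mcoeff (B $ i) a - mcoeff (B' $ i) a)
         + (mcoeff (F $ i) a - mcoeff (F' $ i) a) - (mcoeff (N $ i) a - mcoeff (N' $ i) a) = 0"
    if "i < n" "mdegree a = k" "k \<ge> 2" "k \<le> d"
      "\<And>i. i < n \<Longrightarrow> order_ge k (B $ i - B' $ i) \<and> order_ge k (N $ i - N' $ i)" for i a k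
  proof -
    have "mfps_subst (B $ i) F = mfps_subst (N $ i) B" "mfps_subst (B' $ i) F' = mfps_subst (N' $ i) B'"
      using nf that(1) by (metis mcomp_index normal_form_def)+
    moreover have "\<And>i. i < n \<Longrightarrow> order_ge k (F $ i - F' $ i)"
      using oF that(4) order_ge_mono by blast
    ultimately show ?thesis
      using conjugacy_defect_diff[OF F B N that(3) _ _ _ that(1,2)] that(5) by simp
  qed
  \<comment> \<open>Induction on the degree up to which both \<open>B\<close> and \<open>N\<close>
    agree; each step solves the homological equation with vanishing right-hand side.\<close>
  have ord: "\<forall>i<n. order_ge k (B $ i - B' $ i) \<and> order_ge k (N $ i - N' $ i)" if "k \<le> d" "k \<ge> 2" for k
    using that(2,1)
  proof (induction k rule: dec_induct)
    case base
    have "order_ge 2 (f - g)"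
      if "order_ge 2 (f - h)" "order_ge 2 (g - h)" for f g h :: "complex mfps"
      using that by (simp add: order_ge_def)
    then show ?case
      using diag_linear_leading[OF B(1)] diag_linear_leading[OF B(2)]
        diag_linear_leading[OF N(1)] diag_linear_leading[OF N(2)] by blast
  next
    case (step k)
    then have IH: "\<And>i. i < n \<Longrightarrow> order_ge k (B $ i - B' $ i) \<and> order_ge k (N $ i - N' $ i)" by simp
    have eq: "mcoeff (B $ i) a = mcoeff (B' $ i) a \<and> mcoeff (N $ i) a = mcoeff (N' $ i) a"
      if i: "i < n" and a: "mdegree a = k" for i a
    proof (cases "Poly_Mapping.keys a \<subseteq> {..<n}")
      case keys: True
      have F0: "mcoeff (F $ i) a = mcoeff (F' $ i) a"
        using oF[OF i] a step by (simp add: order_ge_def)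
      show ?thesis
      proof (cases "resonant n i a")
        case True
        then have "mcoeff (B $ i) a = 0" "mcoeff (B' $ i) a = 0"
          using nf i a step by (auto simp: normal_form_def)
        then show ?thesis using defect[OF i a _ _ IH] step F0 by simp
      next
        case False
        then have "mcoeff (N $ i) a = 0" "mcoeff (N' $ i) a = 0"
          using nf i a step by (auto simp: normal_form_def)
        moreover have "mpow n l a \<noteq> l i"
          using nr False i keys a step by (auto simp: nonresonant_def)
        ultimately show ?thesis using defect[OF i a _ _ IH] step F0 by simp
      qed
    qed (use e i in \<open>simp add: mfps_carrierD[of _ n] endosD\<close>)
    show ?case
      using IH eq by (auto simp: order_ge_def less_Suc_eq)
  qed
  show "order_ge d (N $ i - N' $ i)" using ord[of d] d i by simp
  show "mcoeff (N $ i) a - mcoeff (N' $ i) a = mcoeff (F $ i) a - mcoeff (F' $ i) a"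
    if r: "resonant n i a" and a: "mdegree a = d"
  proof -
    have "mcoeff (B $ i) a = 0" "mcoeff (B' $ i) a = 0"
      using nf i a d r by (auto simp: normal_form_def)
    then show ?thesis using defect[OF i a d order_refl] ord[of d] d by simp
  qed
qed

section \<open>Maps that multiply each variable by a series in the product of the variables\<close>

text \<open>This is \<open>f(p)\<close>. A monomial is a power of \<open>p\<close> iff it is the
  \<open>rep\<close> of its own exponent at variable 0, and that exponent is the power.\<close>

definition embed :: "nat \<Rightarrow> complex fps \<Rightarrow> complex mfps" where
  "embed n f = MFPS (\<lambda>m. if m = rep n (Poly_Mapping.lookup m 0) then fps_nth f (Poly_Mapping.lookup m 0) else 0)"

lemma mcoeff_embed_rep: "n \<ge> 1 \<Longrightarrow> mcoeff (embed n f) (rep n k) = fps_nth f k"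
  by (simp add: embed_def lookup_rep)

lemma mcoeff_embed_eq_0: "(\<And>k. m \<noteq> rep n k) \<Longrightarrow> mcoeff (embed n f) m = 0"
  by (simp add: embed_def)

lemma rep_add: "rep n (i + j) = rep n i + rep n j"
  by (rule poly_mapping_eqI) (simp add: lookup_rep lookup_add)

lemma rep_0 [simp]: "rep n 0 = 0"
  by (simp add: rep_def)

lemma rep_inject:
  assumes "n \<ge> 1"
  shows "rep n i = rep n j \<longleftrightarrow> i = j"
proof
  assume "rep n i = rep n j"
  then have "Poly_Mapping.lookup (rep n i) 0 = Poly_Mapping.lookup (rep n j) 0" by (simp only:)
  then show "i = j" using assms by (simp add: lookup_rep)
qed simp

lemma embed_carrier [simp]: "embed n f \<in> mfps_carrier n"
proof (rule mfps_carrierI)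
  fix m assume "mcoeff (embed n f) m \<noteq> 0"
  then obtain k where "m = rep n k" using mcoeff_embed_eq_0 by blast
  then show "Poly_Mapping.keys m \<subseteq> {..<n}" using keys_rep by simp
qed

lemma embed_eqI:
  assumes "n \<ge> 1" "\<And>k. mcoeff g (rep n k) = fps_nth f k"
    and "\<And>m. (\<And>k. m \<noteq> rep n k) \<Longrightarrow> mcoeff g m = 0"
  shows "g = embed n f"
proof (rule mfps_eqI)
  fix m
  show "mcoeff g m = mcoeff (embed n f) m"
    using assms mcoeff_embed_eq_0[of m n f] by (cases "\<exists>k. m = rep n k") (auto simp: mcoeff_embed_rep)
qed

lemma embed_mult:
  assumes n: "n \<ge> 1"
  shows "embed n (f * g) = embed n f * embed n g"
proof (rule embed_eqI[OF n, symmetric])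
  fix k
  have "mcoeff (embed n f * embed n g) (rep n k)
      = (\<Sum>(a, b)\<in>(\<lambda>i. (rep n i, rep n (k - i))) ` {0..k}. mcoeff (embed n f) a * mcoeff (embed n g) b)"
    unfolding mcoeff_mult
  proof (rule sum.mono_neutral_right[OF finite_decomps])
    show "(\<lambda>i. (rep n i, rep n (k - i))) ` {0..k} \<subseteq> decomps (rep n k)"
      by (auto simp: decomps_def simp flip: rep_add)
    show "\<forall>p\<in>decomps (rep n k) - (\<lambda>i. (rep n i, rep n (k - i))) ` {0..k}.
        (case p of (a, b) \<Rightarrow> mcoeff (embed n f) a * mcoeff (embed n g) b) = 0"
    proof clarify
      fix a b assume ab: "(a, b) \<in> decomps (rep n k)" "(a, b) \<notin> (\<lambda>i. (rep n i, rep n (k - i))) ` {0..k}"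
      have False if "a = rep n i" "b = rep n j" for i j
      proof -
        have "i + j = k" using ab(1) that n by (simp add: decomps_def rep_inject flip: rep_add)
        then have "(a, b) = (rep n i, rep n (k - i))" "i \<in> {0..k}" using that by auto
        then show False using ab(2) by blast
      qed
      then show "mcoeff (embed n f) a * mcoeff (embed n g) b = 0"
        by (metis mcoeff_embed_eq_0 mult_zero_left mult_zero_right)
    qed
  qed
  also have "\<dots> = (\<Sum>i=0..k. fps_nth f i * fps_nth g (k - i))"
    using n by (subst sum.reindex) (auto simp: inj_on_def rep_inject mcoeff_embed_rep)
  finally show "mcoeff (embed n f * embed n g) (rep n k) = fps_nth (f * g) k"
    by (simp add: fps_mult_nth)
next
  fix m assume m: "\<And>k. m \<noteq> rep n k"
  have "mcoeff (embed n f) a * mcoeff (embed n g) b = 0" if "a + b = m" for a b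
    using that m by (metis mcoeff_embed_eq_0 mult_zero_left mult_zero_right rep_add)
  then show "mcoeff (embed n f * embed n g) m = 0"
    unfolding mcoeff_mult by (intro sum.neutral) (auto simp: decomps_def)
qed

lemma embed_const:
  assumes "n \<ge> 1"
  shows "embed n (fps_const c) = mmonom c 0"
proof (rule embed_eqI[OF assms, symmetric])
  show "mcoeff (mmonom c 0) m = 0" if "\<And>k. m \<noteq> rep n k" for m
    using that[of 0] by (simp add: mcoeff_mmonom)
qed (use rep_inject[OF assms, of _ 0] in \<open>auto simp: mcoeff_mmonom\<close>)

lemma embed_1 [simp]: "n \<ge> 1 \<Longrightarrow> embed n 1 = 1"
  using embed_const[of n 1] by (simp add: one_eq_mmonom)

lemma embed_X: "n \<ge> 1 \<Longrightarrow> embed n fps_X = mmonom 1 (rep n 1)"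
  by (rule embed_eqI[symmetric]) (auto simp: mcoeff_mmonom rep_inject fps_X_def)

lemma embed_power: "n \<ge> 1 \<Longrightarrow> embed n (f ^ k) = embed n f ^ k"
  by (induction k) (auto simp: embed_mult)

lemma embed_prod: "n \<ge> 1 \<Longrightarrow> embed n (prod f A) = (\<Prod>i\<in>A. embed n (f i))"
  by (induction A rule: infinite_finite_induct) (auto simp: embed_mult)

text \<open>If \<open>G\<close> sends \<open>p\<close> to \<open>g(p)\<close>, it sends
  \<open>p^k\<close> to \<open>g(p)^k\<close>; the rest is the comparison of the two truncated
  sums.\<close>

lemma subst_embed:
  assumes n: "n \<ge> 1" and G: "G \<in> endos n" and P: "(\<Prod>i<n. G $ i) = embed n g" and g: "fps_nth g 0 = 0"
  shows "mfps_subst (embed n f) G = embed n (f oo g)"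
proof -
  have Pk: "monom_subst (rep n k) G = embed n (g ^ k)" for k
    using n P endosD(1)[OF G] by (simp add: monom_subst_def lookup_rep prod_power_distrib[symmetric] embed_power)
  have eq: "mcoeff (mfps_subst (embed n f) G) m = (\<Sum>i\<le>mdegree m. fps_nth f i * mcoeff (embed n (g ^ i)) m)" for m
  proof -
    define d where "d = mdegree m"
    \<comment> \<open>The bound \<open>n * d\<close> in place of \<open>d\<close> makes the powers
      of \<open>p\<close> in the index set exactly \<open>p^0, ..., p^d\<close>, because
      \<open>p^i\<close> has degree \<open>n * i\<close>.\<close>
    have "d \<le> n * d" using n by simp
    then have "mcoeff (mfps_subst (embed n f) G) m
        = (\<Sum>k\<in>monomials_upto n (n * d). mcoeff (embed n f) k * mcoeff (monom_subst k G) m)"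
      by (intro mcoeff_subst[OF embed_carrier G]) (simp add: d_def)
    also have "\<dots> = (\<Sum>k\<in>rep n ` {..d}. mcoeff (embed n f) k * mcoeff (monom_subst k G) m)"
    proof (rule sum.mono_neutral_right)
      show "rep n ` {..d} \<subseteq> monomials_upto n (n * d)"
        using keys_rep by (auto simp: monomials_upto_def mdegree_rep)
      show "\<forall>k\<in>monomials_upto n (n * d) - rep n ` {..d}. mcoeff (embed n f) k * mcoeff (monom_subst k G) m = 0"
      proof
        fix k assume k: "k \<in> monomials_upto n (n * d) - rep n ` {..d}"
        have "k \<noteq> rep n i" for i
          using k n by (cases "i \<le> d") (auto simp: monomials_upto_def mdegree_rep)
        then show "mcoeff (embed n f) k * mcoeff (monom_subst k G) m = 0" by (simp add: mcoeff_embed_eq_0)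
      qed
    qed simp
    also have "\<dots> = (\<Sum>i\<le>d. fps_nth f i * mcoeff (embed n (g ^ i)) m)"
      using n by (subst sum.reindex) (auto simp: inj_on_def rep_inject mcoeff_embed_rep Pk)
    finally show ?thesis by (simp add: d_def)
  qed
  show ?thesis
  proof (rule embed_eqI[OF n])
    fix k
    have "mcoeff (mfps_subst (embed n f) G) (rep n k) = (\<Sum>i\<le>n * k. fps_nth f i * fps_nth (g ^ i) k)"
      using n by (simp add: eq mdegree_rep mcoeff_embed_rep)
    also have "\<dots> = (\<Sum>i=0..k. fps_nth f i * fps_nth (g ^ i) k)"
      by (rule sum.mono_neutral_right) (use n g in \<open>auto simp: startsby_zero_power_prefix not_le\<close>)
    finally show "mcoeff (mfps_subst (embed n f) G) (rep n k) = fps_nth (f oo g) k"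
      by (simp add: fps_compose_nth)
  next
    fix m assume "\<And>k. m \<noteq> rep n k"
    then show "mcoeff (mfps_subst (embed n f) G) m = 0" by (simp add: eq mcoeff_embed_eq_0)
  qed
qed

section \<open>The composition law for multipliers in p\<close>

definition mult_map :: "nat \<Rightarrow> (nat \<Rightarrow> complex fps) \<Rightarrow> complex mfps vec" where
  "mult_map n w = vec n (\<lambda>i. mvar i * embed n (w i))"

lemma mult_map_index: "i < n \<Longrightarrow> mult_map n w $ i = mvar i * embed n (w i)"
  by (simp add: mult_map_def)

lemma mult_map_cong: "(\<And>i. i < n \<Longrightarrow> w i = v i) \<Longrightarrow> mult_map n w = mult_map n v"
  by (auto simp: mult_map_def)

lemma mult_map_endos [simp]: "mult_map n w \<in> endos n"
  unfolding mult_map_def by (rule vec_in_endos) (auto simp: mcoeff_mult_0 mcoeff_mvar)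

lemma prod_mvar: "n \<ge> 1 \<Longrightarrow> (\<Prod>i<n. mvar i) = embed n fps_X"
  using monom_subst_mvar[OF keys_rep, of n 1] by (simp add: monom_subst_def lookup_rep embed_X)

lemma prod_mult_map:
  "n \<ge> 1 \<Longrightarrow> (\<Prod>i<n. mult_map n w $ i) = embed n (fps_X * (\<Prod>i<n. w i))"
  by (simp add: mult_map_index prod.distrib prod_mvar embed_mult embed_prod)

text \<open>The inner map sends \<open>p\<close> to \<open>p\<close> times the product of the
  \<open>v i\<close>. If that product is 1, then \<open>p\<close> is invariant and composition is
  the pointwise product of the multipliers; most later uses are of this kind.\<close>

lemma mult_map_mcomp:
  assumes n: "n \<ge> 1"
  shows "mcomp n (mult_map n w) (mult_map n v)
       = mult_map n (\<lambda>i. v i * (w i oo (fps_X * (\<Prod>i<n. v i))))"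
proof (rule eq_vecI)
  fix i assume "i < dim_vec (mult_map n (\<lambda>i. v i * (w i oo (fps_X * (\<Prod>i<n. v i)))))"
  then have i: "i < n" by (simp add: mult_map_def)
  have "mcomp n (mult_map n w) (mult_map n v) $ i
      = mfps_subst (mvar i) (mult_map n v) * mfps_subst (embed n (w i)) (mult_map n v)"
    using i by (simp add: mult_map_index subst_mult[of _ n])
  also have "mfps_subst (mvar i) (mult_map n v) = mvar i * embed n (v i)"
    using i by (simp add: mult_map_def)
  also have "mfps_subst (embed n (w i)) (mult_map n v) = embed n (w i oo (fps_X * (\<Prod>i<n. v i)))"
    by (rule subst_embed[OF n _ prod_mult_map[OF n]]) simp_all
  finally show "mcomp n (mult_map n w) (mult_map n v) $ i
      = mult_map n (\<lambda>i. v i * (w i oo (fps_X * (\<Prod>i<n. v i)))) $ i"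
    using i n by (simp add: mult_map_index embed_mult mult_ac)
qed (simp add: mult_map_def)

lemma mult_map_1: "n \<ge> 1 \<Longrightarrow> mult_map n (\<lambda>_. 1) = vec n mvar"
  by (auto simp: mult_map_def)

lemma mcoeff_mvar_mult_embed:
  assumes "n \<ge> 1"
  shows "mcoeff (mvar i * embed n f) (Poly_Mapping.single i 1 + rep n k) = fps_nth f k"
    and "\<not> resonant n i m \<Longrightarrow> mcoeff (mvar i * embed n f) m = 0"
proof -
  show "mcoeff (mvar i * embed n f) (Poly_Mapping.single i 1 + rep n k) = fps_nth f k"
    using assms by (simp add: mvar_eq_mmonom mcoeff_mmonom_mult_add[of 1 _ _ "rep n k", simplified] mcoeff_embed_rep)
  show "mcoeff (mvar i * embed n f) m = 0" if "\<not> resonant n i m"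
  proof (cases "\<exists>b. m = Poly_Mapping.single i 1 + b")
    case True
    then obtain b where b: "m = Poly_Mapping.single i 1 + b" by blast
    then have "b \<noteq> rep n k" for k using that by (auto simp: resonant_def)
    then show ?thesis unfolding b mvar_eq_mmonom mcoeff_mmonom_mult_add by (simp add: mcoeff_embed_eq_0)
  qed (auto simp: mvar_eq_mmonom intro!: mcoeff_mmonom_mult_eq_0)
qed

lemma diag_linear_mult_map:
  assumes n: "n \<ge> 2"
  shows "diag_linear n (\<lambda>i. fps_nth (w i) 0) (mult_map n w)"
  unfolding diag_linear_def
proof (intro conjI allI impI mult_map_endos)
  fix i j assume ij: "i < n" "j < n"
  show "mcoeff (mult_map n w $ i) (Poly_Mapping.single j 1) = (if i = j then fps_nth (w i) 0 else 0)"
  proof (cases "i = j")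
    case True
    then show ?thesis using mcoeff_mvar_mult_embed(1)[of n j "w j" 0] n ij by (simp add: mult_map_index)
  next
    case False
    have "\<not> resonant n i (Poly_Mapping.single j 1)"
    proof
      assume "resonant n i (Poly_Mapping.single j 1)"
      then obtain k where "Poly_Mapping.single j 1 = Poly_Mapping.single i 1 + rep n k" by (auto simp: resonant_def)
      from arg_cong[OF this, of "\<lambda>m. Poly_Mapping.lookup m i"] show False
        using False by (simp add: lookup_add lookup_single)
    qed
    then show ?thesis using mcoeff_mvar_mult_embed(2)[of n i] n ij False by (simp add: mult_map_index)
  qed
qed

lemma diag_linear_carrier:
  assumes "diag_linear n l F" "\<And>i. i < n \<Longrightarrow> l i \<noteq> 0"
  shows "F \<in> carrier (formal_maps n)"
proof -
  let ?D = "\<lambda>l. mat n n (\<lambda>(i, j). if i = j then l i else 0 :: complex)"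
  have mult: "?D l * ?D l' = 1\<^sub>m n" if "\<And>i. i < n \<Longrightarrow> l i * l' i = 1" for l l'
  proof (rule eq_matI)
    fix i j assume "i < dim_row (1\<^sub>m n :: complex mat)" "j < dim_col (1\<^sub>m n :: complex mat)"
    then have ij: "i < n" "j < n" by auto
    have "(?D l * ?D l') $$ (i, j) = row (?D l) i \<bullet> col (?D l') j"
      using ij by (intro index_mult_mat) auto
    also have "\<dots> = (\<Sum>k\<in>{0..<n}. if i = k then (if i = j then l i * l' i else 0) else 0)"
      unfolding scalar_prod_def by (rule sum.cong) (use ij in auto)
    finally have "(?D l * ?D l') $$ (i, j) = (if i = j then l i * l' i else 0)" using ij by simp
    then show "(?D l * ?D l') $$ (i, j) = 1\<^sub>m n $$ (i, j)" using ij that by simp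
  qed auto
  have "invertible_mat (?D l)"
    by (rule invertible_matI[of _ n "?D (\<lambda>i. inverse (l i))"]) (use assms(2) in \<open>auto intro!: mult\<close>)
  then show ?thesis using assms(1) by (simp add: carrier_formal_maps diag_linear_iff_linear_part)
qed

lemma mult_map_carrier:
  "n \<ge> 2 \<Longrightarrow> (\<And>i. i < n \<Longrightarrow> fps_nth (w i) 0 \<noteq> 0) \<Longrightarrow> mult_map n w \<in> carrier (formal_maps n)"
  using diag_linear_carrier[OF diag_linear_mult_map] by blast

lemma normal_form_mult_map:
  assumes n: "n \<ge> 2" and nf: "normal_form n l F B N"
  shows "N = mult_map n (\<lambda>i. Abs_fps (\<lambda>k. mcoeff (N $ i) (Poly_Mapping.single i 1 + rep n k)))"
    (is "N = mult_map n ?w")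
proof (rule eq_vecI)
  have dN: "diag_linear n l N" using nf by (simp add: normal_form_def)
  then have Ne: "N \<in> endos n" by (simp add: diag_linear_def)
  show "dim_vec N = dim_vec (mult_map n ?w)" using Ne by (simp add: mult_map_def endosD)
  fix i assume "i < dim_vec (mult_map n ?w)"
  then have i: "i < n" by (simp add: mult_map_def)
  have "mcoeff (N $ i) a = mcoeff (mvar i * embed n (?w i)) a" for a
  proof (cases "resonant n i a")
    case True
    then obtain k where "a = Poly_Mapping.single i 1 + rep n k" by (auto simp: resonant_def)
    then show ?thesis using n mcoeff_mvar_mult_embed(1)[of n i "?w i" k] by simp
  next
    case False
    have "mcoeff (N $ i) a = 0"
    proof -
      \<comment> \<open>\<open>normal_form\<close> constrains \<open>N\<close> from degree 2 on; the
        lower degrees follow from the diagonal linear part, where \<open>x_i\<close> itself is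
        resonant with \<open>k = 0\<close>.\<close>
      consider "a = 0" | "mdegree a = 1" | "mdegree a \<ge> 2" using mdegree_eq_0_iff[of a] by linarith
      then show ?thesis
      proof cases
        case 1
        then show ?thesis using Ne i by (simp add: endosD)
      next
        case 2
        then obtain j where j: "a = Poly_Mapping.single j 1" by (rule mdegree_eq_1E)
        have "i \<noteq> j" using False j unfolding resonant_def by (metis add_0_right rep_0)
        moreover have "\<not> Poly_Mapping.keys a \<subseteq> {..<n}" if "j \<ge> n" using that j by simp
        ultimately show ?thesis
          using dN i mfps_carrierD[OF endosD(2)[OF Ne i]] j
          by (cases "j < n") (auto simp: diag_linear_def)
      next
        case 3
        then show ?thesis using nf i False by (simp add: normal_form_def)
      qed
    qed
    then show ?thesis using mcoeff_mvar_mult_embed(2)[OF _ False] n by simp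
  qed
  then have "N $ i = mvar i * embed n (?w i)" by (rule mfps_eqI)
  then show "N $ i = mult_map n ?w $ i" unfolding mult_map_index[OF i] .
qed

section \<open>Permutations of the variables\<close>

definition perm_map :: "nat \<Rightarrow> (nat \<Rightarrow> nat) \<Rightarrow> complex mfps vec" where
  "perm_map n p = vec n (\<lambda>i. mvar (p i))"

text \<open>A permutation of the variables fixes \<open>p\<close>, so conjugation by it merely
  permutes the multipliers.\<close>

lemma perm_map_mcomp_mult_map_mcomp:
  assumes n: "n \<ge> 1" and p: "p permutes {..<n}" "\<And>i. p (p i) = i"
  shows "mcomp n (perm_map n p) (mcomp n (mult_map n w) (perm_map n p)) = mult_map n (\<lambda>i. w (p i))"
proof (rule eq_vecI)
  have lt: "p i < n \<longleftrightarrow> i < n" for i using permutes_in_image[OF p(1), of i] by simp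
  have S: "perm_map n p \<in> endos n"
    unfolding perm_map_def by (rule vec_in_endos) (auto simp: lt mcoeff_mvar)
  have P: "(\<Prod>i<n. perm_map n p $ i) = embed n fps_X"
    using prod.permute[OF p(1), of "mvar :: nat \<Rightarrow> complex mfps"] prod_mvar[OF n] by (simp add: perm_map_def)
  fix i assume "i < dim_vec (mult_map n (\<lambda>i. w (p i)))"
  then have i: "i < n" by (simp add: mult_map_def)
  have "mcomp n (perm_map n p) (mcomp n (mult_map n w) (perm_map n p)) $ i
      = mfps_subst (mvar (p i) * embed n (w (p i))) (perm_map n p)"
    using i by (simp add: perm_map_def lt mult_map_index)
  also have "\<dots> = perm_map n p $ p i * embed n (w (p i))"
    using i n S by (simp add: subst_mult[of _ n] lt subst_embed[OF n S P]) (simp add: perm_map_def lt)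
  finally show "mcomp n (perm_map n p) (mcomp n (mult_map n w) (perm_map n p)) $ i = mult_map n (\<lambda>i. w (p i)) $ i"
    using i by (simp add: perm_map_def lt p mult_map_index)
qed (simp add: mult_map_def)

section \<open>Strongly reversible elements\<close>

definition strongly_reversible :: "('a, 'b) monoid_scheme \<Rightarrow> 'a \<Rightarrow> bool" where
  "strongly_reversible G g \<longleftrightarrow> (\<exists>a b. involution G a \<and> involution G b \<and> g = a \<otimes>\<^bsub>G\<^esub> b)"

abbreviation sr_product :: "('a, 'b) monoid_scheme \<Rightarrow> nat \<Rightarrow> 'a \<Rightarrow> bool" where
  "sr_product G k g \<equiv> product_of G k (strongly_reversible G) g"

lemma product_of_mono:
  "product_of G k P g \<Longrightarrow> (\<And>x. P x \<Longrightarrow> Q x) \<Longrightarrow> product_of G k Q g"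
  by (auto simp: product_of_def)

context group
begin

lemma involution_iff: "involution G x \<longleftrightarrow> x \<in> carrier G \<and> x \<otimes> x = \<one>"
  unfolding involution_def using inv_equality r_inv by metis

lemma involution_one: "involution G \<one>"
  by (simp add: involution_iff)

lemma strongly_reversible_closed: "strongly_reversible G g \<Longrightarrow> g \<in> carrier G"
  by (auto simp: strongly_reversible_def involution_def)

lemma strongly_reversible_one: "strongly_reversible G \<one>"
  unfolding strongly_reversible_def using involution_one by force

lemma strongly_reversible_inv:
  assumes "strongly_reversible G g"
  shows "strongly_reversible G (inv g)"
proof -
  obtain a b where ab: "involution G a" "involution G b" "g = a \<otimes> b"
    using assms by (auto simp: strongly_reversible_def)
  then have "inv g = b \<otimes> a" by (simp add: involution_def inv_mult_group)
  then show ?thesis using ab by (auto simp: strongly_reversible_def)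
qed

lemma strongly_reversible_imp_reversible:
  assumes "strongly_reversible G g"
  shows "reversible G g"
proof -
  obtain a b where inv: "involution G a" "involution G b" and g: "g = a \<otimes> b"
    using assms by (auto simp: strongly_reversible_def)
  then have ab: "a \<in> carrier G" "b \<in> carrier G" "a \<otimes> a = \<one>" "inv a = a" "inv b = b" "g = a \<otimes> b"
    by (simp_all add: involution_iff) (use inv in \<open>simp_all add: involution_def\<close>)
  have "inv a \<otimes> g \<otimes> a = (a \<otimes> a) \<otimes> b \<otimes> a"
    using ab(1,2) unfolding ab(4,6) by (simp add: m_assoc)
  also have "\<dots> = inv g" using ab by (simp add: inv_mult_group)
  finally show ?thesis
    unfolding reversible_def using ab by (intro conjI bexI[of _ a]) auto
qed

lemma conj_mult:
  "h \<in> carrier G \<Longrightarrow> a \<in> carrier G \<Longrightarrow> b \<in> carrier G \<Longrightarrow>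
    h \<otimes> (a \<otimes> b) \<otimes> inv h = (h \<otimes> a \<otimes> inv h) \<otimes> (h \<otimes> b \<otimes> inv h)"
  using inv_solve_left by (simp add: m_assoc)

lemma involution_conj:
  assumes "involution G a" "h \<in> carrier G"
  shows "involution G (h \<otimes> a \<otimes> inv h)"
  using assms conj_mult[of h a a] by (simp add: involution_iff)

lemma strongly_reversible_conj:
  assumes "strongly_reversible G g" "h \<in> carrier G"
  shows "strongly_reversible G (h \<otimes> g \<otimes> inv h)"
proof -
  obtain a b where ab: "involution G a" "involution G b" "g = a \<otimes> b"
    using assms by (auto simp: strongly_reversible_def)
  then have "h \<otimes> g \<otimes> inv h = (h \<otimes> a \<otimes> inv h) \<otimes> (h \<otimes> b \<otimes> inv h)"
    using assms by (simp add: conj_mult involution_def)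
  then show ?thesis
    using ab assms involution_conj unfolding strongly_reversible_def by blast
qed

lemma foldr_mult_closed:
  "set gs \<subseteq> carrier G \<Longrightarrow> foldr (\<otimes>) gs \<one> \<in> carrier G"
  by (induction gs) auto

lemma foldr_mult_append:
  "set gs \<subseteq> carrier G \<Longrightarrow> set hs \<subseteq> carrier G \<Longrightarrow>
    foldr (\<otimes>) (gs @ hs) \<one> = foldr (\<otimes>) gs \<one> \<otimes> foldr (\<otimes>) hs \<one>"
  by (induction gs) (auto simp: m_assoc foldr_mult_closed)

lemma sr_product_closed: "sr_product G k g \<Longrightarrow> g \<in> carrier G"
  unfolding product_of_def using foldr_mult_closed strongly_reversible_closed by blast

lemma sr_product_mult:
  assumes "sr_product G k g" "sr_product G l h"
  shows "sr_product G (k + l) (g \<otimes> h)"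
proof -
  obtain gs hs where gs: "length gs = k" "\<forall>x\<in>set gs. strongly_reversible G x" "g = foldr (\<otimes>) gs \<one>"
    and hs: "length hs = l" "\<forall>x\<in>set hs. strongly_reversible G x" "h = foldr (\<otimes>) hs \<one>"
    using assms by (auto simp: product_of_def)
  then have "g \<otimes> h = foldr (\<otimes>) (gs @ hs) \<one>"
    using foldr_mult_append[of gs hs] strongly_reversible_closed by (metis subsetI)
  then show ?thesis
    unfolding product_of_def using gs hs by (intro exI[of _ "gs @ hs"]) auto
qed

lemma sr_product_0: "sr_product G 0 \<one>"
  by (simp add: product_of_def)

lemma sr_product_1: "strongly_reversible G g \<Longrightarrow> sr_product G 1 g"
  unfolding product_of_def using strongly_reversible_closed by (intro exI[of _ "[g]"]) auto

lemma sr_product_ones: "sr_product G k \<one>"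
proof (induction k)
  case (Suc k)
  then show ?case
    using sr_product_mult[OF sr_product_1[OF strongly_reversible_one] Suc.IH] by simp
qed (rule sr_product_0)

text \<open>The identity counts as a factor, so a bound on the number of factors yields any larger
  exact number.\<close>

lemma sr_product_pad: "sr_product G k g \<Longrightarrow> k \<le> l \<Longrightarrow> sr_product G l g"
  using sr_product_mult[OF _ sr_product_ones, of k g "l - k"] by (simp add: sr_product_closed)

lemma sr_product_conj:
  assumes "sr_product G k g" "h \<in> carrier G"
  shows "sr_product G k (h \<otimes> g \<otimes> inv h)"
proof -
  obtain gs where gs: "length gs = k" "\<forall>x\<in>set gs. strongly_reversible G x" "g = foldr (\<otimes>) gs \<one>"
    using assms by (auto simp: product_of_def)
  have "sr_product G (length gs) (h \<otimes> foldr (\<otimes>) gs \<one> \<otimes> inv h)"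
    using gs(2)
  proof (induction gs)
    case Nil
    then show ?case using assms by (simp add: sr_product_0)
  next
    case (Cons x gs)
    have closed: "x \<in> carrier G" "foldr (\<otimes>) gs \<one> \<in> carrier G"
      using Cons.prems strongly_reversible_closed foldr_mult_closed[of gs] by auto
    have "sr_product G (1 + length gs) ((h \<otimes> x \<otimes> inv h) \<otimes> (h \<otimes> foldr (\<otimes>) gs \<one> \<otimes> inv h))"
      using Cons assms strongly_reversible_conj by (intro sr_product_mult sr_product_1) auto
    then show ?case using closed assms by (simp add: conj_mult)
  qed
  then show ?thesis using gs by simp
qed

lemma sr_product_conj_iff:
  assumes "g \<in> carrier G" "h \<in> carrier G" "sr_product G k (h \<otimes> g \<otimes> inv h)"
  shows "sr_product G k g"
proof -
  have "inv h \<otimes> (h \<otimes> g \<otimes> inv h) \<otimes> inv (inv h) = g"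
    using assms(1,2) by (simp add: m_assoc) (simp add: m_assoc[symmetric])
  then show ?thesis using sr_product_conj[OF assms(3), of "inv h"] assms(2) by simp
qed

lemma sr_product_imp_involution_product:
  assumes "sr_product G k g"
  shows "product_of G (2 * k) (involution G) g"
proof -
  obtain gs where gs: "length gs = k" "\<forall>x\<in>set gs. strongly_reversible G x" "g = foldr (\<otimes>) gs \<one>"
    using assms by (auto simp: product_of_def)
  have "product_of G (2 * length gs) (involution G) (foldr (\<otimes>) gs \<one>)"
    using gs(2)
  proof (induction gs)
    case (Cons x gs)
    then obtain hs where hs: "length hs = 2 * length gs" "\<forall>x\<in>set hs. involution G x"
      "foldr (\<otimes>) gs \<one> = foldr (\<otimes>) hs \<one>"
      by (auto simp: product_of_def)
    obtain a b where ab: "involution G a" "involution G b" "x = a \<otimes> b"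
      using Cons.prems by (auto simp: strongly_reversible_def)
    have "foldr (\<otimes>) hs \<one> \<in> carrier G"
      using hs by (intro foldr_mult_closed) (auto simp: involution_def)
    then have "foldr (\<otimes>) (x # gs) \<one> = foldr (\<otimes>) (a # b # hs) \<one>"
      using ab hs by (simp add: involution_def m_assoc)
    then show ?case
      unfolding product_of_def using ab hs by (intro exI[of _ "a # b # hs"]) auto
  qed (simp add: product_of_def)
  then show ?thesis using gs by simp
qed

end

interpretation formal_maps: group "formal_maps n"
  by (rule group_formal_maps)

lemma formal_maps_involutionI:
  "F \<in> carrier (formal_maps n) \<Longrightarrow> mcomp n F F = vec n mvar \<Longrightarrow> involution (formal_maps n) F"
  by (simp add: formal_maps.involution_iff)

lemma linear_part_id: "linear_part n (vec n mvar) = 1\<^sub>m n"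
  by (rule eq_matI) (auto simp: linear_part_def mcoeff_mvar)

text \<open>Membership in the group comes for free: the linear part squares to the identity and is
  therefore invertible.\<close>

lemma endo_involutionI:
  assumes S: "S \<in> endos n" and SS: "mcomp n S S = vec n mvar"
  shows "involution (formal_maps n) S"
proof (rule formal_maps_involutionI[OF _ SS])
  have "linear_part n S * linear_part n S = 1\<^sub>m n"
    using linear_part_mcomp[OF S S] by (simp add: SS linear_part_id)
  then show "S \<in> carrier (formal_maps n)"
    using S by (auto simp: carrier_formal_maps intro: invertible_matI[of _ n "linear_part n S"])
qed

lemma perm_map_involution:
  assumes p: "p permutes {..<n}" "\<And>i. p (p i) = i"
  shows "involution (formal_maps n) (perm_map n p)"
proof (rule endo_involutionI)
  have lt: "p i < n \<longleftrightarrow> i < n" for i using permutes_in_image[OF p(1), of i] by simp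
  show "perm_map n p \<in> endos n"
    unfolding perm_map_def by (rule vec_in_endos) (auto simp: lt mcoeff_mvar)
  show "mcomp n (perm_map n p) (perm_map n p) = vec n mvar"
    by (rule eq_vecI) (auto simp: perm_map_def lt p)
qed

text \<open>Conjugation by the permutation inverts every multiplier, hence inverts the map
  \<open>M\<close>. With \<open>S M S\<close> inverse to \<open>M\<close>, both \<open>S\<close> and
  \<open>S M\<close> are involutions, and \<open>M = S (S M)\<close>.\<close>

lemma mult_map_strongly_reversible:
  assumes n: "n \<ge> 2" and p: "p permutes {..<n}" "\<And>i. p (p i) = i"
    and v0: "\<And>i. i < n \<Longrightarrow> fps_nth (v i) 0 \<noteq> 0"
    and v1: "(\<Prod>i<n. v i) = 1" and vp: "\<And>i. i < n \<Longrightarrow> v (p i) * v i = 1"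
  shows "strongly_reversible (formal_maps n) (mult_map n v)"
proof -
  let ?S = "perm_map n p" and ?M = "mult_map n v"
  have S: "involution (formal_maps n) ?S" by (rule perm_map_involution[OF p])
  have Sc: "?S \<in> carrier (formal_maps n)" and SS: "mcomp n ?S ?S = vec n mvar"
    using S by (auto simp: formal_maps.involution_iff)
  have Mc: "?M \<in> carrier (formal_maps n)" using mult_map_carrier[OF n] v0 by blast
  have e: "?S \<in> endos n" "?M \<in> endos n" using Sc Mc by (auto simp: carrier_formal_maps)
  have "mcomp n (mcomp n ?S ?M) (mcomp n ?S ?M) = mcomp n (mcomp n ?S (mcomp n ?M ?S)) ?M"
    using e by (simp add: mcomp_assoc mcomp_endos)
  also have "\<dots> = mcomp n (mult_map n (\<lambda>i. v (p i))) ?M"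
    using n by (simp add: perm_map_mcomp_mult_map_mcomp p)
  also have "\<dots> = mult_map n (\<lambda>_. 1)"
    using n by (subst mult_map_mcomp) (auto intro!: mult_map_cong simp: v1 vp mult.commute[of _ "v (p _)"])
  also have "\<dots> = vec n mvar" using n by (simp add: mult_map_1)
  finally have "involution (formal_maps n) (mcomp n ?S ?M)"
    using formal_maps.m_closed[OF Sc Mc] by (intro formal_maps_involutionI) auto
  moreover have "mcomp n ?S (mcomp n ?S ?M) = ?M"
    using e SS by (simp add: id_mcomp flip: mcomp_assoc)
  ultimately show ?thesis
    using S unfolding strongly_reversible_def by (metis formal_maps_simps(1))
qed

lemma fps_inverse_mult_self: "fps_nth (f :: complex fps) 0 \<noteq> 0 \<Longrightarrow> f * inverse f = 1"
  using inverse_mult_eq_1[of f] by (simp add: mult.commute)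

text \<open>
  Pairing the indices of \<open>A\<close> and cancelling one partner against the other halves the number of
  nontrivial factors; when a single one is left, it is \<open>1\<close> as the product of all factors is \<open>1\<close>.
\<close>

lemma sr_product_mult_map_supported:
  assumes n: "n \<ge> 2"
  shows "A \<subseteq> {..<n} \<Longrightarrow> card A \<le> 2 ^ c \<Longrightarrow> (\<And>i. i \<notin> A \<Longrightarrow> w i = 1) \<Longrightarrow>
    (\<And>i. fps_nth (w i) 0 \<noteq> 0) \<Longrightarrow> (\<Prod>i<n. w i) = 1 \<Longrightarrow> sr_product (formal_maps n) c (mult_map n w)"
proof (induction c arbitrary: A w)
  case 0
  have fin: "finite A" using 0(1) finite_subset by blast
  have "w i = 1" for i
  proof (cases "i \<in> A")
    case True
    then have "A = {i}" using 0(2) card_le_Suc0_iff_eq[OF fin] by auto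
    then have "(\<Prod>j<n. w j) = w i"
      using 0(1,3) by (subst prod.remove[of _ i]) (auto intro!: prod.neutral)
    then show ?thesis using 0 by simp
  qed (use 0 in auto)
  then have "w = (\<lambda>_. 1)" by auto
  then show ?case using n formal_maps.sr_product_0[of n] by (simp add: mult_map_1)
next
  case (Suc c)
  have fin: "finite A" using Suc.prems(1) finite_subset by blast
  have half_le: "(card A + 1) div 2 \<le> card A" by linarith
  \<comment> \<open>Rounding up makes \<open>B\<close> at least as large as its complement in
    \<open>A\<close>, and from \<open>card A \<le> 2 ^ Suc c\<close> it still gives
    \<open>card B \<le> 2 ^ c\<close>.\<close>
  obtain B where B: "B \<subseteq> A" "card B = (card A + 1) div 2"
    using obtain_subset_with_card_n[of "(card A + 1) div 2" A] by (metis half_le)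
  define C where "C = A - B"
  have finB: "finite B" and finC: "finite C" using B fin C_def finite_subset by auto
  have cC: "card C = card A - card B" using B finB by (simp add: C_def card_Diff_subset)
  then have "card C \<le> card B" using B(2) by linarith
  then obtain f where f: "f ` C \<subseteq> B" "inj_on f C" using card_le_inj[OF finC finB] by blast
  have cB: "card B \<le> 2 ^ c" using B(2) Suc.prems(2) by simp
  define g where "g = inv_into C f"
  have gf: "i \<in> C \<Longrightarrow> g (f i) = i" for i using f by (simp add: g_def)
  have fg: "i \<in> f ` C \<Longrightarrow> f (g i) = i \<and> g i \<in> C" for i using f_inv_into_f[of i f C] inv_into_into[of i f C] by (simp add: g_def)
  have disj: "i \<in> C \<Longrightarrow> i \<notin> f ` C" "i \<in> C \<Longrightarrow> f i \<notin> C" for i using f by (auto simp: C_def)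
  \<comment> \<open>\<open>p\<close> exchanges each index of \<open>C\<close> with its partner in
    \<open>B\<close>. The map with multipliers \<open>v\<close> carries \<open>w i\<close> on
    \<open>C\<close> and its inverse at the partner, so what remains, \<open>u\<close>, is trivial
    outside \<open>B\<close>.\<close>
  define p where "p i = (if i \<in> C then f i else if i \<in> f ` C then g i else i)" for i
  define v where "v i = (if i \<in> C then w i else if i \<in> f ` C then inverse (w (g i)) else 1)" for i
  define u where "u i = w i * inverse (v i)" for i
  have pp: "p (p i) = i" for i using gf fg disj by (auto simp: p_def)
  have CA: "C \<subseteq> {..<n}" "f ` C \<subseteq> {..<n}" using B f Suc.prems(1) by (auto simp: C_def)
  have p_perm: "p permutes {..<n}"
  proof (rule bij_imp_permutes)
    have "p ` {..<n} \<subseteq> {..<n}" using CA fg by (auto simp: p_def)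
    then show "bij_betw p {..<n} {..<n}"
      using pp by (intro bij_betw_byWitness[where f' = p]) auto
    show "\<And>x. x \<notin> {..<n} \<Longrightarrow> p x = x" using CA by (auto simp: p_def)
  qed
  have v0: "fps_nth (v i) 0 \<noteq> 0" for i using Suc.prems(4) by (auto simp: v_def)
  have vp: "v (p i) * v i = 1" for i
    using gf fg disj Suc.prems(4) inverse_mult_eq_1 fps_inverse_mult_self by (auto simp: v_def p_def)
  have v1: "(\<Prod>i<n. v i) = 1"
  proof -
    have "(\<Prod>i<n. v i) = (\<Prod>i\<in>C \<union> f ` C. v i)"
      using CA finC by (intro prod.mono_neutral_right) (auto simp: v_def)
    also have "\<dots> = (\<Prod>i\<in>C. v i) * (\<Prod>i\<in>f ` C. v i)"
      using finC disj by (intro prod.union_disjoint) auto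
    also have "(\<Prod>i\<in>f ` C. v i) = (\<Prod>i\<in>C. v (f i))" using f by (simp add: prod.reindex)
    also have "(\<Prod>i\<in>C. v i) * (\<Prod>i\<in>C. v (f i)) = (\<Prod>i\<in>C. v i * v (p i))"
      by (simp add: prod.distrib p_def)
    also have "\<dots> = 1" using vp by (intro prod.neutral) (simp add: mult.commute)
    finally show ?thesis .
  qed
  have vu: "v i * u i = w i" for i
    using fps_inverse_mult_self[OF v0] by (simp add: u_def mult.left_commute[of "v i"])
  have u1: "(\<Prod>i<n. u i) = 1"
    using Suc.prems(5) v1 by (simp add: prod.distrib flip: vu)
  have "sr_product (formal_maps n) c (mult_map n u)"
  proof (rule Suc.IH[of B])
    show "u i = 1" if "i \<notin> B" for i
      using that f Suc.prems(3,4) fps_inverse_mult_self by (cases "i \<in> A") (auto simp: u_def v_def C_def)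
    show "fps_nth (u i) 0 \<noteq> 0" for i using Suc.prems(4)[of i] unfolding vu[symmetric] by simp
  qed (use B cB Suc.prems(1) u1 in auto)
  moreover have "strongly_reversible (formal_maps n) (mult_map n v)"
    using mult_map_strongly_reversible[OF n p_perm pp v0 v1 vp] .
  \<comment> \<open>The multipliers \<open>u\<close> have product 1, so the composition is
    pointwise.\<close>
  moreover have "mcomp n (mult_map n v) (mult_map n u) = mult_map n w"
    using n by (subst mult_map_mcomp) (auto intro!: mult_map_cong simp: u1 vu mult.commute[of "u _"])
  ultimately show ?case
    using formal_maps.sr_product_mult[OF formal_maps.sr_product_1, of n _ c] by fastforce
qed

lemma sr_product_mult_map:
  assumes "n \<ge> 2" "n \<le> 2 ^ c" "\<And>i. i < n \<Longrightarrow> fps_nth (w i) 0 \<noteq> 0" "(\<Prod>i<n. w i) = 1"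
  shows "sr_product (formal_maps n) c (mult_map n w)"
proof -
  have "sr_product (formal_maps n) c (mult_map n (\<lambda>i. if i < n then w i else 1))"
    by (rule sr_product_mult_map_supported[OF assms(1), of "{..<n}"]) (use assms in auto)
  also have "mult_map n (\<lambda>i. if i < n then w i else 1) = mult_map n w"
    by (rule mult_map_cong) simp
  finally show ?thesis .
qed


section \<open>Maps acting on the first variable only\<close>

definition first_map :: "nat \<Rightarrow> complex fps \<Rightarrow> complex mfps vec" where
  "first_map n g = mult_map n (\<lambda>i. if i = 0 then g else 1)"

lemma prod_first: "n \<ge> 1 \<Longrightarrow> (\<Prod>i<n. if i = (0 :: nat) then g else 1) = (g :: complex fps)"
  by (simp add: prod.delta)

text \<open>This is the composition law of the one-variable germs \<open>z g(z)\<close> and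
  \<open>z h(z)\<close>: maps on the first variable compose like the germs they induce on
  \<open>p\<close>.\<close>

lemma first_map_mcomp:
  "n \<ge> 1 \<Longrightarrow> mcomp n (first_map n g) (first_map n h) = first_map n (h * (g oo (fps_X * h)))"
  unfolding first_map_def
  by (subst mult_map_mcomp) (auto intro!: mult_map_cong simp: prod_first)

lemma first_map_1: "n \<ge> 1 \<Longrightarrow> first_map n 1 = vec n mvar"
  by (simp add: first_map_def mult_map_1)

lemma first_map_carrier: "n \<ge> 2 \<Longrightarrow> fps_nth g 0 \<noteq> 0 \<Longrightarrow> first_map n g \<in> carrier (formal_maps n)"
  unfolding first_map_def by (rule mult_map_carrier) auto

lemma first_map_parabolic_strongly_reversible:
  assumes n: "n \<ge> 2"
  shows "strongly_reversible (formal_maps n) (first_map n (inverse (1 - fps_X)))"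
proof -
  \<comment> \<open>As germs these are \<open>- z / (1 + z)\<close> and \<open>- z\<close>, two
    involutions with composite \<open>z / (1 - z)\<close>.\<close>
  let ?a = "- inverse (1 + fps_X) :: complex fps" and ?m = "- 1 :: complex fps"
  have n1: "n \<ge> 1" using n by simp
  have m: "involution (formal_maps n) (first_map n ?m)"
    by (rule formal_maps_involutionI)
      (use n n1 in \<open>auto simp: first_map_mcomp first_map_carrier first_map_1 fps_compose_uminus\<close>)
  have "?a oo (fps_X * ?a) = - inverse (1 + fps_X * ?a)"
    by (simp add: fps_compose_uminus fps_inverse_compose fps_compose_add_distrib)
  moreover have "?a * (- inverse (1 + fps_X * ?a)) = inverse ((1 + fps_X) * (1 + fps_X * ?a))"
    by (simp add: fps_inverse_mult)
  moreover have "(1 + fps_X) * (1 + fps_X * ?a) = 1"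
  proof -
    have "(1 + fps_X) * (1 + fps_X * ?a) = 1 + fps_X - fps_X * ((1 + fps_X) * inverse (1 + fps_X))"
      by (simp add: algebra_simps)
    then show ?thesis using fps_inverse_mult_self[of "1 + fps_X"] by simp
  qed
  ultimately have "?a * (?a oo (fps_X * ?a)) = 1" by simp
  then have a: "involution (formal_maps n) (first_map n ?a)"
    by (intro formal_maps_involutionI) (use n n1 in \<open>auto simp: first_map_mcomp first_map_carrier first_map_1\<close>)
  have "?a oo (fps_X * ?m) = - inverse (1 - fps_X)"
    by (simp add: fps_compose_uminus fps_inverse_compose fps_compose_add_distrib)
  then have "first_map n (inverse (1 - fps_X)) = mcomp n (first_map n ?a) (first_map n ?m)"
    using n1 by (simp add: first_map_mcomp)
  then show ?thesis using a m by (auto simp: strongly_reversible_def)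
qed

lemma fps_power_nth_0_1:
  assumes "fps_nth f 0 = (1 :: complex)"
  shows "fps_nth (f ^ k) 0 = 1 \<and> fps_nth (f ^ k) 1 = of_nat k * fps_nth f 1"
  by (induction k) (auto simp: fps_mult_nth assms algebra_simps)

text \<open>With \<open>\<phi> = z \<psi>(z)\<close> and \<open>f = 1 / \<psi>\<close> this is
  \<open>z\<close> times the Abel equation \<open>1 / \<phi> + g(\<phi>) = 1 / z + g - 1\<close>,
  whose unknown \<open>1 / z + g\<close> is lowered by 1 under \<open>\<phi>\<close>. The
  coefficients 0 and 1 of \<open>f\<close> fit the right-hand side. In degree 2 the unknown
  \<open>g_1\<close> cancels, which leaves the condition that coefficient 2 of \<open>f\<close> is
  0; otherwise a logarithm would be required.\<close>

lemma abel_equation: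
  fixes \<psi> f :: "complex fps"
  assumes \<psi>: "fps_nth \<psi> 0 = 1" "fps_nth \<psi> 1 = 1"
    and f: "fps_nth f 0 = 1" "fps_nth f 1 = - 1" "fps_nth f 2 = 0"
  shows "\<exists>g. f + fps_X * (g oo (fps_X * \<psi>)) = 1 + fps_X * g - fps_X"
proof -
  let ?\<phi> = "fps_X * \<psi>"
  \<comment> \<open>For \<open>j \<ge> 1\<close> this is the coefficient of degree
    \<open>j + 2\<close>, where \<open>g_(j+1)\<close> cancels and \<open>g_j\<close> is the unknown
    to be solved for, with slope \<open>j\<close>. The free constant term is fixed by the equation
    \<open>g 0 = 0\<close>.\<close>
  define \<Phi> where "\<Phi> g j = (if j = 0 then g 0
      else (\<Sum>i=0..j. g i * fps_nth (?\<phi> ^ i) (Suc j)) + fps_nth f (Suc (Suc j)))" for g :: "nat \<Rightarrow> complex" and j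
  have lead: "fps_nth (?\<phi> ^ i) (i + k) = fps_nth (\<psi> ^ i) k" for i k
    by (simp add: power_mult_distrib fps_X_power_mult_nth)
  have "\<exists>g. \<forall>j. \<Phi> g j = 0"
  proof (rule triangular_solution[where \<delta> = id and c = "\<lambda>j. if j = 0 then 1 else of_nat j"])
    fix X Y :: "nat \<Rightarrow> complex" and j
    assume "\<And>j'. id j' < id j \<Longrightarrow> X j' = Y j'"
    then have "(\<Sum>i=0..<j. X i * fps_nth (?\<phi> ^ i) (Suc j)) = (\<Sum>i=0..<j. Y i * fps_nth (?\<phi> ^ i) (Suc j))"
      by (intro sum.cong) auto
    moreover have "fps_nth (?\<phi> ^ j) (Suc j) = of_nat j"
      using lead[of j 1] fps_power_nth_0_1[OF \<psi>(1), of j] \<psi>(2) by simp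
    ultimately show "\<Phi> X j - \<Phi> Y j = (if j = 0 then 1 else of_nat j) * (X j - Y j)"
      by (simp add: \<Phi>_def atLeastLessThanSuc_atLeastAtMost[symmetric] algebra_simps)
  qed auto
  then obtain x where x: "\<And>j. \<Phi> x j = 0" by blast
  define g where "g = Abs_fps x"
  have g0: "x 0 = 0" using x[of 0] by (simp add: \<Phi>_def)
  have "fps_nth f (Suc m) + fps_nth (g oo ?\<phi>) m = x m - (if m = 0 then 1 else 0)" for m
  proof -
    consider "m = 0" | "m = 1" | j where "m = Suc j" "j \<ge> 1" by (cases m) (auto simp: Suc_le_eq)
    then show ?thesis
    proof cases
      case 1
      then show ?thesis using f by (simp add: g_def g0)
    next
      case 2
      then show ?thesis
        using f lead[of 1 0] \<psi> by (simp add: g_def g0 fps_compose_nth numeral_2_eq_2)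
    next
      case 3
      have "fps_nth (?\<phi> ^ Suc j) (Suc j) = 1"
        using lead[of "Suc j" 0] fps_power_nth_0_1[OF \<psi>(1), of "Suc j"] by simp
      then show ?thesis
        using x[of j] 3 by (simp add: \<Phi>_def g_def fps_compose_nth algebra_simps)
    qed
  qed
  then have "fps_nth (f + fps_X * (g oo ?\<phi>)) k = fps_nth (1 + fps_X * g - fps_X) k" for k
    using f by (cases k) (auto simp: g_def fps_X_nth)
  then show ?thesis by (intro exI[of _ g] fps_ext)
qed

text \<open>The second coefficient of \<open>1 / \<psi>\<close> is
  \<open>\<psi>_1^2 - \<psi>_2\<close>, so the values 1, 1, 1 are what removes the obstruction in
  Abel's equation. Its solution conjugates the map to the parabolic model.\<close>

lemma first_map_strongly_reversible:
  assumes n: "n \<ge> 2" and \<psi>: "fps_nth \<psi> 0 = 1" "fps_nth \<psi> 1 = 1" "fps_nth \<psi> 2 = 1"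
  shows "strongly_reversible (formal_maps n) (first_map n \<psi>)"
proof -
  define f where "f = inverse \<psi>"
  have n1: "n \<ge> 1" using n by simp
  have f\<psi>: "f * \<psi> = 1" using \<psi> by (simp add: f_def inverse_mult_eq_1)
  have f0: "fps_nth f 0 = 1" using \<psi> by (simp add: f_def)
  have f1: "fps_nth f 1 = - 1"
    using arg_cong[OF f\<psi>, of "\<lambda>h. fps_nth h 1"] f0 \<psi> by (simp add: fps_mult_nth add_eq_0_iff)
  have f2: "fps_nth f 2 = 0"
    using arg_cong[OF f\<psi>, of "\<lambda>h. fps_nth h 2"] f0 f1 \<psi> by (simp add: fps_mult_nth numeral_2_eq_2)
  obtain g where g: "f + fps_X * (g oo (fps_X * \<psi>)) = 1 + fps_X * g - fps_X"
    using abel_equation[OF \<psi>(1,2) f0 f1 f2] by blast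
  \<comment> \<open>The conjugating germ \<open>z u(z) = z / A(z)\<close> has reciprocal
    \<open>1 / z + g\<close>, the Abel coordinate, in which the model \<open>z / (1 - z)\<close> is
    subtraction of 1.\<close>
  define A where "A = 1 + fps_X * g"
  define u where "u = inverse A"
  have A0: "fps_nth A 0 = 1" by (simp add: A_def)
  have "A oo (fps_X * \<psi>) = 1 + fps_X * \<psi> * (g oo (fps_X * \<psi>))"
    by (simp add: A_def fps_compose_add_distrib fps_compose_mult_distrib)
  also have "\<dots> = \<psi> * (f + fps_X * (g oo (fps_X * \<psi>)))"
    using f\<psi> by (simp add: algebra_simps)
  finally have A\<psi>: "A oo (fps_X * \<psi>) = \<psi> * (A - fps_X)" by (simp add: g A_def)
  have "\<psi> * (u oo (fps_X * \<psi>)) = \<psi> * inverse (\<psi> * (A - fps_X))"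
    using A0 by (simp add: u_def fps_inverse_compose A\<psi>)
  also have "\<dots> = (f * \<psi>) * inverse (A - fps_X)"
    by (simp add: fps_inverse_mult f_def mult_ac)
  finally have 1: "\<psi> * (u oo (fps_X * \<psi>)) = inverse (A - fps_X)" using f\<psi> by simp
  have "inverse (1 - fps_X) oo (fps_X * u) = inverse (1 - fps_X * u)"
    by (simp add: fps_inverse_compose fps_compose_sub_distrib)
  then have "u * (inverse (1 - fps_X) oo (fps_X * u)) = inverse (A * (1 - fps_X * u))"
    by (simp add: fps_inverse_mult u_def)
  also have "A * (1 - fps_X * u) = A - fps_X"
    using fps_inverse_mult_self[of A] A0 by (simp add: u_def algebra_simps)
  finally have 2: "u * (inverse (1 - fps_X) oo (fps_X * u)) = inverse (A - fps_X)" .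
  let ?U = "first_map n u" and ?P = "first_map n \<psi>" and ?Q = "first_map n (inverse (1 - fps_X))"
  have eq: "?U \<otimes>\<^bsub>formal_maps n\<^esub> ?P = ?Q \<otimes>\<^bsub>formal_maps n\<^esub> ?U"
    using n1 by (simp add: first_map_mcomp 1 2)
  have c: "?U \<in> carrier (formal_maps n)" "?P \<in> carrier (formal_maps n)" "?Q \<in> carrier (formal_maps n)"
    using n A0 \<psi> by (auto intro!: first_map_carrier simp: u_def)
  have "?P = inv\<^bsub>formal_maps n\<^esub> ?U \<otimes>\<^bsub>formal_maps n\<^esub> ?Q \<otimes>\<^bsub>formal_maps n\<^esub> inv\<^bsub>formal_maps n\<^esub> (inv\<^bsub>formal_maps n\<^esub> ?U)"
    using c eq formal_maps.inv_solve_left[of ?P n ?U "?Q \<otimes>\<^bsub>formal_maps n\<^esub> ?U"] formal_maps.m_assoc[of "inv\<^bsub>formal_maps n\<^esub> ?U" n ?Q ?U]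
    by (simp del: formal_maps_simps)
  then show ?thesis
    using formal_maps.strongly_reversible_conj[OF first_map_parabolic_strongly_reversible[OF n], of "inv\<^bsub>formal_maps n\<^esub> ?U"] c
    by simp
qed

text \<open>Dividing the first multiplier by \<psi> leaves a map with product 1, which takes
  \<open>c\<close> factors and fixes \<open>p\<close>; the map on the first variable then restores
  \<psi>.\<close>

lemma sr_product_mult_map_parabolic:
  assumes n: "n \<ge> 2" "n \<le> 2 ^ c" and w: "\<And>i. i < n \<Longrightarrow> fps_nth (w i) 0 \<noteq> 0"
    and \<psi>: "fps_nth (\<Prod>i<n. w i) 0 = 1" "fps_nth (\<Prod>i<n. w i) 1 = 1" "fps_nth (\<Prod>i<n. w i) 2 = 1"
  shows "sr_product (formal_maps n) (1 + c) (mult_map n w)"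
proof -
  let ?\<psi> = "\<Prod>i<n. w i"
  define u where "u i = (if i = 0 then w i * inverse ?\<psi> else w i)" for i
  have \<psi>i: "?\<psi> * inverse ?\<psi> = 1" by (rule fps_inverse_mult_self) (simp only: \<psi>, simp)
  have "(\<Prod>i<n. u i) = (\<Prod>i<n. w i * (if i = 0 then inverse ?\<psi> else 1))"
    by (intro prod.cong) (auto simp: u_def)
  then have u1: "(\<Prod>i<n. u i) = 1"
    using n \<psi>i by (simp add: prod.distrib)
  have "mcomp n (first_map n ?\<psi>) (mult_map n u) = mult_map n w"
  proof -
    have "mcomp n (first_map n ?\<psi>) (mult_map n u) = mult_map n (\<lambda>i. u i * (if i = 0 then ?\<psi> else 1))"
      unfolding first_map_def using n by (subst mult_map_mcomp) (auto intro!: mult_map_cong simp: u1)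
    also have "\<dots> = mult_map n w"
      using \<psi>i by (intro mult_map_cong) (auto simp: u_def mult.assoc mult.commute[of "inverse _"])
    finally show ?thesis .
  qed
  moreover have "sr_product (formal_maps n) c (mult_map n u)"
  proof (rule sr_product_mult_map[OF n _ u1])
    show "fps_nth (u i) 0 \<noteq> 0" if "i < n" for i
      using w[OF that] \<psi>(1) by (auto simp: u_def)
  qed
  ultimately show ?thesis
    using formal_maps.sr_product_mult[OF formal_maps.sr_product_1[OF first_map_strongly_reversible[OF n(1) \<psi>]], of c "mult_map n u"]
    by simp
qed

section \<open>Adjusting the resonant coefficients\<close>

definition mixing :: "nat \<Rightarrow> complex mfps vec" where
  "mixing n = vec n (\<lambda>i. if i = 0 then mvar 0 + mvar 1 else if i = 1 then - mvar 1 else mvar i)"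

definition commutator_with_mixing :: "nat \<Rightarrow> complex mfps vec \<Rightarrow> complex mfps vec" where
  "commutator_with_mixing n H =
     mcomp n H (mcomp n (mixing n) (mcomp n (inv\<^bsub>formal_maps n\<^esub> H) (mixing n)))"

lemma subst_uminus:
  assumes "f \<in> mfps_carrier n" "G \<in> endos n"
  shows "mfps_subst (- f) G = - mfps_subst f G"
  using subst_diff[OF zero_mfps_carrier assms] by simp

lemma mixing_endos: "n \<ge> 2 \<Longrightarrow> mixing n \<in> endos n"
  unfolding mixing_def by (rule vec_in_endos) (auto simp: mcoeff_mvar)

lemma mixing_mcomp:
  assumes "n \<ge> 2" "G \<in> endos n" "i < n"
  shows "mcomp n (mixing n) G $ i = (if i = 0 then G $ 0 + G $ 1 else if i = 1 then - (G $ 1) else G $ i)"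
  using assms endosD(1)[OF assms(2)]
  by (auto simp: mixing_def subst_add[of _ n] subst_uminus[of _ n])

lemma mixing_involution: "n \<ge> 2 \<Longrightarrow> involution (formal_maps n) (mixing n)"
proof (rule endo_involutionI)
  assume n: "n \<ge> 2"
  show "mixing n \<in> endos n" by (rule mixing_endos[OF n])
  show "mcomp n (mixing n) (mixing n) = vec n mvar"
    by (rule eq_vecI) (use n in \<open>auto simp: mixing_mcomp mixing_endos simp del: mcomp_index, auto simp: mixing_def\<close>)
qed

lemma tangent_carrier: "diag_linear n (\<lambda>_. 1) F \<Longrightarrow> F \<in> carrier (formal_maps n)"
  by (rule diag_linear_carrier) auto

lemma tangent_inv:
  assumes H: "diag_linear n (\<lambda>_. 1) H"
  shows "diag_linear n (\<lambda>_. 1) (inv\<^bsub>formal_maps n\<^esub> H)"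
proof -
  let ?I = "inv\<^bsub>formal_maps n\<^esub> H"
  have Hc: "H \<in> carrier (formal_maps n)" by (rule tangent_carrier[OF H])
  have I: "?I \<in> endos n" using formal_maps.inv_closed[OF Hc] by (simp add: carrier_formal_maps)
  have "mcomp n H ?I = vec n mvar" using formal_maps.r_inv[OF Hc] by simp
  then have "linear_part n H * linear_part n ?I = 1\<^sub>m n"
    using H I linear_part_mcomp[of H n ?I] by (simp add: diag_linear_def linear_part_id)
  then show ?thesis
    using H I left_mult_one_mat[OF linear_part_carrier[of n ?I]] by (simp add: tangent_iff_linear_part)
qed

lemma tangent_mixing_conj:
  assumes n: "n \<ge> 2" and G: "diag_linear n (\<lambda>_. 1) G"
  shows "diag_linear n (\<lambda>_. 1) (mcomp n (mixing n) (mcomp n G (mixing n)))"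
proof -
  have e: "mixing n \<in> endos n" "G \<in> endos n" using n G by (auto simp: mixing_endos diag_linear_def)
  have "linear_part n (mixing n) * linear_part n (mixing n) = 1\<^sub>m n"
    using mixing_involution[OF n] e linear_part_mcomp[of "mixing n" n "mixing n"]
    by (simp add: formal_maps.involution_iff linear_part_id)
  then show ?thesis
    using G e left_mult_one_mat[OF linear_part_carrier[of n "mixing n"]]
    by (simp add: tangent_iff_linear_part linear_part_mcomp mcomp_endos)
qed

lemma tangent_mcomp:
  fixes l :: "nat \<Rightarrow> complex"
  shows "diag_linear n (\<lambda>_. 1) F \<Longrightarrow> diag_linear n l G \<Longrightarrow> diag_linear n l (mcomp n F G)"
  by (simp add: tangent_iff_linear_part diag_linear_iff_linear_part[of n l] mcomp_endos linear_part_mcomp)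

lemma tangent_commutator:
  "n \<ge> 2 \<Longrightarrow> diag_linear n (\<lambda>_. 1) H \<Longrightarrow> diag_linear n (\<lambda>_. 1) (commutator_with_mixing n H)"
  unfolding commutator_with_mixing_def by (intro tangent_mcomp tangent_mixing_conj tangent_inv)

text \<open>The bracketing \<open>(H \<sigma> H^-1) \<sigma>\<close> shows a product of two
  involutions, whatever \<open>H\<close> is, while the four factors together are tangent to the
  identity.\<close>

lemma commutator_strongly_reversible:
  assumes n: "n \<ge> 2" and H: "diag_linear n (\<lambda>_. 1) H"
  shows "strongly_reversible (formal_maps n) (commutator_with_mixing n H)"
proof -
  let ?G = "formal_maps n" and ?S = "mixing n"
  have Hc: "H \<in> carrier ?G" by (rule tangent_carrier[OF H])
  have S: "involution ?G ?S" by (rule mixing_involution[OF n])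
  then have Sc: "?S \<in> carrier ?G" by (simp add: involution_def)
  have "commutator_with_mixing n H = (H \<otimes>\<^bsub>?G\<^esub> ?S \<otimes>\<^bsub>?G\<^esub> inv\<^bsub>?G\<^esub> H) \<otimes>\<^bsub>?G\<^esub> ?S"
    using Hc Sc formal_maps.inv_closed[OF Hc]
    by (simp add: commutator_with_mixing_def formal_maps.m_assoc del: formal_maps_simps)
      (simp add: carrier_formal_maps)
  then show ?thesis
    using formal_maps.involution_conj[OF S Hc] S unfolding strongly_reversible_def by blast
qed

text \<open>Inversion changes the sign of the leading difference. With \<open>I\<close> and
  \<open>I'\<close> the inverses of \<open>H\<close> and \<open>H'\<close>, one has
  \<open>I = I o (H' o I')\<close> and \<open>I' = I o (H o I')\<close>, so the difference formula
  applies to the outer \<open>I\<close>.\<close>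

lemma inv_diff_leading:
  assumes H: "diag_linear n (\<lambda>_. 1) H" "diag_linear n (\<lambda>_. 1) H'"
    and ord: "\<And>i. i < n \<Longrightarrow> order_ge d (H $ i - H' $ i)" and d: "d \<ge> 1" and i: "i < n"
    and a: "mdegree a \<le> d"
  shows "mcoeff ((inv\<^bsub>formal_maps n\<^esub> H) $ i - (inv\<^bsub>formal_maps n\<^esub> H') $ i) a = - mcoeff (H $ i - H' $ i) a"
proof -
  let ?I = "inv\<^bsub>formal_maps n\<^esub> H" and ?I' = "inv\<^bsub>formal_maps n\<^esub> H'"
  have Hc: "H \<in> carrier (formal_maps n)" "H' \<in> carrier (formal_maps n)" using H tangent_carrier by auto
  have I: "diag_linear n (\<lambda>_. 1) ?I" "diag_linear n (\<lambda>_. 1) ?I'" using H tangent_inv by auto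
  have e: "H \<in> endos n" "H' \<in> endos n" "?I \<in> endos n" "?I' \<in> endos n"
    using H I by (auto simp: diag_linear_def)
  have inv: "mcomp n ?I H = vec n mvar" "mcomp n H' ?I' = vec n mvar"
    using formal_maps.l_inv[OF Hc(1)] formal_maps.r_inv[OF Hc(2)] by auto
  have oc: "order_ge d ((H $ j - H' $ j))" "H $ j - H' $ j \<in> mfps_carrier n" if "j < n" for j
    using ord that e by (auto simp: endosD)
  have sub: "mcomp n H' ?I' $ j - mcomp n H ?I' $ j = - mfps_subst (H $ j - H' $ j) ?I'" if "j < n" for j
    using that e by (simp add: subst_diff[of _ n] endosD)
  have co: "mcoeff (mcomp n H' ?I' $ j - mcomp n H ?I' $ j) a = - mcoeff (H $ j - H' $ j) a" if j: "j < n" for j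
  proof (cases "mdegree a = d")
    case True
    then show ?thesis
      using mcoeff_subst_leading[OF oc(2)[OF j] I(2) oc(1)[OF j] True] unfolding sub[OF j] by simp
  next
    case False
    then show ?thesis
      using order_ge_subst[OF oc(2)[OF j] e(4) oc(1)[OF j]] oc(1)[OF j] a unfolding sub[OF j]
      by (simp add: order_ge_def)
  qed
  have "mcoeff (mfps_subst (?I $ i) (mcomp n H' ?I')) a - mcoeff (mfps_subst (?I $ i) (mcomp n H ?I')) a
      = (\<Sum>j<n. mcoeff (?I $ i) (Poly_Mapping.single j 1) * mcoeff (mcomp n H' ?I' $ j - mcomp n H ?I' $ j) a)"
  proof (rule mcoeff_subst_diff_arg[OF _ _ _ _ d a])
    show "order_ge d (mcomp n H' ?I' $ j - mcomp n H ?I' $ j)" if "j < n" for j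
      using order_ge_subst[OF oc(2)[OF that] e(4) oc(1)[OF that]] unfolding sub[OF that]
      by (simp add: order_ge_def)
  qed (use e i in \<open>auto simp: endosD mcomp_endos\<close>)
  also have "\<dots> = (\<Sum>j<n. if i = j then - mcoeff (H $ j - H' $ j) a else 0)"
  proof (rule sum.cong)
    show "mcoeff (?I $ i) (Poly_Mapping.single j 1) * mcoeff (mcomp n H' ?I' $ j - mcomp n H ?I' $ j) a
        = (if i = j then - mcoeff (H $ j - H' $ j) a else 0)" if "j \<in> {..<n}" for j
      using co[of j] that I(1) i by (auto simp: diag_linear_def simp del: mcomp_index mcoeff_diff)
  qed simp
  also have "\<dots> = - mcoeff (H $ i - H' $ i) a" using i by simp
  also have "mfps_subst (?I $ i) (mcomp n H' ?I') = ?I $ i"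
    using e i by (simp add: inv subst_id endosD)
  also have "mfps_subst (?I $ i) (mcomp n H ?I') = ?I' $ i"
  proof -
    have "mcomp n ?I (mcomp n H ?I') = ?I'"
      using e by (simp add: inv id_mcomp flip: mcomp_assoc)
    then show ?thesis using i by (metis mcomp_index)
  qed
  finally show ?thesis by simp
qed

text \<open>To first order a perturbation \<open>E\<close> of the first component of
  \<open>H\<close> enters twice: as \<open>E\<close> through \<open>H\<close>, and as
  \<open>- E o \<sigma>\<close> through the inverse.\<close>

lemma commutator_diff_leading:
  assumes n: "n \<ge> 2" and H: "diag_linear n (\<lambda>_. 1) H" "diag_linear n (\<lambda>_. 1) H'"
    and E: "E \<in> mfps_carrier n" "order_ge d E" and d: "d \<ge> 1"
    and diff: "\<And>i. i < n \<Longrightarrow> H $ i - H' $ i = (if i = 0 then E else 0)"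
    and i: "i < n" and a: "mdegree a \<le> d"
  shows "mcoeff (commutator_with_mixing n H $ i - commutator_with_mixing n H' $ i) a
       = (if i = 0 then mcoeff (E - mfps_subst E (mixing n)) a else 0)"
proof -
  let ?S = "mixing n" and ?I = "inv\<^bsub>formal_maps n\<^esub> H" and ?I' = "inv\<^bsub>formal_maps n\<^esub> H'"
  let ?P = "mcomp n ?S (mcomp n ?I ?S)" and ?P' = "mcomp n ?S (mcomp n ?I' ?S)"
  have I: "diag_linear n (\<lambda>_. 1) ?I" "diag_linear n (\<lambda>_. 1) ?I'" using H tangent_inv by auto
  have P: "diag_linear n (\<lambda>_. 1) ?P" "diag_linear n (\<lambda>_. 1) ?P'" using I tangent_mixing_conj[OF n] by auto
  have e: "H \<in> endos n" "H' \<in> endos n" "?I \<in> endos n" "?I' \<in> endos n" "?P \<in> endos n" "?P' \<in> endos n"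
    using H I P by (auto simp: diag_linear_def)
  have S: "?S \<in> endos n" by (rule mixing_endos[OF n])
  have ord: "order_ge d (H $ i - H' $ i)" if "i < n" for i
    using that E by (simp add: diff)
  let ?E = "\<lambda>i. if i = 0 then E else 0" and ?E' = "\<lambda>i. if i = 0 then mfps_subst E ?S else 0"
  have EC: "?E i \<in> mfps_carrier n" for i using E by simp
  have Q: "order_ge (Suc d) (mcomp n ?I ?S $ j - mcomp n ?I' ?S $ j + ?E' j)" if j: "j < n" for j
  proof -
    have "order_ge (Suc d) (?I $ j - ?I' $ j + ?E j)"
      using inv_diff_leading[OF H ord d j] j by (auto simp: order_ge_def less_Suc_eq_le diff)
    moreover have "mfps_subst (?I $ j - ?I' $ j + ?E j) ?S = mcomp n ?I ?S $ j - mcomp n ?I' ?S $ j + ?E' j"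
      using j e S E by (simp add: subst_add[of _ n] subst_diff[of _ n] endosD)
    ultimately show ?thesis
      using order_ge_subst[OF _ S, of "?I $ j - ?I' $ j + ?E j" "Suc d"] j e E(1) by (auto simp: endosD)
  qed
  have PP: "order_ge (Suc d) (?P $ j - ?P' $ j + ?E' j)" if j: "j < n" for j
  proof -
    have *: "order_ge (Suc d) (mcomp n ?I ?S $ 0 - mcomp n ?I' ?S $ 0 + mfps_subst E ?S)"
      "order_ge (Suc d) (mcomp n ?I ?S $ 1 - mcomp n ?I' ?S $ 1)"
      using Q[of 0] Q[of 1] n by auto
    have Qe: "mcomp n ?I ?S \<in> endos n" "mcomp n ?I' ?S \<in> endos n" using e S by (auto intro: mcomp_endos)
    show ?thesis
      using * Q[OF j] j unfolding mixing_mcomp[OF n Qe(1) j] mixing_mcomp[OF n Qe(2) j]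
      by (auto simp: order_ge_def algebra_simps simp del: mcomp_index)
  qed
  have oP: "order_ge d (?P $ j - ?P' $ j)" if j: "j < n" for j
  proof -
    have "order_ge d (?E' j)" using E S by (auto intro: order_ge_subst)
    then have "order_ge d (0 - ?E' j)" using order_ge_diff_commute[of d "?E' j" 0] by simp
    from order_ge_add[OF order_ge_mono[OF PP[OF j], of d] this] show ?thesis
      by (simp del: mcomp_index split: if_splits)
  qed
  have "mcoeff (mfps_subst (H' $ i) ?P) a - mcoeff (mfps_subst (H' $ i) ?P') a
      = (\<Sum>j<n. mcoeff (H' $ i) (Poly_Mapping.single j 1) * mcoeff (?P $ j - ?P' $ j) a)"
    by (rule mcoeff_subst_diff_arg[OF _ e(5,6) oP d a]) (use e i in \<open>auto simp: endosD\<close>)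
  also have "\<dots> = (\<Sum>j<n. if i = j then mcoeff (?P $ j - ?P' $ j) a else 0)"
    using H(2) i by (intro sum.cong) (auto simp: diag_linear_def)
  also have "\<dots> = mcoeff (?P $ i - ?P' $ i) a" using i by simp
  also have "\<dots> = - mcoeff (?E' i) a"
    using PP[OF i] a by (auto simp: order_ge_def add_eq_0_iff simp del: mcomp_index split: if_splits)
  finally have 1: "mcoeff (mfps_subst (H' $ i) ?P) a - mcoeff (mfps_subst (H' $ i) ?P') a = - mcoeff (?E' i) a" .
  have 2: "mcoeff (mfps_subst (H $ i) ?P) a - mcoeff (mfps_subst (H' $ i) ?P) a = mcoeff (?E i) a"
  proof -
    have "mcoeff (mfps_subst (H $ i - H' $ i) ?P) a = mcoeff (?E i) a"
    proof (cases "mdegree a = d")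
      case True
      then show ?thesis
        using mcoeff_subst_leading[OF _ P(1) ord[OF i] True] i E by (simp add: diff)
    next
      case False
      then show ?thesis
        using order_ge_subst[OF _ e(5) ord[OF i]] i E a by (auto simp: diff order_ge_def)
    qed
    then show ?thesis using e i by (simp add: subst_diff[of _ n] endosD)
  qed
  have "commutator_with_mixing n H $ i = mfps_subst (H $ i) ?P"
    "commutator_with_mixing n H' $ i = mfps_subst (H' $ i) ?P'"
    using i by (auto simp: commutator_with_mixing_def)
  then show ?thesis using 1 2 by (simp add: algebra_simps split: if_splits)
qed

text \<open>
  The monomial \<open>x\<^sub>0\<^sup>2\<^sup>k\<^sup>+\<^sup>1 x\<^sub>2\<^sup>k \<cdots> x\<^sub>n\<^sub>-\<^sub>1\<^sup>k\<close> is not resonant, but after the substitution of \<open>x\<^sub>0 + x\<^sub>1\<close> for \<open>x\<^sub>0\<close>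
  it contains the resonant monomial \<open>x\<^sub>0 (x\<^sub>0 \<cdots> x\<^sub>n\<^sub>-\<^sub>1)\<^sup>k\<close>.
\<close>

definition tail_monomial :: "nat \<Rightarrow> nat \<Rightarrow> monomial" where
  "tail_monomial n k = (\<Sum>i=2..<n. Poly_Mapping.single i k)"

definition shear_monomial :: "nat \<Rightarrow> nat \<Rightarrow> monomial" where
  "shear_monomial n k = Poly_Mapping.single 0 (2 * k + 1) + tail_monomial n k"

lemma lookup_tail: "Poly_Mapping.lookup (tail_monomial n k) i = (if 2 \<le> i \<and> i < n then k else 0)"
  by (simp add: tail_monomial_def lookup_sum lookup_single when_def)

lemma resonant_split:
  "n \<ge> 2 \<Longrightarrow> Poly_Mapping.single 0 1 + rep n k
    = Poly_Mapping.single 0 (k + 1) + Poly_Mapping.single 1 k + tail_monomial n k"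
  by (rule poly_mapping_eqI) (auto simp: lookup_add lookup_single lookup_rep lookup_tail when_def)

lemma keys_tail: "Poly_Mapping.keys (tail_monomial n k) \<subseteq> {..<n}"
  by (auto simp: in_keys_iff lookup_tail split: if_splits)

lemma keys_shear: "n \<ge> 2 \<Longrightarrow> Poly_Mapping.keys (shear_monomial n k) \<subseteq> {..<n}"
  using keys_tail by (auto simp: shear_monomial_def keys_add_nat)

lemma mdegree_shear:
  assumes "n \<ge> 2"
  shows "mdegree (shear_monomial n k) = n * k + 1"
  using arg_cong[OF resonant_split[OF assms, of k], of mdegree]
  by (simp add: shear_monomial_def mdegree_add mdegree_rep)

lemma of_nat_mfps: "(of_nat c :: 'a :: comm_ring_1 mfps) = mmonom (of_nat c) 0"
  by (induction c) (auto intro!: mfps_eqI simp: mcoeff_mmonom mcoeff_1)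

lemma mcoeff_of_nat_mult: "mcoeff (of_nat c * f) m = of_nat c * mcoeff f m"
  by (simp add: of_nat_mfps)

lemma mvar_power: "mvar i ^ k = mmonom 1 (Poly_Mapping.single i k)"
proof (induction k)
  case 0
  then show ?case by (simp add: one_eq_mmonom)
next
  case (Suc k)
  then show ?case by (simp add: mvar_eq_mmonom mmonom_mult single_add[symmetric])
qed

lemma mcoeff_shear_mixing:
  assumes n: "n \<ge> 2"
  shows "mcoeff (mfps_subst (mmonom c (shear_monomial n k)) (mixing n)) (Poly_Mapping.single 0 1 + rep n k)
       = c * of_nat ((2 * k + 1) choose (k + 1))"
proof -
  have dim: "dim_vec (mixing n) = n" by (simp add: mixing_def)
  let ?N = "2 * k + 1"
  have "monom_subst (tail_monomial n k) (mixing n) = monom_subst (tail_monomial n k) (vec n mvar)"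
    unfolding monom_subst_def by (intro prod.cong) (auto simp: lookup_tail mixing_def)
  then have tail: "monom_subst (tail_monomial n k) (mixing n) = mmonom 1 (tail_monomial n k)"
    by (simp add: monom_subst_mvar[OF keys_tail])
  have "monom_subst (shear_monomial n k) (mixing n) = mmonom 1 (tail_monomial n k) * (mvar 0 + mvar 1) ^ ?N"
    using n by (simp add: shear_monomial_def monom_subst_add tail monom_subst_single dim mult.commute)
      (simp add: mixing_def)
  then have "mcoeff (monom_subst (shear_monomial n k) (mixing n)) (Poly_Mapping.single 0 1 + rep n k)
      = mcoeff ((mvar 0 + mvar 1) ^ ?N :: complex mfps) (Poly_Mapping.single 0 (k + 1) + Poly_Mapping.single 1 k)"
    unfolding resonant_split[OF n] add.commute[of _ "tail_monomial n k"] by (simp only: mcoeff_mmonom_mult_add mult_1)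
  also have "\<dots> = (\<Sum>j\<le>?N. of_nat (?N choose j) *
      mcoeff (mmonom 1 (Poly_Mapping.single 0 j + Poly_Mapping.single 1 (?N - j)) :: complex mfps)
        (Poly_Mapping.single 0 (k + 1) + Poly_Mapping.single 1 k))"
    unfolding binomial_ring mcoeff_sum
    by (rule sum.cong) (simp_all only: mcoeff_of_nat_mult mvar_power mmonom_mult mult.assoc mult_1)
  also have "\<dots> = (\<Sum>j\<le>?N. if j = k + 1 then of_nat (?N choose j) else 0)"
  proof (rule sum.cong)
    fix j assume j: "j \<in> {..?N}"
    have "Poly_Mapping.single 0 (k + 1) + Poly_Mapping.single 1 k
        = (Poly_Mapping.single 0 j + Poly_Mapping.single 1 (?N - j) :: monomial) \<longleftrightarrow> j = k + 1"
    proof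
      assume eq: "Poly_Mapping.single 0 (k + 1) + Poly_Mapping.single 1 k
        = (Poly_Mapping.single 0 j + Poly_Mapping.single 1 (?N - j) :: monomial)"
      show "j = k + 1"
        using arg_cong[OF eq, of "\<lambda>m. Poly_Mapping.lookup m 0"] by (simp add: lookup_add lookup_single)
    qed simp
    then show "of_nat (?N choose j) *
        mcoeff (mmonom 1 (Poly_Mapping.single 0 j + Poly_Mapping.single 1 (?N - j)) :: complex mfps)
          (Poly_Mapping.single 0 (k + 1) + Poly_Mapping.single 1 k) = (if j = k + 1 then of_nat (?N choose j) else 0)"
      by (simp add: mcoeff_mmonom)
  qed simp
  also have "\<dots> = of_nat (?N choose (k + 1))" by simp
  finally show ?thesis by (simp add: subst_mmonom)
qed

definition resonant_series :: "nat \<Rightarrow> complex mfps vec \<Rightarrow> nat \<Rightarrow> complex fps" where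
  "resonant_series n N i = Abs_fps (\<lambda>k. mcoeff (N $ i) (Poly_Mapping.single i 1 + rep n k))"

lemma prod_fps_nth_cong:
  fixes f g :: "'i \<Rightarrow> complex fps"
  assumes "finite A" "\<And>i j. i \<in> A \<Longrightarrow> j \<le> k \<Longrightarrow> fps_nth (f i) j = fps_nth (g i) j"
  shows "j \<le> k \<Longrightarrow> fps_nth (\<Prod>i\<in>A. f i) j = fps_nth (\<Prod>i\<in>A. g i) j"
  using assms by (induction A arbitrary: j rule: finite_induct) (auto simp: fps_mult_nth intro!: sum.cong)

lemma prod_resonant_series_adjust:
  assumes n: "n \<ge> 2" and nr: "nonresonant n l" and l1: "(\<Prod>i<n. l i) = 1"
    and F: "diag_linear n l F"
    and H: "diag_linear n (\<lambda>_. 1) H" "diag_linear n (\<lambda>_. 1) H'" and k: "k \<ge> 1"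
    and diff: "\<And>i. i < n \<Longrightarrow> H $ i - H' $ i = (if i = 0 then mmonom c (shear_monomial n k) else 0)"
    and nf: "normal_form n l (mcomp n (commutator_with_mixing n H) F) B N"
      "normal_form n l (mcomp n (commutator_with_mixing n H') F) B' N'"
    and j: "j \<le> k"
  shows "fps_nth (\<Prod>i<n. resonant_series n N i) j
       = fps_nth (\<Prod>i<n. resonant_series n N' i) j
         - (if j = k then c * of_nat ((2 * k + 1) choose (k + 1)) else 0)"
proof -
  let ?K = "commutator_with_mixing n H" and ?K' = "commutator_with_mixing n H'"
  let ?d = "n * k + 1" and ?E = "mmonom c (shear_monomial n k)"
  define w w' where "w = resonant_series n N" and "w' = resonant_series n N'"
  have d: "?d \<ge> 2" "?d \<ge> 1" using n k by (auto simp: Suc_le_eq)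
  have E: "?E \<in> mfps_carrier n" "order_ge ?d ?E"
    using mmonom_carrier[OF keys_shear[OF n]] order_ge_mmonom[of "shear_monomial n k"] mdegree_shear[OF n] by auto
  have K: "diag_linear n (\<lambda>_. 1) ?K" "diag_linear n (\<lambda>_. 1) ?K'" using H tangent_commutator[OF n] by auto
  have KF: "diag_linear n l (mcomp n ?K F)" "diag_linear n l (mcomp n ?K' F)" using K F tangent_mcomp by auto
  have e: "F \<in> endos n" "?K \<in> endos n" "?K' \<in> endos n" using F K by (auto simp: diag_linear_def)
  have KK: "mcoeff (?K $ i - ?K' $ i) a = (if i = 0 then mcoeff (?E - mfps_subst ?E (mixing n)) a else 0)"
    if "i < n" "mdegree a \<le> ?d" for i a
    by (rule commutator_diff_leading[OF n H E d(2) diff that])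
  have E': "order_ge ?d (mfps_subst ?E (mixing n))" using order_ge_subst[OF E(1) mixing_endos[OF n] E(2)] .
  have oK: "order_ge ?d (?K $ i - ?K' $ i)" if i: "i < n" for i
    using KK[OF i] E(2) E' by (auto simp: order_ge_def)
  have oF: "order_ge ?d (mcomp n ?K F $ i - mcomp n ?K' F $ i)" if i: "i < n" for i
    using order_ge_subst[OF _ e(1) oK[OF i]] i e by (simp add: subst_diff[of _ n] endosD)
  have keys: "Poly_Mapping.keys (Poly_Mapping.single i 1 + rep n k) \<subseteq> {..<n}" if "i < n" for i
    using that keys_rep by (auto simp: keys_add_nat)
  have deg: "mdegree (Poly_Mapping.single i 1 + rep n k) = ?d" for i by (simp add: mdegree_add mdegree_rep)
  have res: "resonant n i (Poly_Mapping.single i 1 + rep n m)" for i m by (auto simp: resonant_def)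
  have low: "fps_nth (w i) m = fps_nth (w' i) m" if "i < n" "m < k" for i m
  proof -
    have "n * m < n * k" using that n by simp
    then show ?thesis
      using normal_form_diff(1)[OF nr KF nf d(1) oF that(1)]
      by (simp add: w_def w'_def resonant_series_def order_ge_def mdegree_add mdegree_rep)
  qed
  have top: "fps_nth (w i) k - fps_nth (w' i) k
      = (if i = 0 then - l 0 * c * of_nat ((2 * k + 1) choose (k + 1)) else 0)" if i: "i < n" for i
  proof -
    let ?a = "Poly_Mapping.single i 1 + rep n k :: monomial"
    have "fps_nth (w i) k - fps_nth (w' i) k = mcoeff (mcomp n ?K F $ i) ?a - mcoeff (mcomp n ?K' F $ i) ?a"
      using normal_form_diff(2)[OF nr KF nf d(1) oF i res deg] by (simp add: w_def w'_def resonant_series_def)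
    also have "\<dots> = mcoeff (mfps_subst (?K $ i - ?K' $ i) F) ?a"
      using i e by (simp add: subst_diff[of _ n] endosD)
    also have "\<dots> = mpow n l ?a * mcoeff (?K $ i - ?K' $ i) ?a"
      by (rule mcoeff_subst_leading[OF _ F oK[OF i] deg]) (use e i in \<open>auto simp: endosD\<close>)
    also have "mpow n l ?a = l i"
      using nr i keys[OF i] res[of i k] unfolding nonresonant_def deg[of i, symmetric]
      by (auto simp: mdegree_add)
    also have "mcoeff (?K $ i - ?K' $ i) ?a = (if i = 0 then - c * of_nat ((2 * k + 1) choose (k + 1)) else 0)"
    proof -
      have "?a \<noteq> shear_monomial n k" if "i = 0"
      proof
        assume "?a = shear_monomial n k"
        from arg_cong[OF this, of "\<lambda>m. Poly_Mapping.lookup m 0"] show False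
          using that n k by (simp add: shear_monomial_def lookup_add lookup_single lookup_rep lookup_tail)
      qed
      then show ?thesis
        using KK[OF i, of ?a] deg[of i] mcoeff_shear_mixing[OF n, of c k] by (auto simp: mcoeff_mmonom)
    qed
    finally show ?thesis by simp
  qed
  have "{..<n} = insert 0 {1..<n}" using n by auto
  then have split: "(\<Prod>i<n. v i) = v 0 * (\<Prod>i=1..<n. v i)" for v :: "nat \<Rightarrow> complex fps" by simp
  have W: "m \<le> k \<Longrightarrow> fps_nth (\<Prod>i=1..<n. w i) m = fps_nth (\<Prod>i=1..<n. w' i) m" for m
  proof (rule prod_fps_nth_cong)
    show "fps_nth (w i) j = fps_nth (w' i) j" if "i \<in> {1..<n}" "j \<le> k" for i j
      using low[of i j] top[of i] that by (cases "j = k") auto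
  qed auto
  have W0: "l 0 * fps_nth (\<Prod>i=1..<n. w' i) 0 = 1"
  proof -
    have "fps_nth (w' i) 0 = l i" if "i < n" for i
      using nf(2) that by (simp add: w'_def resonant_series_def normal_form_def diag_linear_def)
    then have "fps_nth (\<Prod>i=1..<n. w' i) 0 = (\<Prod>i=1..<n. l i)"
      by (simp add: fps_prod_nth')
    moreover have "(\<Prod>i<n. l i) = l 0 * (\<Prod>i=1..<n. l i)"
      using \<open>{..<n} = insert 0 {1..<n}\<close> by simp
    ultimately show ?thesis using l1 by simp
  qed
  have "fps_nth (\<Prod>i<n. w i) j - fps_nth (\<Prod>i<n. w' i) j
      = (\<Sum>m=0..j. (fps_nth (w 0) m - fps_nth (w' 0) m) * fps_nth (\<Prod>i=1..<n. w' i) (j - m))"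
    unfolding split fps_mult_nth sum_subtractf[symmetric] using j W
    by (intro sum.cong) (auto simp: algebra_simps)
  also have "\<dots> = (\<Sum>m=0..j. if m = k then - c * of_nat ((2 * k + 1) choose (k + 1)) else 0)"
  proof (rule sum.cong)
    fix m assume m: "m \<in> {0..j}"
    show "(fps_nth (w 0) m - fps_nth (w' 0) m) * fps_nth (\<Prod>i=1..<n. w' i) (j - m)
        = (if m = k then - c * of_nat ((2 * k + 1) choose (k + 1)) else 0)"
    proof (cases "m = k")
      case True
      then have "j - m = 0" using j m by simp
      then show ?thesis using top[of 0] n True W0 by (simp add: mult_ac)
    qed (use low[of 0 m] n m j in auto)
  qed simp
  also have "\<dots> = (if j = k then - c * of_nat ((2 * k + 1) choose (k + 1)) else 0)"
    using j by auto
  finally show ?thesis unfolding w_def w'_def by (auto simp: algebra_simps)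
qed

lemma sr_product_nonresonant:
  assumes n: "n \<ge> 2" "n \<le> 2 ^ c" and nr: "nonresonant n l" and l1: "(\<Prod>i<n. l i) = 1"
    and F: "diag_linear n l F"
  shows "sr_product (formal_maps n) (2 + c) F"
proof -
  let ?G = "formal_maps n"
  have l0: "l i \<noteq> 0" if "i < n" for i using l1 that by (metis finite_lessThan lessThan_iff prod_zero_iff zero_neq_one)
  define h where "h s t = mmonom s (shear_monomial n 1) + mmonom t (shear_monomial n 2)" for s t :: complex
  define H where "H s t = vec n (\<lambda>i. mvar i + (if i = 0 then h s t else 0))" for s t
  define K where "K s t = commutator_with_mixing n (H s t)" for s t
  have H: "diag_linear n (\<lambda>_. 1) (H s t)" for s t
  proof -
    have deg: "mdegree (shear_monomial n 1) \<ge> 2" "mdegree (shear_monomial n 2) \<ge> 2"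
      using n by (auto simp: mdegree_shear)
    have "mcoeff (h s t) a = 0" if "mdegree a < 2" for a
      using that deg by (auto simp: h_def mcoeff_mmonom)
    then have h0: "mcoeff (h s t) 0 = 0" "mcoeff (h s t) (Poly_Mapping.single j 1) = 0" for j by auto
    have "h s t \<in> mfps_carrier n" using keys_shear[OF n(1)] by (simp add: h_def mmonom_carrier)
    then show ?thesis
      unfolding diag_linear_def H_def using h0 by (auto intro!: vec_in_endos simp: mcoeff_mvar)
  qed
  have KF: "diag_linear n l (mcomp n (K s t) F)" for s t
    unfolding K_def by (intro tangent_mcomp tangent_commutator n H F)
  obtain B N where nf: "normal_form n l (mcomp n (K s t) F) (B s t) (N s t)" for s t
    using normal_form_exists[OF nr KF] by metis
  define \<psi> where "\<psi> s t = (\<Prod>i<n. resonant_series n (N s t) i)" for s t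
  define C :: "nat \<Rightarrow> complex" where "C k = of_nat ((2 * k + 1) choose (k + 1))" for k
  have C: "C k \<noteq> 0" for k unfolding C_def of_nat_eq_0_iff binomial_eq_0_iff by simp
  define s where "s = (fps_nth (\<psi> 0 0) 1 - 1) / C 1"
  define t where "t = (fps_nth (\<psi> s 0) 2 - 1) / C 2"
  have adjust: "fps_nth (\<psi> s t) j
      = fps_nth (\<psi> s' t') j - (if j = k then c * C k else 0)"
    if "j \<le> k" "k \<ge> 1" "h s t - h s' t' = mmonom c (shear_monomial n k)" for s t s' t' j k c
    unfolding \<psi>_def C_def
  proof (rule prod_resonant_series_adjust[OF n(1) nr l1 F H[of s t] H[of s' t'] that(2) _
      nf[of s t, unfolded K_def] nf[of s' t', unfolded K_def] that(1)])
    show "H s t $ i - H s' t' $ i = (if i = 0 then mmonom c (shear_monomial n k) else 0)" if "i < n" for i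
      using that \<open>h s t - h s' t' = _\<close> by (simp add: H_def)
  qed
  have "h s 0 - h 0 0 = mmonom s (shear_monomial n 1)" "h s t - h s 0 = mmonom t (shear_monomial n 2)"
    by (auto simp: h_def mcoeff_mmonom intro!: mfps_eqI)
  note adjust1 = adjust[OF _ _ this(1), of 1] and adjust2 = adjust[OF _ _ this(2)]
  have s: "fps_nth (\<psi> s 0) 1 = 1"
    using adjust1 C[of 1] by (simp add: s_def)
  have t: "fps_nth (\<psi> s t) j = fps_nth (\<psi> s 0) j - (if j = 2 then t * C 2 else 0)" if "j \<le> 2" for j
    using adjust2[OF that] by simp
  have \<psi>1: "fps_nth (\<psi> s t) 1 = 1" using t[of 1] s by simp
  have \<psi>2: "fps_nth (\<psi> s t) 2 = 1" using t[of 2] C[of 2] by (simp add: t_def)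
  have w0: "fps_nth (resonant_series n (N s t) i) 0 = l i" if "i < n" for i
    using nf[of s t] that by (simp add: resonant_series_def normal_form_def diag_linear_def)
  then have \<psi>0: "fps_nth (\<psi> s t) 0 = 1" by (simp add: \<psi>_def fps_prod_nth' l1)
  have "N s t = mult_map n (resonant_series n (N s t))"
    using normal_form_mult_map[OF n(1) nf] by (simp add: resonant_series_def[abs_def])
  then have N: "sr_product ?G (1 + c) (N s t)"
    using sr_product_mult_map_parabolic[OF n, of "resonant_series n (N s t)"] w0 l0 \<psi>0 \<psi>1 \<psi>2
    by (simp add: \<psi>_def)
  let ?B = "B s t" and ?K = "K s t" and ?KF = "mcomp n (K s t) F"
  have Bc: "?B \<in> carrier ?G" using nf[of s t] by (auto simp: normal_form_def intro: tangent_carrier)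
  have KFc: "?KF \<in> carrier ?G" using diag_linear_carrier[OF KF] l0 by blast
  have Fc: "F \<in> carrier ?G" using diag_linear_carrier[OF F] l0 by blast
  have Kc: "?K \<in> carrier ?G" unfolding K_def by (intro tangent_carrier tangent_commutator n H)
  have Nc: "N s t \<in> carrier ?G" using formal_maps.sr_product_closed[OF N] .
  have "?B \<otimes>\<^bsub>?G\<^esub> ?KF = N s t \<otimes>\<^bsub>?G\<^esub> ?B" using nf[of s t] by (simp add: normal_form_def)
  then have "?B \<otimes>\<^bsub>?G\<^esub> ?KF \<otimes>\<^bsub>?G\<^esub> inv\<^bsub>?G\<^esub> ?B = N s t"
    using Bc Nc by (simp add: formal_maps.m_assoc del: formal_maps_simps)
  then have 1: "sr_product ?G (1 + c) ?KF"
    using formal_maps.sr_product_conj_iff[OF KFc Bc] N by simp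
  have "sr_product ?G 1 (inv\<^bsub>?G\<^esub> ?K)"
    unfolding K_def
    by (intro formal_maps.sr_product_1 formal_maps.strongly_reversible_inv commutator_strongly_reversible n H)
  from formal_maps.sr_product_mult[OF this 1] have "sr_product ?G (1 + (1 + c)) (inv\<^bsub>?G\<^esub> ?K \<otimes>\<^bsub>?G\<^esub> ?KF)" .
  moreover have "inv\<^bsub>?G\<^esub> ?K \<otimes>\<^bsub>?G\<^esub> (?K \<otimes>\<^bsub>?G\<^esub> F) = F"
    using Kc Fc by (simp add: formal_maps.m_assoc[symmetric] del: formal_maps_simps)
  ultimately show ?thesis by simp
qed

section \<open>Linear parts\<close>

lemma prime_exponents_unique:
  fixes q :: "nat \<Rightarrow> nat"
  assumes q: "inj q" "\<And>i. prime (q i)" and eq: "(\<Prod>i<m. q i ^ e i) = (\<Prod>i<m. q i ^ e' i)" and j: "j < m"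
  shows "e j = e' j"
proof -
  have "multiplicity (q j) (\<Prod>i<m. q i ^ e i) = e j" for e
  proof -
    have "(\<Prod>i<m. q i ^ e i) = (\<Prod>p\<in>q ` {..<m}. p ^ e (inv_into UNIV q p))"
      using q(1) by (subst prod.reindex) (auto simp: inj_on_def inj_def inv_f_f)
    also have "multiplicity (q j) \<dots> = e j"
      using q j by (subst multiplicity_prod_prime_powers) auto
    finally show ?thesis .
  qed
  from this[of e] this[of e'] show ?thesis by (simp only: eq)
qed

text \<open>
  Distinct primes are multiplicatively independent, so when the last eigenvalue is chosen to make
  the product \<open>1\<close>, this product is essentially the only multiplicative relation.
\<close>

lemma nonresonant_exists:
  assumes n: "n \<ge> 2"
  shows "\<exists>l :: nat \<Rightarrow> complex. nonresonant n l \<and> (\<Prod>i<n. l i) = 1"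
proof -
  obtain q :: "nat \<Rightarrow> nat" where q: "inj q" "\<And>i. prime (q i)"
    using infinite_countable_subset[OF primes_infinite] by blast
  define m where "m = n - 1"
  have nm: "n = Suc m" using n by (simp add: m_def)
  define Q :: complex where "Q = (\<Prod>j<m. of_nat (q j))"
  have q0: "q j \<noteq> 0" for j using q(2)[of j] by (metis not_prime_0)
  then have Q0: "Q \<noteq> 0" by (simp add: Q_def)
  define l :: "nat \<Rightarrow> complex" where "l i = (if i < m then of_nat (q i) else 1 / Q)" for i
  have l1: "(\<Prod>i<n. l i) = 1"
  proof -
    have "(\<Prod>i<m. l i) = Q" by (simp add: l_def Q_def)
    then show ?thesis using Q0 by (simp add: nm) (simp add: l_def)
  qed
  have mp: "mpow n l a = (\<Prod>i<m. of_nat (q i) ^ Poly_Mapping.lookup a i) / Q ^ Poly_Mapping.lookup a m" for a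
  proof -
    have "(\<Prod>i<m. l i ^ Poly_Mapping.lookup a i) = (\<Prod>i<m. of_nat (q i) ^ Poly_Mapping.lookup a i)"
      by (intro prod.cong) (auto simp: l_def)
    then show ?thesis by (simp add: mpow_def nm) (simp add: l_def power_inverse divide_inverse)
  qed
  have exps: "Poly_Mapping.lookup a j + Poly_Mapping.lookup b m = Poly_Mapping.lookup b j + Poly_Mapping.lookup a m"
    if eq: "mpow n l a = mpow n l b" and j: "j < n" for a b j
  proof (cases "j < m")
    case True
    have "(\<Prod>i<m. of_nat (q i) ^ Poly_Mapping.lookup a i) * Q ^ Poly_Mapping.lookup b m
        = (\<Prod>i<m. of_nat (q i) ^ Poly_Mapping.lookup b i) * Q ^ Poly_Mapping.lookup a m"
      using eq Q0 by (simp add: mp frac_eq_eq)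
    then have "(of_nat (\<Prod>i<m. q i ^ (Poly_Mapping.lookup a i + Poly_Mapping.lookup b m)) :: complex)
        = of_nat (\<Prod>i<m. q i ^ (Poly_Mapping.lookup b i + Poly_Mapping.lookup a m))"
      by (simp add: Q_def power_add prod.distrib prod_power_distrib)
    then have "(\<Prod>i<m. q i ^ (Poly_Mapping.lookup a i + Poly_Mapping.lookup b m))
        = (\<Prod>i<m. q i ^ (Poly_Mapping.lookup b i + Poly_Mapping.lookup a m))"
      unfolding of_nat_eq_iff .
    from prime_exponents_unique[OF q this True] show ?thesis .
  next
    case False
    then have "j = m" using j nm by simp
    then show ?thesis by simp
  qed
  have "mpow n l a = l i \<longleftrightarrow> resonant n i a" if i: "i < n" and keys: "Poly_Mapping.keys a \<subseteq> {..<n}" for i a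
  proof
    assume "mpow n l a = l i"
    then have eq: "mpow n l a = mpow n l (Poly_Mapping.single i 1)" by (simp only: mpow_single[OF i])
    define j0 :: nat where "j0 = (if i = 0 then 1 else 0)"
    have j0: "j0 < n" "j0 \<noteq> i" using n by (auto simp: j0_def)
    have "a = Poly_Mapping.single i 1 + rep n (Poly_Mapping.lookup a j0)"
    proof (rule poly_mapping_eqI)
      fix j
      show "Poly_Mapping.lookup a j = Poly_Mapping.lookup (Poly_Mapping.single i 1 + rep n (Poly_Mapping.lookup a j0)) j"
      proof (cases "j < n")
        case True
        then show ?thesis
          using exps[OF eq True] exps[OF eq j0(1)] j0(2) by (simp add: lookup_add lookup_rep lookup_single)
      next
        case False
        then have "Poly_Mapping.lookup a j = 0" using keys by (auto simp: in_keys_iff)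
        then show ?thesis using False i by (simp add: lookup_add lookup_rep lookup_single)
      qed
    qed
    then show "resonant n i a" by (auto simp: resonant_def)
  next
    assume "resonant n i a"
    then obtain k where a: "a = Poly_Mapping.single i 1 + rep n k" by (auto simp: resonant_def)
    have "mpow n l (rep n k) = (\<Prod>i<n. l i) ^ k" by (simp add: mpow_def lookup_rep prod_power_distrib)
    then show "mpow n l a = l i" unfolding a mpow_add mpow_single[OF i] by (simp add: l1)
  qed
  then show ?thesis using l1 unfolding nonresonant_def by blast
qed

lemma nonresonant_distinct:
  assumes "nonresonant n l" "i < n" "j < n" "l i = l j"
  shows "i = j"
proof -
  have "resonant n i (Poly_Mapping.single j 1)"
    using assms(1-3) assms(4)[symmetric] unfolding nonresonant_def
    by (metis keys_single lessThan_iff mdegree_single mpow_single order_refl singletonD subsetI zero_neq_one)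
  then obtain k where "Poly_Mapping.single j 1 = Poly_Mapping.single i 1 + rep n k" by (auto simp: resonant_def)
  from arg_cong[OF this, of "\<lambda>m. Poly_Mapping.lookup m i"] show ?thesis
    by (cases "i = j") (auto simp: lookup_add lookup_single)
qed

definition diag_of :: "nat \<Rightarrow> (nat \<Rightarrow> complex) \<Rightarrow> complex mat" where
  "diag_of n l = mat n n (\<lambda>(i, j). if i = j then l i else 0)"

lemma diag_of_carrier [simp]: "diag_of n l \<in> carrier_mat n n"
  by (simp add: diag_of_def)

lemma diag_linear_iff_diag_of: "diag_linear n l F \<longleftrightarrow> F \<in> endos n \<and> linear_part n F = diag_of n l"
  by (simp add: diag_linear_iff_linear_part diag_of_def)

lemma mult_mat_nth:
  assumes "A \<in> carrier_mat n n" "B \<in> carrier_mat n n" "i < n" "j < n"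
  shows "(A * B) $$ (i, j) = (\<Sum>k<n. A $$ (i, k) * B $$ (k, j))"
  using assms by (simp add: scalar_prod_def atLeast0LessThan)

lemma diag_of_mult_nth:
  assumes "B \<in> carrier_mat n n" "i < n" "j < n"
  shows "(diag_of n l * B) $$ (i, j) = l i * B $$ (i, j)"
proof -
  have "(diag_of n l * B) $$ (i, j) = (\<Sum>k<n. if i = k then l i * B $$ (k, j) else 0)"
    unfolding mult_mat_nth[OF diag_of_carrier assms]
    by (rule sum.cong) (use assms in \<open>auto simp: diag_of_def\<close>)
  then show ?thesis using assms by simp
qed

lemma unit_triangular_diagonalization:
  fixes T :: "complex mat"
  assumes T: "T \<in> carrier_mat n n" "upper_triangular T" "\<And>i. i < n \<Longrightarrow> T $$ (i, i) = l i"
    and l: "\<And>i j. i < n \<Longrightarrow> j < n \<Longrightarrow> l i = l j \<Longrightarrow> i = j"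
  shows "\<exists>U. U \<in> carrier_mat n n \<and> Determinant.det U = 1 \<and> U * T = diag_of n l * U"
proof -
  define U where "U X = mat n n (\<lambda>(i, j). if i = j then 1 else if i < j then X (i, j) else 0)"
    for X :: "nat \<times> nat \<Rightarrow> complex"
  have UC: "U X \<in> carrier_mat n n" for X by (simp add: U_def)
  have Ui: "U X $$ (i, j) = (if i = j then 1 else if i < j then X (i, j) else 0)" if "i < n" "j < n" for X i j
    using that by (simp add: U_def)
  have T0: "T $$ (i, j) = 0" if "j < i" "i < n" for i j
    using T(1,2) that by (auto simp: upper_triangular_def)
  define \<Phi> where "\<Phi> X = (\<lambda>(i, j). if i < j \<and> j < n
      then (\<Sum>k<n. U X $$ (i, k) * T $$ (k, j)) - l i * U X $$ (i, j) else X (i, j))" for X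
  define c where "c = (\<lambda>(i, j). if i < j \<and> j < n then l j - l i else 1)"
  have "\<exists>X. \<forall>p. \<Phi> X p = 0"
  proof (rule triangular_solution[where \<delta> = "\<lambda>(i :: nat, j). j" and c = c])
    fix X Y :: "nat \<times> nat \<Rightarrow> complex" and p
    assume eq: "\<And>p'. (case p' of (i :: nat, j) \<Rightarrow> j) < (case p of (i :: nat, j) \<Rightarrow> j) \<Longrightarrow> X p' = Y p'"
    obtain i j where p: "p = (i, j)" by (cases p)
    show "\<Phi> X p - \<Phi> Y p = c p * (X p - Y p)"
    proof (cases "i < j \<and> j < n")
      case True
      have "(\<Sum>k<n. U X $$ (i, k) * T $$ (k, j)) - (\<Sum>k<n. U Y $$ (i, k) * T $$ (k, j))
          = (\<Sum>k<n. if k = j then (X (i, j) - Y (i, j)) * l j else 0)"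
        unfolding sum_subtractf[symmetric]
      proof (rule sum.cong)
        fix k assume k: "k \<in> {..<n}"
        consider "k < j" | "k = j" | "j < k" by linarith
        then show "U X $$ (i, k) * T $$ (k, j) - U Y $$ (i, k) * T $$ (k, j)
            = (if k = j then (X (i, j) - Y (i, j)) * l j else 0)"
        proof cases
          case 1
          then have "X (i, k) = Y (i, k)" using eq[of "(i, k)"] by (simp add: p)
          then show ?thesis using 1 k True by (simp add: Ui)
        qed (use k True T(3) T0 in \<open>auto simp: Ui algebra_simps\<close>)
      qed simp
      then show ?thesis
        using True by (simp add: \<Phi>_def p c_def Ui algebra_simps)
    qed (auto simp: \<Phi>_def p c_def)
  next
    fix p show "c p \<noteq> 0" using l[of "snd p" "fst p"] by (auto simp: c_def split: prod.splits)
  qed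
  then obtain X where X: "\<And>p. \<Phi> X p = 0" by blast
  have "U X * T = diag_of n l * U X"
  proof (rule eq_matI)
    fix i j assume "i < dim_row (diag_of n l * U X)" "j < dim_col (diag_of n l * U X)"
    then have ij: "i < n" "j < n" by (auto simp: diag_of_def U_def)
    have "(\<Sum>k<n. U X $$ (i, k) * T $$ (k, j)) = l i * U X $$ (i, j)"
    proof (cases "i < j")
      case True
      then show ?thesis using X[of "(i, j)"] ij by (simp add: \<Phi>_def)
    next
      case False
      have "(\<Sum>k<n. U X $$ (i, k) * T $$ (k, j)) = (\<Sum>k<n. if k = i then (if i = j then l i else 0) else 0)"
      proof (rule sum.cong)
        fix k assume k: "k \<in> {..<n}"
        consider "k < i" | "k = i" | "i < k" by linarith
        then show "U X $$ (i, k) * T $$ (k, j) = (if k = i then (if i = j then l i else 0) else 0)"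
          by cases (use k ij False T(3) T0 in \<open>auto simp: Ui\<close>)
      qed simp
      then show ?thesis using ij False by (simp add: Ui)
    qed
    then show "(U X * T) $$ (i, j) = (diag_of n l * U X) $$ (i, j)"
      by (simp only: mult_mat_nth[OF UC T(1) ij] diag_of_mult_nth[OF UC ij])
  qed (use T(1) in \<open>auto simp: diag_of_def U_def\<close>)
  moreover have "Determinant.det (U X) = 1"
  proof -
    have "upper_triangular (U X)" by (auto simp: upper_triangular_def U_def)
    then have "Determinant.det (U X) = prod_list (diag_mat (U X))" using det_upper_triangular UC by blast
    also have "\<dots> = (\<Prod>i<n. U X $$ (i, i))"
      using UC[of X] by (simp add: diag_mat_def prod.distinct_set_conv_list[symmetric] atLeast0LessThan)
    finally show ?thesis by (simp add: Ui)
  qed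
  ultimately show ?thesis using UC by blast
qed

lemma linear_map_carrier:
  assumes "A \<in> carrier_mat n n" "B \<in> carrier_mat n n" "A * B = 1\<^sub>m n" "B * A = 1\<^sub>m n"
  shows "linear_map n A \<in> carrier (formal_maps n)"
    and "inv\<^bsub>formal_maps n\<^esub> (linear_map n A) = linear_map n B"
proof -
  have c: "linear_map n A \<in> carrier (formal_maps n)" "linear_map n B \<in> carrier (formal_maps n)"
    using assms invertible_matI[of A n B] invertible_matI[of B n A]
    by (auto simp: carrier_formal_maps linear_part_linear_map)
  then show "linear_map n A \<in> carrier (formal_maps n)" by simp
  show "inv\<^bsub>formal_maps n\<^esub> (linear_map n A) = linear_map n B"
    using c assms by (intro formal_maps.inv_equality) (auto simp: mcomp_linear_map linear_map_1)
qed

lemma linear_part_conj: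
  assumes A: "A \<in> carrier_mat n n" "B \<in> carrier_mat n n" "A * B = 1\<^sub>m n" "B * A = 1\<^sub>m n"
    and F: "F \<in> endos n"
  shows "linear_part n (linear_map n A \<otimes>\<^bsub>formal_maps n\<^esub> F \<otimes>\<^bsub>formal_maps n\<^esub> inv\<^bsub>formal_maps n\<^esub> (linear_map n A))
       = A * linear_part n F * B"
  using A F by (simp add: linear_map_carrier(2)[OF A] linear_part_mcomp mcomp_endos linear_part_linear_map)

lemma sr_product_triangular:
  assumes n: "n \<ge> 2" "n \<le> 2 ^ c" and F: "F \<in> carrier (formal_maps n)"
    and T: "upper_triangular (linear_part n F)" "Determinant.det (linear_part n F) = 1"
  shows "sr_product (formal_maps n) (2 + 2 * c) F"
proof -
  let ?G = "formal_maps n" and ?T = "linear_part n F"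
  obtain l :: "nat \<Rightarrow> complex" where nr: "nonresonant n l" and l1: "(\<Prod>i<n. l i) = 1"
    using nonresonant_exists[OF n(1)] by blast
  have l0: "l i \<noteq> 0" if "i < n" for i using l1 that by (metis finite_lessThan lessThan_iff prod_zero_iff zero_neq_one)
  have Fe: "F \<in> endos n" using F by (simp add: carrier_formal_maps)
  have TC: "?T \<in> carrier_mat n n" by simp
  have "Determinant.det ?T = (\<Prod>i<n. ?T $$ (i, i))"
    using det_upper_triangular[OF T(1) TC]
    by (simp add: diag_mat_def prod.distinct_set_conv_list[symmetric] atLeast0LessThan) (simp add: linear_part_def)
  then have T1: "(\<Prod>i<n. ?T $$ (i, i)) = 1" using T(2) by simp
  have T0: "?T $$ (i, i) \<noteq> 0" if "i < n" for i
    using T1 that by (metis finite_lessThan lessThan_iff prod_zero_iff zero_neq_one)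
  define d where "d i = ?T $$ (i, i) / l i" for i
  have d0: "d i \<noteq> 0" if "i < n" for i using that T0 l0 by (simp add: d_def)
  let ?D = "mult_map n (\<lambda>i. fps_const (d i))" and ?D' = "mult_map n (\<lambda>i. fps_const (inverse (d i)))"
  have d1: "(\<Prod>i<n. d i) = 1" by (simp add: d_def prod_dividef T1 l1)
  have pc: "(\<Prod>i<n. fps_const (e i)) = fps_const (\<Prod>i<n. e i)" for e :: "nat \<Rightarrow> complex"
    by (induction n) (auto simp: fps_const_mult[symmetric] simp del: fps_const_mult)
  have D: "sr_product ?G c ?D"
    by (rule sr_product_mult_map[OF n]) (auto simp: d0 pc d1)
  have DD: "mcomp n ?D ?D' = vec n mvar"
  proof -
    have "mcomp n ?D ?D' = mult_map n (\<lambda>_. 1)"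
      using n by (subst mult_map_mcomp) (auto intro!: mult_map_cong simp: d0)
    then show ?thesis using n by (simp add: mult_map_1)
  qed
  define F1 where "F1 = mcomp n ?D' F"
  have D'l: "diag_linear n (\<lambda>i. inverse (d i)) ?D'"
    using diag_linear_mult_map[OF n(1), of "\<lambda>i. fps_const (inverse (d i))"] by simp
  have D'c: "?D' \<in> carrier ?G" using d0 by (intro mult_map_carrier n) auto
  have F1c: "F1 \<in> carrier ?G" using formal_maps.m_closed[OF D'c F] by (simp add: F1_def)
  have F1e: "F1 \<in> endos n" using F1c by (simp add: carrier_formal_maps)
  have DF: "mcomp n ?D F1 = F" using Fe by (simp add: F1_def mcomp_assoc[symmetric] DD id_mcomp)
  have "linear_part n F1 = diag_of n (\<lambda>i. inverse (d i)) * ?T"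
    using D'l Fe by (simp add: F1_def linear_part_mcomp diag_linear_iff_diag_of)
  then have T1i: "linear_part n F1 $$ (i, j) = inverse (d i) * ?T $$ (i, j)" if "i < n" "j < n" for i j
    using that by (simp add: diag_of_mult_nth)
  have "upper_triangular (linear_part n F1)"
    using T(1) T1i by (auto simp: upper_triangular_def) (simp add: linear_part_def)
  moreover have "linear_part n F1 $$ (i, i) = l i" if "i < n" for i
    using that T0 l0 by (simp add: T1i d_def)
  ultimately obtain U where U: "U \<in> carrier_mat n n" "Determinant.det U = 1" "U * linear_part n F1 = diag_of n l * U"
    using unit_triangular_diagonalization[of "linear_part n F1" n l] nonresonant_distinct[OF nr] by auto
  define V where "V = adj_mat U"
  have V: "V \<in> carrier_mat n n" "U * V = 1\<^sub>m n" "V * U = 1\<^sub>m n"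
    using adj_mat[OF U(1)] U(2) by (auto simp: V_def)
  note UV = linear_map_carrier[OF U(1) V]
  define F2 where "F2 = linear_map n U \<otimes>\<^bsub>?G\<^esub> F1 \<otimes>\<^bsub>?G\<^esub> inv\<^bsub>?G\<^esub> (linear_map n U)"
  have F2e: "F2 \<in> endos n"
    using F1e by (simp add: F2_def UV mcomp_endos)
  have "linear_part n F2 = diag_of n l * U * V"
    unfolding F2_def linear_part_conj[OF U(1) V F1e] U(3) ..
  also have "\<dots> = diag_of n l * (U * V)" using U V by (intro assoc_mult_mat[of _ n n _ n _ n]) auto
  also have "\<dots> = diag_of n l" by (simp add: V(2) right_mult_one_mat[OF diag_of_carrier])
  finally have "sr_product ?G (2 + c) F2"
    using sr_product_nonresonant[OF n nr l1] F2e by (simp add: diag_linear_iff_diag_of)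
  then have "sr_product ?G (2 + c) F1"
    using formal_maps.sr_product_conj_iff[OF F1c UV(1)] by (simp only: F2_def)
  from formal_maps.sr_product_mult[OF D this] show ?thesis by (simp add: DF mult_2 add_ac)
qed

lemma sr_product_det_1:
  assumes n: "n \<ge> 2" "n \<le> 2 ^ c" and F: "F \<in> carrier (formal_maps n)"
    and det: "Determinant.det (linear_part n F) = 1"
  shows "sr_product (formal_maps n) (2 + 2 * c) F"
proof -
  let ?G = "formal_maps n" and ?A = "linear_part n F"
  have AC: "?A \<in> carrier_mat n n" by simp
  obtain es where es: "char_poly ?A = (\<Prod>e\<leftarrow>es. [:- e, 1:])"
    using char_poly_factorized[OF AC] by blast
  obtain T P Q where "schur_decomposition ?A es = (T, P, Q)" by (metis prod_cases3)
  from schur_decomposition[OF AC es this] have sim: "similar_mat_wit ?A T P Q" and T: "upper_triangular T" by auto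
  note S = similar_mat_witD2[OF AC sim]
  have QAP: "Q * ?A * P = T"
    using similar_mat_witD2(3)[OF S(5) similar_mat_wit_sym[OF sim]] by simp
  have detT: "Determinant.det T = 1"
    using det_similar[of ?A T] sim det by (auto simp: similar_mat_def)
  note Qc = linear_map_carrier[OF S(7,6,2,1)]
  let ?F = "linear_map n Q \<otimes>\<^bsub>?G\<^esub> F \<otimes>\<^bsub>?G\<^esub> inv\<^bsub>?G\<^esub> (linear_map n Q)"
  have Fe: "F \<in> endos n" using F by (simp add: carrier_formal_maps)
  have L: "linear_part n ?F = T" using linear_part_conj[OF S(7,6,2,1) Fe] QAP by simp
  have "?F \<in> carrier ?G"
    using Qc(1) F by (intro formal_maps.m_closed formal_maps.inv_closed)
  from sr_product_triangular[OF n this] L T detT have "sr_product ?G (2 + 2 * c) ?F" by simp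
  then show ?thesis by (rule formal_maps.sr_product_conj_iff[OF F Qc(1)])
qed

theorem theorem1p4:
  fixes n c :: nat and F :: "complex mfps vec"
  assumes "n \<ge> 2"
    and "F \<in> carrier (formal_maps n)"
    and "Determinant.det (linear_part n F) = 1"
    and "int c = \<lceil>log 2 (real n)\<rceil>"
  shows "product_of (formal_maps n) (1 + 3 * c) (reversible (formal_maps n)) F
       \<and> product_of (formal_maps n) (8 + 6 * c) (involution (formal_maps n)) F"
proof -
  have "log 2 (real n) \<le> real c"
    using assms(4) by (metis le_of_int_ceiling of_int_of_nat_eq)
  then have "real n \<le> 2 powr real c" using assms(1) by (simp add: log_le_iff)
  then have nc: "n \<le> 2 ^ c" by (simp add: powr_realpow)
  have "c \<ge> 1" using nc assms(1) by (cases c) auto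
  have sr: "sr_product (formal_maps n) (2 + 2 * c) F"
    by (rule sr_product_det_1[OF assms(1) nc assms(2,3)])
  have "sr_product (formal_maps n) (1 + 3 * c) F"
    using formal_maps.sr_product_pad[OF sr] \<open>c \<ge> 1\<close> by simp
  then have 1: "product_of (formal_maps n) (1 + 3 * c) (reversible (formal_maps n)) F"
    by (rule product_of_mono) (rule formal_maps.strongly_reversible_imp_reversible)
  have "sr_product (formal_maps n) (4 + 3 * c) F"
    using formal_maps.sr_product_pad[OF sr] by simp
  from formal_maps.sr_product_imp_involution_product[OF this]
  have "product_of (formal_maps n) (8 + 6 * c) (involution (formal_maps n)) F"
    by (simp add: algebra_simps)
  with 1 show ?thesis ..
qed

end
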